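(* For $N=3$ particles with velocities in $\mathbb{R}^3$ and $\alpha=2$, the spectral gap $\hat\Delta_{3,2}$ of the conjugate Kac process satisfies $\hat\Delta_{3,2}\ge 0.01984$. Explicitly: for every real-valued $f\in L^2(\mathcal S_3,\sigma_3)$ with $\int_{\mathcal S_3} f\,d\sigma_3=0$, $$\frac13\sum_{k=1}^3\int_{\mathcal S_3} w_3(v_k)\,\big[f^2-f\,P_kf\big]\,d\sigma_3\;\ge\;0.01984\int_{\mathcal S_3} f^2\,d\sigma_3 .$$
   Context: State space: $\mathcal S_3=\{\vec v=(v_1,v_2,v_3)\in(\mathbb R^3)^3:\ v_1+v_2+v_3=0,\ |v_1|^2+|v_2|^2+|v_3|^2=3\}$, a $5$-dimensional sphere of radius $\sqrt3$ in the $6$-dimensional subspace $\{v_1+v_2+v_3=0\}$ of $\mathbb R^9$. $\sigma_3$ is the uniform (rotation invariant) probability measure on $\mathcal S_3$. For $k=1,2,3$, $P_k$ is the conditional expectation $P_kf=\mathbb E[f\mid v_k]$ with respect to $\sigma_3$, i.e. the orthogonal projection in $L^2(\sigma_3)$ onto the subspace of square integrable functions depending on $v_k$ only. Weight: for general $N$, $w_N(v_k)=\dfrac{N^2-(1+|v_k|^2)N}{(N-1)^2}$; for $N=3$, $w_3(v_k)=\frac32-\frac34|v_k|^2$. The conjugate Kac process with $\alpha=2$ is the reversible Markov jump process with (bounded, self-adjoint) generator $\hat L_{3,2}f=-\frac13\sum_{k=1}^3 w_3(v_k)\,[f-P_kf]$: at rate $\frac13w_3(v_k)$ the velocity $v_k$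 is kept and the others are resampled uniformly conditionally on $v_k$. Its spectral gap is $$\hat\Delta_{3,2}=\inf\Big\{-\langle f,\hat L_{3,2}f\rangle_{L^2(\sigma_3)}:\ \langle f,1\rangle_{L^2(\sigma_3)}=0,\ \|f\|_{L^2(\sigma_3)}=1\Big\}.$$ *)

theory Defs
  imports "HOL-Probability.Probability"
begin

section \<open>State space and uniform measure\<close>

text \<open>A velocity configuration $(v_1,v_2,v_3) \in (\mathbb{R}^3)^3$ is an element of
  \<^typ>\<open>real^3^3\<close>; \<open>v $ k\<close> is the velocity of particle \<open>k\<close>.\<close>

definition momentum_space :: "(real^3^3) set" where
  "momentum_space = {v. (\<Sum>k\<in>UNIV. v $ k) = 0}"

definition state_space3 :: "(real^3^3) set" where
  "state_space3 = {v. (\<Sum>k\<in>UNIV. v $ k) = 0 \<and> (\<Sum>k\<in>UNIV. (norm (v $ k))\<^sup>2) = 3}"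

text \<open>Normalized surface measure of the unit sphere of a Euclidean space, as the cone measure:
  the radial projection of the uniform distribution on the unit ball.\<close>

definition uniform_sphere :: "'a::euclidean_space measure" where
  "uniform_sphere = distr (uniform_measure lborel (ball 0 1)) borel sgn"

text \<open>Jacobi coordinates: a linear isometry of $\mathbb{R}^3 \times \mathbb{R}^3$ onto the
  six-dimensional space of configurations with zero total momentum.\<close>

definition jacobi :: "(real^3) \<times> (real^3) \<Rightarrow> real^3^3" where
  "jacobi = (\<lambda>(x, y). vector
     [(1 / sqrt 2) *\<^sub>R x - (1 / sqrt 6) *\<^sub>R y,
      - (1 / sqrt 2) *\<^sub>R x - (1 / sqrt 6) *\<^sub>R y,
      (2 / sqrt 6) *\<^sub>R y])"

text \<open>The uniform probability measure on the state space. Its rotation invariance, which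
  characterizes it, is lemma \<open>sigma3_rotation_invariant\<close> below.\<close>

definition sigma3 :: "(real^3^3) measure" where
  "sigma3 = restrict_space (distr uniform_sphere borel (\<lambda>z. sqrt 3 *\<^sub>R jacobi z)) state_space3"


section \<open>The conjugate Kac process for three particles\<close>

text \<open>Conditional expectation given \<open>v $ k\<close>; determined up to \<open>sigma3\<close>-null sets.\<close>

definition sigma_alg_v :: "3 \<Rightarrow> (real^3^3) measure" where
  "sigma_alg_v k = vimage_algebra state_space3 (\<lambda>v. v $ k) borel"

definition P_cond :: "3 \<Rightarrow> (real^3^3 \<Rightarrow> real) \<Rightarrow> real^3^3 \<Rightarrow> real" where
  "P_cond k f = real_cond_exp sigma3 (sigma_alg_v k) f"

definition kac_weight :: "nat \<Rightarrow> real^3 \<Rightarrow> real" where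
  "kac_weight N x = ((real N)\<^sup>2 - (1 + (norm x)\<^sup>2) * real N) / (real N - 1)\<^sup>2"

definition conj_kac_gen :: "(real^3^3 \<Rightarrow> real) \<Rightarrow> real^3^3 \<Rightarrow> real" where
  "conj_kac_gen f = (\<lambda>v. - (1/3) * (\<Sum>k\<in>UNIV. kac_weight 3 (v $ k) * (f v - P_cond k f v)))"

text \<open>Square integrable functions; representatives are not identified up to null sets.\<close>

definition L2_sigma3 :: "(real^3^3 \<Rightarrow> real) set" where
  "L2_sigma3 = {f. f \<in> borel_measurable sigma3 \<and> integrable sigma3 (\<lambda>v. (f v)\<^sup>2)}"

definition inner_sigma3 :: "(real^3^3 \<Rightarrow> real) \<Rightarrow> (real^3^3 \<Rightarrow> real) \<Rightarrow> real" where
  "inner_sigma3 f g = (\<integral>v. f v * g v \<partial>sigma3)"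

text \<open>The infimum is taken in the reals: the set is nonempty, and it is bounded below by 0 since
  the weights are nonnegative on the state space.\<close>

definition conj_kac_gap :: real where
  "conj_kac_gap = Inf {- inner_sigma3 f (conj_kac_gen f) | f.
     f \<in> L2_sigma3 \<and> inner_sigma3 f (\<lambda>_. 1) = 0 \<and> sqrt (inner_sigma3 f f) = 1}"


section \<open>Basic properties of the definitions\<close>

lemma kac_weight_3: "kac_weight 3 x = 3/2 - 3/4 * (norm x)\<^sup>2"
  by (simp add: kac_weight_def field_simps)

lemma space_sigma3: "space sigma3 = state_space3"
  by (simp add: sigma3_def space_restrict_space)

lemma closed_state_space3: "closed state_space3"
  unfolding state_space3_def by (intro closed_Collect_conj closed_Collect_eq continuous_intros)

lemma state_space3_borel [measurable]: "state_space3 \<in> sets borel"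
  using closed_state_space3 by (rule borel_closed)

lemma sets_sigma3: "sets sigma3 = sets (restrict_space borel state_space3)"
  unfolding sigma3_def by (intro sets_restrict_space_cong) simp

lemma subalgebra_sigma_alg_v: "subalgebra sigma3 (sigma_alg_v k)"
proof -
  have "(\<lambda>v. v $ k) \<in> measurable sigma3 borel"
    by (subst measurable_cong_sets[OF sets_sigma3 refl], rule measurable_restrict_space1,
        intro borel_measurable_continuous_onI continuous_intros)
  then have "sets (vimage_algebra (space sigma3) (\<lambda>v. v $ k) borel) \<subseteq> sets sigma3"
    by (auto simp: sets_vimage_algebra2 measurable_sets)
  then show ?thesis
    by (simp add: subalgebra_def sigma_alg_v_def space_sigma3)
qed

lemma jacobi_nth:
  "jacobi (x, y) $ 1 = (1 / sqrt 2) *\<^sub>R x - (1 / sqrt 6) *\<^sub>R y"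
  "jacobi (x, y) $ 2 = - (1 / sqrt 2) *\<^sub>R x - (1 / sqrt 6) *\<^sub>R y"
  "jacobi (x, y) $ 3 = (2 / sqrt 6) *\<^sub>R y"
  by (simp_all add: jacobi_def vector_3)

lemma linear_jacobi: "linear jacobi"
proof (rule linearI)
  show "jacobi (a + b) = jacobi a + jacobi b" for a b
    by (cases a; cases b)
       (simp add: vec_eq_iff[of "jacobi _"] forall_3 jacobi_nth algebra_simps)
  show "jacobi (c *\<^sub>R a) = c *\<^sub>R jacobi a" for c a
    by (cases a)
       (simp add: vec_eq_iff[of "jacobi _"] forall_3 jacobi_nth algebra_simps)
qed

lemma jacobi_momentum: "jacobi z \<in> momentum_space"
proof -
  have "(2 / sqrt 6) *\<^sub>R y = (1 / sqrt 6) *\<^sub>R y + (1 / sqrt 6) *\<^sub>R y" for y :: "real^3"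
    by (simp flip: scaleR_left_distrib)
  then show ?thesis
    by (cases z) (simp add: momentum_space_def sum_3 jacobi_nth)
qed

lemma inner_jacobi: "jacobi a \<bullet> jacobi b = a \<bullet> b"
proof -
  obtain x y x' y' where ab: "a = (x, y)" "b = (x', y')" by (cases a, cases b)
  have s: "sqrt 2 * sqrt 2 = 2" "sqrt 6 * sqrt 6 = (6::real)" by simp_all
  show ?thesis
    by (simp add: ab inner_vec_def[of "jacobi _"] sum_3 jacobi_nth inner_simps s field_simps
        del: real_sqrt_mult_self)
qed

lemma norm_jacobi: "norm (jacobi z) = norm z"
  by (simp add: norm_eq_sqrt_inner inner_jacobi)

definition jacobi_inv :: "real^3^3 \<Rightarrow> (real^3) \<times> (real^3)" where
  "jacobi_inv v = ((1 / sqrt 2) *\<^sub>R (v $ 1 - v $ 2), (1 / sqrt 6) *\<^sub>R (2 *\<^sub>R (v $ 3) - v $ 1 - v $ 2))"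

lemma linear_jacobi_inv: "linear jacobi_inv"
  by (rule linearI) (simp_all add: jacobi_inv_def algebra_simps)

lemma jacobi_jacobi_inv:
  assumes "v \<in> momentum_space" shows "jacobi (jacobi_inv v) = v"
proof -
  have v3: "v $ 3 = - v $ 1 - v $ 2"
    using assms by (simp add: momentum_space_def sum_3 eq_neg_iff_add_eq_0 algebra_simps)
  show ?thesis
    unfolding vec_eq_iff[of "jacobi _"] forall_3 jacobi_inv_def jacobi_nth v3
    by (auto simp: vec_eq_iff field_simps)
qed

lemma jacobi_state_space3: "norm z = 1 \<Longrightarrow> sqrt 3 *\<^sub>R jacobi z \<in> state_space3"
  using jacobi_momentum[of z] norm_jacobi[of z]
  by (simp add: state_space3_def momentum_space_def norm_vec_def[of "jacobi z"] L2_set_def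
      power_mult_distrib flip: scaleR_sum_right sum_distrib_left)

lemma prob_space_unif_ball:
  "prob_space (uniform_measure lborel (ball 0 1 :: 'a::euclidean_space set))"
proof (rule prob_space_uniform_measure)
  show "emeasure lborel (ball 0 1 :: 'a set) \<noteq> 0"
    using content_ball_pos[of 1 "0::'a"] by (auto simp: measure_def)
  show "emeasure lborel (ball 0 1 :: 'a set) \<noteq> \<infinity>"
    using emeasure_lborel_ball_finite[of "0::'a" 1] by (simp add: less_top)
qed

lemma measurable_sgn' [measurable]: "sgn \<in> borel_measurable (borel :: 'a::euclidean_space measure)"
  unfolding sgn_div_norm[abs_def] by measurable

lemma measurable_jacobi [measurable]: "jacobi \<in> borel_measurable borel"
  using linear_jacobi by (intro borel_measurable_continuous_onI linear_continuous_on) (simp add: linear_conv_bounded_linear)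

lemma prob_space_uniform_sphere: "prob_space (uniform_sphere :: 'a::euclidean_space measure)"
  unfolding uniform_sphere_def by (intro prob_space.prob_space_distr prob_space_unif_ball) simp

lemma sets_uniform_sphere [measurable_cong, simp]: "sets uniform_sphere = sets borel"
  by (simp add: uniform_sphere_def)

lemma AE_uniform_sphere: "AE z in uniform_sphere. norm (z::'a::euclidean_space) = 1"
proof -
  have "AE z in lborel. z \<noteq> (0::'a)"
    by (rule AE_I[of _ _ "{0}"]) auto
  then have "AE z in uniform_measure lborel (ball 0 1). z \<noteq> (0::'a)"
    by (intro AE_uniform_measureI) auto
  then show ?thesis
    unfolding uniform_sphere_def by (subst AE_distr_iff) (auto simp: norm_sgn)
qed

lemma AE_state_space3:
  "AE v in distr uniform_sphere borel (\<lambda>z. sqrt 3 *\<^sub>R jacobi z). v \<in> state_space3"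
  by (subst AE_distr_iff) (auto intro: AE_mp[OF AE_uniform_sphere] jacobi_state_space3)

lemma prob_space_sigma3: "prob_space sigma3"
  unfolding sigma3_def
proof (rule prob_space_restrict_space)
  interpret D: prob_space "distr uniform_sphere borel (\<lambda>z. sqrt 3 *\<^sub>R jacobi z)"
    by (intro prob_space.prob_space_distr prob_space_uniform_sphere) simp
  show "emeasure (distr uniform_sphere borel (\<lambda>z. sqrt 3 *\<^sub>R jacobi z)) state_space3 = 1"
    using AE_state_space3 by (intro D.emeasure_eq_1_AE) simp
qed simp

lemma lborel_orthogonal_vec:
  fixes T :: "real^'n::{finite,wellorder} \<Rightarrow> real^'n::_"
  assumes T: "orthogonal_transformation T"
  shows "distr lborel borel T = lborel"
proof (rule lborel_eqI[symmetric])
  fix l u :: "real^'n::_" assume lu: "\<And>b. b \<in> Basis \<Longrightarrow> l \<bullet> b \<le> u \<bullet> b"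
  have bij: "bij T" and lin: "linear T"
    using T orthogonal_transformation_bij orthogonal_transformation_linear by auto
  have inv: "orthogonal_transformation (inv T)"
    using T by (rule orthogonal_transformation_inv)
  have meas: "T \<in> borel_measurable borel"
    using lin by (intro borel_measurable_continuous_onI linear_continuous_on)
       (simp add: linear_conv_bounded_linear)
  have vim: "T -` box l u = inv T ` box l u"
    using bij by (simp add: bij_vimage_eq_inv_image)
  have vb: "T -` box l u \<in> sets borel"
    using measurable_sets[OF meas, of "box l u"] by simp
  have "emeasure (distr lborel borel T) (box l u) = emeasure lebesgue (T -` box l u)"
    using meas vb by (simp add: emeasure_distr)
  also have "\<dots> = ennreal (measure lebesgue (T -` box l u))"
    unfolding vim
    by (intro emeasure_eq_measure2 fmeasurableD2 measurable_orthogonal_image[OF inv]) simp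
  also have "\<dots> = ennreal (measure lebesgue (box l u))"
    unfolding vim by (simp add: measure_orthogonal_image[OF inv])
  also have "\<dots> = (\<Prod>b\<in>Basis. (u - l) \<bullet> b)"
    using lu by (simp add: measure_lborel_box_eq)
  finally show "emeasure (distr lborel borel T) (box l u) = (\<Prod>b\<in>Basis. (u - l) \<bullet> b)" .
qed simp

text \<open>Linear isometries of $\mathbb{R}^3 \times \mathbb{R}^3$ preserve Lebesgue measure; this is
  transported from \<^typ>\<open>real^6\<close> by a relabelling of coordinates.\<close>

definition relabel :: "(3 + 3 \<Rightarrow> 6) \<Rightarrow> real^6 \<Rightarrow> (real^3) \<times> (real^3)" where
  "relabel g w = ((\<chi> i. w $ g (Inl i)), (\<chi> i. w $ g (Inr i)))"

lemma lborel_relabel: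
  fixes g :: "3 + 3 \<Rightarrow> 6"
  assumes g: "bij g"
  shows "distr lborel borel (relabel g) = lborel"
    and "linear (relabel g)" and "relabel g a \<bullet> relabel g b = a \<bullet> b" and "bij (relabel g)"
proof -
  have rg: "(\<Sum>j\<in>UNIV. f j) = (\<Sum>i\<in>UNIV. f (g (Inl i))) + (\<Sum>i\<in>UNIV. f (g (Inr i)))"
    for f :: "6 \<Rightarrow> real"
    using g by (subst sum.reindex_bij_betw[OF g, symmetric]) (simp add: sum.Plus flip: UNIV_Plus_UNIV)
  show lin: "linear (relabel g)"
    by (rule linearI) (simp_all add: relabel_def vec_eq_iff)
  show inn: "relabel g a \<bullet> relabel g b = a \<bullet> b" for a b
    by (simp add: relabel_def inner_vec_def rg)
  have inj: "inj (relabel g)"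
  proof (rule injI)
    fix a b assume "relabel g a = relabel g b"
    then have "relabel g (a - b) = 0" by (simp add: linear_diff[OF lin])
    then have "(a - b) \<bullet> (a - b) = 0" using inn[of "a - b" "a - b"] by simp
    then show "a = b" by simp
  qed
  have surj: "surj (relabel g)"
  proof (rule surjI)
    show "relabel g (\<chi> j. case inv g j of Inl i \<Rightarrow> fst p $ i | Inr i \<Rightarrow> snd p $ i) = p" for p
      using g by (simp add: relabel_def bij_is_inj prod_eq_iff vec_eq_iff)
  qed
  show bij: "bij (relabel g)" using inj surj by (simp add: bij_def)
  have meas: "relabel g \<in> borel_measurable borel"
    using lin by (intro borel_measurable_continuous_onI linear_continuous_on)
       (simp add: linear_conv_bounded_linear)
  have axis: "relabel g (axis (g (Inl i)) 1) = (axis i 1, 0)"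
             "relabel g (axis (g (Inr i)) 1) = (0, axis i 1)" for i
    using g by (auto simp: relabel_def axis_def vec_eq_iff bij_is_inj inj_eq)
  have B: "relabel g ` Basis = Basis"
  proof -
    have "Basis = (\<lambda>s. axis (g s) 1 :: real^6) ` UNIV"
      using g by (auto simp: Basis_vec_def bij_def image_iff) (metis surjD)
    also have "\<dots> = (\<lambda>i. axis (g (Inl i)) 1) ` UNIV \<union> (\<lambda>i. axis (g (Inr i)) 1) ` UNIV"
      by (auto simp: image_iff) (metis sum.exhaust)+
    finally have "relabel g ` Basis = relabel g ` ((\<lambda>i. axis (g (Inl i)) 1) ` UNIV \<union> (\<lambda>i. axis (g (Inr i)) 1) ` UNIV)"
      by (rule arg_cong)
    then show ?thesis
      unfolding image_Un image_image axis by (auto simp: Basis_prod_def Basis_vec_def)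
  qed
  show "distr lborel borel (relabel g) = lborel"
  proof (rule lborel_eqI[symmetric])
    fix l' u' :: "(real^3) \<times> (real^3)" assume lu: "\<And>b. b \<in> Basis \<Longrightarrow> l' \<bullet> b \<le> u' \<bullet> b"
    obtain l u where lu': "l' = relabel g l" "u' = relabel g u" using surj by (metis surjD)
    have ball: "(\<forall>b\<in>Basis. P b) \<longleftrightarrow> (\<forall>b\<in>Basis. P (relabel g b))" for P
      by (subst B[symmetric]) simp
    have vim: "relabel g -` box l' u' = box l u"
      by (auto simp: box_def ball inn lu')
    have le: "l \<bullet> b \<le> u \<bullet> b" if "b \<in> Basis" for b
      using lu[of "relabel g b"] that B by (auto simp: lu' inn)
    have "emeasure (distr lborel borel (relabel g)) (box l' u') = (\<Prod>b\<in>Basis. (u - l) \<bullet> b)"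
      using meas le by (simp add: emeasure_distr vim emeasure_lborel_box_eq)
    also have "(\<Prod>b\<in>Basis. (u - l) \<bullet> b) = (\<Prod>b\<in>relabel g ` Basis. (u' - l') \<bullet> b)"
      using inj by (subst prod.reindex) (auto simp: inj_on_def inj_def lu' inn simp flip: linear_diff[OF lin])
    finally show "emeasure (distr lborel borel (relabel g)) (box l' u') = (\<Prod>b\<in>Basis. (u' - l') \<bullet> b)"
      by (simp add: B)
  qed simp
qed

lemma lborel_orthogonal_prod:
  fixes U :: "(real^3) \<times> (real^3) \<Rightarrow> (real^3) \<times> (real^3)"
  assumes U: "orthogonal_transformation U"
  shows "distr lborel borel U = lborel"
proof -
  have "\<exists>g :: 3 + 3 \<Rightarrow> 6. bij g"
    by (intro finite_same_card_bij) simp_all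
  then obtain g :: "3 + 3 \<Rightarrow> 6" where g: "bij g" ..
  note r = lborel_relabel[OF g]
  define V where "V = inv (relabel g) \<circ> U \<circ> relabel g"
  have inj: "inj (relabel g)" and fi: "relabel g (inv (relabel g) p) = p" for p
    using r(4) by (auto simp: bij_is_inj bij_is_surj surj_f_inv_f)
  have lin': "linear (inv (relabel g))"
    by (rule linearI; rule injD[OF inj]) (simp_all add: linear_add[OF r(2)] linear_cmul[OF r(2)] fi)
  have eV: "relabel g (V w) = U (relabel g w)" for w
    using r(4) by (simp add: V_def bij_is_surj surj_f_inv_f)
  have V: "orthogonal_transformation V"
    unfolding orthogonal_transformation_def
  proof (intro conjI allI)
    show "linear V"
      unfolding V_def using U r(2) lin' by (intro linear_compose) (auto simp: orthogonal_transformation_linear)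
    show "V v \<bullet> V w = v \<bullet> w" for v w
      using U by (metis eV orthogonal_transformation_def r(3))
  qed
  have lm: "f \<in> borel_measurable borel" if "linear f" for f :: "'x::euclidean_space \<Rightarrow> 'y::euclidean_space"
    using that by (intro borel_measurable_continuous_onI linear_continuous_on)
       (simp add: linear_conv_bounded_linear)
  have [measurable]: "U \<in> borel_measurable borel" "V \<in> borel_measurable borel"
      "relabel g \<in> borel_measurable borel"
    using U V r(2) by (auto intro: lm orthogonal_transformation_linear)
  have "distr lborel borel U = distr (distr lborel borel (relabel g)) borel U"
    by (simp add: r(1))
  also have "\<dots> = distr lborel borel (\<lambda>w. relabel g (V w))"
    by (simp add: distr_distr comp_def eV)
  also have "\<dots> = distr (distr lborel borel V) borel (relabel g)"
    by (simp add: distr_distr comp_def)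
  finally show ?thesis
    by (simp add: lborel_orthogonal_vec[OF V] r(1))
qed

lemma uniform_sphere_orthogonal:
  fixes U :: "(real^3) \<times> (real^3) \<Rightarrow> (real^3) \<times> (real^3)"
  assumes U: "orthogonal_transformation U"
  shows "distr uniform_sphere borel U = uniform_sphere"
proof -
  let ?B = "ball 0 1 :: ((real^3) \<times> (real^3)) set"
  have lin: "linear U" using U by (rule orthogonal_transformation_linear)
  have n: "norm (U z) = norm z" for z using U by (simp add: orthogonal_transformation_norm)
  have [measurable]: "U \<in> borel_measurable borel"
    using lin by (intro borel_measurable_continuous_onI linear_continuous_on)
       (simp add: linear_conv_bounded_linear)
  have sgnU: "U (sgn z) = sgn (U z)" for z
    by (simp add: sgn_div_norm n linear_cmul[OF lin])
  have "distr (uniform_measure lborel ?B) borel U = uniform_measure lborel ?B"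
  proof (rule measure_eqI)
    fix A assume "A \<in> sets (distr (uniform_measure lborel ?B) borel U)"
    then have A [measurable]: "A \<in> sets borel" by simp
    have UA [measurable]: "U -` A \<in> sets borel"
      using measurable_sets[of U borel borel A] by simp
    have "emeasure lborel (?B \<inter> U -` A) = emeasure (distr lborel borel U) (?B \<inter> A)"
    proof -
      have "?B \<inter> U -` A = U -` (?B \<inter> A)" by (simp add: set_eq_iff n)
      then show ?thesis by (subst emeasure_distr) simp_all
    qed
    then show "emeasure (distr (uniform_measure lborel ?B) borel U) A =
        emeasure (uniform_measure lborel ?B) A"
      by (simp add: emeasure_distr lborel_orthogonal_prod[OF U])
  qed simp
  moreover have "distr uniform_sphere borel U = distr (distr (uniform_measure lborel ?B) borel U) borel sgn"
    by (simp add: uniform_sphere_def distr_distr comp_def sgnU)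
  ultimately show ?thesis by (simp add: uniform_sphere_def)
qed

theorem sigma3_rotation_invariant:
  assumes T: "orthogonal_transformation T" and TM: "T ` momentum_space \<subseteq> momentum_space"
  shows "distr sigma3 sigma3 T = sigma3"
proof -
  let ?J = "\<lambda>z. sqrt 3 *\<^sub>R jacobi z"
  let ?D = "distr uniform_sphere borel ?J"
  define U where "U = jacobi_inv \<circ> T \<circ> jacobi"
  have lin: "linear T" using T by (rule orthogonal_transformation_linear)
  have JU: "jacobi (U z) = T (jacobi z)" for z
    unfolding U_def using TM jacobi_momentum[of z] by (auto intro!: jacobi_jacobi_inv)
  have U: "orthogonal_transformation U"
    unfolding orthogonal_transformation_def
  proof (intro conjI allI)
    show "linear U"
      unfolding U_def by (intro linear_compose linear_jacobi linear_jacobi_inv lin)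
    show "U v \<bullet> U w = v \<bullet> w" for v w
      using T by (simp add: JU inner_jacobi orthogonal_transformation_def flip: inner_jacobi[of "U v"])
  qed
  have [measurable]: "T \<in> borel_measurable borel" "U \<in> borel_measurable borel"
    using lin U by (auto intro!: borel_measurable_continuous_onI linear_continuous_on
        simp: orthogonal_transformation_linear simp flip: linear_conv_bounded_linear)
  have DT: "distr ?D borel T = ?D"
  proof -
    have "distr ?D borel T = distr uniform_sphere borel (\<lambda>z. ?J (U z))"
      by (simp add: distr_distr comp_def JU linear_cmul[OF lin])
    also have "\<dots> = distr (distr uniform_sphere borel U) borel ?J"
      by (simp add: distr_distr comp_def)
    finally show ?thesis by (simp add: uniform_sphere_orthogonal[OF U])
  qed
  have TS: "T v \<in> state_space3" if "v \<in> state_space3" for v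
  proof -
    have iff: "u \<in> state_space3 \<longleftrightarrow> u \<in> momentum_space \<and> (norm u)\<^sup>2 = 3" for u
      by (simp add: state_space3_def momentum_space_def norm_vec_def[of u] L2_set_def sum_nonneg)
    show ?thesis
      using that TM T by (auto simp: iff orthogonal_transformation_norm)
  qed
  have Tm: "T \<in> measurable sigma3 sigma3"
  proof -
    have "T \<in> measurable (restrict_space borel state_space3) (restrict_space borel state_space3)"
      by (intro measurable_restrict_space3) (auto intro: TS)
    then show ?thesis by (simp add: measurable_cong_sets[OF sets_sigma3 sets_sigma3])
  qed
  have em: "emeasure sigma3 A = emeasure ?D A" if "A \<in> sets borel" "A \<subseteq> state_space3" for A
    unfolding sigma3_def using that by (intro emeasure_restrict_space) auto
  show ?thesis
  proof (rule measure_eqI)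
    fix A assume "A \<in> sets (distr sigma3 sigma3 T)"
    then have A': "A \<in> sets sigma3" by simp
    then have A [measurable]: "A \<in> sets borel" and AS: "A \<subseteq> state_space3"
      by (auto simp: sets_sigma3 sets_restrict_space)
    have TA [measurable]: "T -` A \<in> sets borel"
      using measurable_sets[of T borel borel A] by simp
    have "emeasure (distr sigma3 sigma3 T) A = emeasure sigma3 (T -` A \<inter> state_space3)"
      using Tm A' by (simp add: emeasure_distr space_sigma3)
    also have "\<dots> = emeasure ?D (T -` A \<inter> state_space3)"
      by (intro em) auto
    also have "\<dots> = emeasure ?D (T -` A)"
      using AE_state_space3 by (intro emeasure_eq_AE) auto
    also have "\<dots> = emeasure (distr ?D borel T) A"
      by (simp add: emeasure_distr[of T ?D borel])
    also have "\<dots> = emeasure sigma3 A"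
      by (simp add: DT em AS)
    finally show "emeasure (distr sigma3 sigma3 T) A = emeasure sigma3 A" .
  qed simp
qed

end

theory Submission
  imports Defs
begin

text \<open>Write \<open>x\<^sub>k = v\<^sub>k / sqrt 2\<close> and \<open>s\<^sub>k = 1 - |x\<^sub>k|\<^sup>2\<close>; then \<open>w\<^sub>3(v\<^sub>k) = 3/2 s\<^sub>k\<close> and \<open>s\<^sub>1 + s\<^sub>2 + s\<^sub>3 = 3/2\<close>,
  so the claim is \<open>1/2 \<Sum> E[s\<^sub>k f P\<^sub>k f] \<le> c E[f\<^sup>2]\<close> with \<open>c = 3/4 - 0.01984 = 9127/12500\<close>. This reduces to a
  bound on functions of one velocity, namely on the operator \<open>T h(x) = 1/2 s(x) h(x) + E[s(y) h(y) | x]\<close> on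
  the unit ball, \<open>y\<close> being the rescaled velocity of a second particle. It is self-adjoint with respect to the
  law of \<open>x\<close> with density \<open>s\<close>, and \<open>T 1 = 3/4\<close>; it has to be shown that \<open>\<langle>h, T h\<rangle> \<le> c \<langle>h, h\<rangle>\<close> for \<open>h\<close>
  orthogonal to constants.

  Coupling the resampled velocities from \<open>x\<close> and \<open>x'\<close> with \<open>|x| = |x'|\<close> by the rotation that takes \<open>x\<close> to
  \<open>x'\<close> shows that \<open>T\<close> contracts a weighted angular Lipschitz seminorm by the factor \<open>c\<close>. For the radial part,
  two steps of \<open>T\<close> dominate a fixed positive functional, which makes the oscillation contract by a better factor up to
  an error controlled by the angular seminorm. Hence \<open>T\<^sup>m h = O(c\<^sup>m)\<close> uniformly for Lipschitz \<open>h\<close> orthogonal to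
  constants, and since \<open>m \<mapsto> \<parallel>T\<^sup>m h\<parallel>\<^sup>2\<close> is logarithmically convex, the bound holds for such \<open>h\<close> without a
  constant; Lipschitz functions are dense.\<close>

section \<open>The uniform measure on the two-sphere\<close>

text \<open>The obstacle sits at \<open>norm x = 1\<close>. There \<open>wt x = 0\<close>, so
  \<open>resample x w\<close> is \<open>- x / 2\<close> whatever \<open>w\<close> is, a point of
  weight \<open>3/4\<close>, and an angular seminorm without weight could not contract by a factor
  below \<open>3/4\<close>, which leaves no gap. The factor \<open>1 - wt x / 25\<close> equals
  \<open>1\<close> at \<open>x\<close> and \<open>97/100\<close> at \<open>- x / 2\<close>, which
  brings the contraction there to \<open>291/400\<close>. Elsewhere the gain comes from the axis of
  the coupling rotation: the component of a vector along the axis does not move. The radial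
  direction degenerates at the same place and also at \<open>x = 0\<close>, where one step sends
  \<open>wt\<close> to a single value; hence the use of two steps. Their oscillation factor is
  \<open>9/16 - 23/640 = 337/640\<close>, just below \<open>(9127/12500)^2\<close>, so the
  oscillation decays at the angular rate. A further difficulty is that the functions
  \<open>P_k f\<close> need not be orthogonal to constants one by one. Only their average is,
  because only the sum of the three weights is constant; the spectral bound is therefore applied to
  the average alone.\<close>

lemma borel_measurable_linear:
  fixes f :: "'a::euclidean_space \<Rightarrow> 'b::euclidean_space"
  assumes "linear f"
  shows "f \<in> borel_measurable borel"
  using assms by (intro borel_measurable_continuous_onI linear_continuous_on)
    (simp add: linear_conv_bounded_linear)

text \<open>A norm-preserving linear map commutes with \<open>sgn\<close> and pulls the unit ball
  back to the unit ball. Source and target may differ, so that the lemma covers rotations of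
  \<open>real^3\<close> as well as the change of coordinates \<open>vec3\<close>.\<close>

lemma distr_uniform_sphere_isometry:
  fixes J :: "'a::euclidean_space \<Rightarrow> 'b::euclidean_space"
  assumes lin: "linear J" and n: "\<And>z. norm (J z) = norm z"
    and leb: "distr lborel borel J = lborel"
  shows "distr uniform_sphere borel J = uniform_sphere"
proof -
  have [measurable]: "J \<in> borel_measurable borel"
    using lin by (rule borel_measurable_linear)
  have sgnJ: "J (sgn z) = sgn (J z)" for z
    by (simp add: sgn_div_norm n linear_cmul[OF lin])
  have vim: "J -` (ball 0 1 \<inter> A) = ball 0 1 \<inter> J -` A" for A
    by (simp add: set_eq_iff n)
  have em: "emeasure lborel (ball 0 1 \<inter> J -` A) = emeasure lborel (ball 0 1 \<inter> A)"
    if [measurable]: "A \<in> sets borel" for A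
  proof -
    have "emeasure lborel (ball 0 1 \<inter> A) = emeasure (distr lborel borel J) (ball 0 1 \<inter> A)"
      by (simp add: leb)
    also have "\<dots> = emeasure lborel (ball 0 1 \<inter> J -` A)"
      by (subst emeasure_distr) (simp_all add: vim del: vimage_Int)
    finally show ?thesis by simp
  qed
  have "distr (uniform_measure lborel (ball 0 1)) borel J = uniform_measure lborel (ball 0 1)"
  proof (rule measure_eqI)
    fix A assume "A \<in> sets (distr (uniform_measure lborel (ball 0 1)) borel J)"
    then have [measurable]: "A \<in> sets borel" by simp
    have [measurable]: "J -` A \<in> sets borel"
      using measurable_sets[of J borel borel A] by simp
    show "emeasure (distr (uniform_measure lborel (ball 0 1)) borel J) A =
        emeasure (uniform_measure lborel (ball 0 1)) A"
      using em[of A] em[of UNIV] by (simp add: emeasure_distr)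
  qed simp
  moreover have "distr uniform_sphere borel J =
      distr (distr (uniform_measure lborel (ball 0 1)) borel J) borel sgn"
    by (simp add: uniform_sphere_def distr_distr comp_def sgnJ)
  ultimately show ?thesis by (simp add: uniform_sphere_def)
qed

lemma uniform_sphere_orthogonal_vec:
  fixes R :: "real^'n::{finite,wellorder} \<Rightarrow> real^'n::_"
  assumes R: "orthogonal_transformation R"
  shows "distr uniform_sphere borel R = uniform_sphere"
  using R by (intro distr_uniform_sphere_isometry lborel_orthogonal_vec)
    (auto simp: orthogonal_transformation_linear orthogonal_transformation_norm)

section \<open>Archimedes: a coordinate of a uniform point of the two-sphere is uniform\<close>

definition vec3 :: "real \<times> real \<times> real \<Rightarrow> real^3" where
  "vec3 p = vector [fst p, fst (snd p), snd (snd p)]"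

lemma vec3_nth: "vec3 p $ 1 = fst p" "vec3 p $ 2 = fst (snd p)" "vec3 p $ 3 = snd (snd p)"
  by (simp_all add: vec3_def vector_3)

lemma linear_vec3: "linear vec3"
  by (rule linearI) (simp_all add: vec_eq_iff[of "vec3 _"] forall_3 vec3_nth)

lemma norm_vec3: "norm (vec3 p) = norm p"
  by (cases p) (simp add: norm_vec_def[of "vec3 _"] L2_set_def sum_3 vec3_nth norm_Pair)

lemma lborel_vec3: "distr lborel borel vec3 = lborel"
proof (rule lborel_eqI[symmetric])
  have Bas: "Basis = {axis 1 1, axis 2 1, axis 3 1 :: real^3}"
    by (auto simp: Basis_vec_def UNIV_3)
  have ne: "axis 1 1 \<noteq> (axis 2 1 :: real^3)" "axis 1 1 \<noteq> (axis 3 1 :: real^3)"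
    "axis 2 1 \<noteq> (axis 3 1 :: real^3)"
    by (auto simp: axis_eq_axis)
  fix l u :: "real^3" assume lu: "\<And>b. b \<in> Basis \<Longrightarrow> l \<bullet> b \<le> u \<bullet> b"
  have le: "l $ 1 \<le> u $ 1" "l $ 2 \<le> u $ 2" "l $ 3 \<le> u $ 3"
    using lu[of "axis 1 1"] lu[of "axis 2 1"] lu[of "axis 3 1"] by (auto simp: Bas inner_axis)
  have vim: "vec3 -` box l u = box (l $ 1) (u $ 1) \<times> box (l $ 2) (u $ 2) \<times> box (l $ 3) (u $ 3)"
    by (auto simp: box_def Bas inner_axis vec3_nth)
  have [measurable]: "vec3 \<in> borel_measurable borel"
    using linear_vec3 by (rule borel_measurable_linear)
  have "emeasure (distr lborel borel vec3) (box l u) =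
      emeasure (lborel \<Otimes>\<^sub>M (lborel \<Otimes>\<^sub>M lborel)) (vec3 -` box l u)"
    by (subst emeasure_distr) (simp_all add: lborel_prod)
  also have "\<dots> = ennreal (u $ 1 - l $ 1) * (ennreal (u $ 2 - l $ 2) * ennreal (u $ 3 - l $ 3))"
    unfolding vim using le
    by (subst lborel.emeasure_pair_measure_Times lborel_pair.emeasure_pair_measure_Times;
        simp add: lborel_prod; subst lborel_prod[symmetric];
        subst lborel.emeasure_pair_measure_Times; simp)
  also have "\<dots> = (\<Prod>b\<in>Basis. (u - l) \<bullet> b)"
    using le by (simp add: Bas ne inner_axis ennreal_mult' inner_diff_left)
  finally show "emeasure (distr lborel borel vec3) (box l u) = (\<Prod>b\<in>Basis. (u - l) \<bullet> b)" .
qed simp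

text \<open>Volume of a spherical sector by horizontal slices. The slice at height \<open>h\<close>
  is a disc of squared radius \<open>q h\<close>; the cone is the binding constraint for
  \<open>h < t\<close> and the sphere for \<open>h > t\<close>. In a product of copies of
  \<open>real\<close> Fubini splits off the height.\<close>

lemma emeasure_cone:
  fixes t :: real assumes t: "0 < t" "t < 1"
  shows "emeasure lborel {p::real \<times> real \<times> real. norm p < 1 \<and> t * norm p < fst p} =
    ennreal (2 * pi / 3 * (1 - t))"
proof -
  let ?A = "{p::real \<times> real \<times> real. norm p < 1 \<and> t * norm p < fst p}"
  define q where "q h = min (1 - h\<^sup>2) (h\<^sup>2 * (1 - t\<^sup>2) / t\<^sup>2)" for h :: real
  have [measurable]: "?A \<in> sets borel"
    by (intro borel_open open_Collect_conj open_Collect_less continuous_intros)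
  have A2: "?A \<in> sets (lborel \<Otimes>\<^sub>M lborel)"
    unfolding lborel_prod by simp
  have t2: "0 < t\<^sup>2" "t\<^sup>2 < 1" using t power_strict_mono[of t 1 2] by auto
  have slice: "Pair h -` ?A = (if 0 < h \<and> h < 1 then ball 0 (sqrt (q h)) else {})" for h
  proof -
    have "norm (h, w) < 1 \<and> t * norm (h, w) < h \<longleftrightarrow> 0 < h \<and> h < 1 \<and> norm w < sqrt (q h)"
      for w :: "real \<times> real"
    proof -
      have n: "norm (h, w) = sqrt (h\<^sup>2 + (norm w)\<^sup>2)" by (simp add: norm_Pair)
      have 1: "norm (h, w) < 1 \<longleftrightarrow> h\<^sup>2 + (norm w)\<^sup>2 < 1"
        unfolding n by simp
      have 2: "t * norm (h, w) < h \<longleftrightarrow> 0 < h \<and> t\<^sup>2 * (h\<^sup>2 + (norm w)\<^sup>2) < h\<^sup>2"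
      proof (cases "0 < h")
        case True
        have "t * norm (h, w) < h \<longleftrightarrow> (t * norm (h, w))\<^sup>2 < h\<^sup>2"
          using True t power_strict_mono[of "t * norm (h, w)" h 2]
            power_less_imp_less_base[of "t * norm (h, w)" 2 h] by auto
        with True show ?thesis by (simp add: power_mult_distrib n)
      next
        case False
        then show ?thesis using t by (auto simp: not_less intro: order_trans)
      qed
      have 3: "norm w < sqrt (q h) \<longleftrightarrow> (norm w)\<^sup>2 < q h"
        by (metis norm_ge_zero real_less_rsqrt real_sqrt_less_iff real_sqrt_unique)
      have 4: "t\<^sup>2 * (h\<^sup>2 + (norm w)\<^sup>2) < h\<^sup>2 \<longleftrightarrow> (norm w)\<^sup>2 < h\<^sup>2 * (1 - t\<^sup>2) / t\<^sup>2"
        using t2 by (simp add: field_simps)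
      have 5: "h < 1" if "0 < h" "(norm w)\<^sup>2 < 1 - h\<^sup>2"
        using that zero_le_power2[of "norm w"] by (smt (verit) one_le_power)
      show ?thesis
        unfolding 1 2 3 4 using 5 by (auto simp: q_def)
    qed
    then show ?thesis by (auto simp: set_eq_iff)
  qed
  have q0: "0 \<le> q h" if "0 \<le> h" "h \<le> 1" for h
    using that t2 by (auto simp: q_def power_le_one)
  have ev: "emeasure lborel (Pair h -` ?A) = ennreal (pi * q h) * indicator {0..1} h" for h
  proof (cases "0 < h \<and> h < 1")
    case True
    then show ?thesis
      unfolding slice using q0[of h] by (simp add: emeasure_ball unit_ball_vol_2)
  next
    case False
    then have "h < 0 \<or> h > 1 \<or> q h = 0" by (cases "h = 0 \<or> h = 1") (auto simp: q_def t2 less_imp_le)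
    then show ?thesis unfolding slice using False by auto
  qed
  have "emeasure lborel ?A = emeasure (lborel \<Otimes>\<^sub>M lborel) ?A"
    by (simp add: lborel_prod)
  also have "\<dots> = (\<integral>\<^sup>+h. ennreal (pi * q h) * indicator {0..1} h \<partial>lborel)"
    by (simp only: lborel.emeasure_pair_measure_alt[OF A2] ev)
  also have "\<dots> = (\<integral>\<^sup>+h. ennreal (pi * (h\<^sup>2 * (1 - t\<^sup>2) / t\<^sup>2)) * indicator {0..t} h +
      ennreal (pi * (1 - h\<^sup>2)) * indicator {t..1} h \<partial>lborel)"
  proof (rule nn_integral_cong_AE, rule AE_mp[OF AE_lborel_singleton[of t]], rule AE_I2, rule impI)
    fix h assume "h \<noteq> t"
    moreover have "q h = h\<^sup>2 * (1 - t\<^sup>2) / t\<^sup>2" if "0 \<le> h" "h < t"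
    proof -
      have "h\<^sup>2 \<le> t\<^sup>2" using that by (intro power_mono) auto
      then show ?thesis using t2 by (simp add: q_def min_def field_simps)
    qed
    moreover have "q h = 1 - h\<^sup>2" if "t < h"
    proof -
      have "t\<^sup>2 \<le> h\<^sup>2" using that t by (intro power_mono) auto
      then show ?thesis using t2 by (simp add: q_def min_def field_simps)
    qed
    ultimately show "ennreal (pi * q h) * indicator {0..1} h =
        ennreal (pi * (h\<^sup>2 * (1 - t\<^sup>2) / t\<^sup>2)) * indicator {0..t} h +
        ennreal (pi * (1 - h\<^sup>2)) * indicator {t..1} h"
      using t by (auto simp: indicator_def)
  qed
  also have "\<dots> = (\<integral>\<^sup>+h. ennreal (pi * (h\<^sup>2 * (1 - t\<^sup>2) / t\<^sup>2)) * indicator {0..t} h \<partial>lborel) +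
      (\<integral>\<^sup>+h. ennreal (pi * (1 - h\<^sup>2)) * indicator {t..1} h \<partial>lborel)"
    by (rule nn_integral_add) simp_all
  also have "(\<integral>\<^sup>+h. ennreal (pi * (h\<^sup>2 * (1 - t\<^sup>2) / t\<^sup>2)) * indicator {0..t} h \<partial>lborel) =
      ennreal (pi * (t^3 * (1 - t\<^sup>2) / (3 * t\<^sup>2)) - pi * (0^3 * (1 - t\<^sup>2) / (3 * t\<^sup>2)))"
  proof (rule nn_integral_FTC_Icc)
    show "0 \<le> pi * (h\<^sup>2 * (1 - t\<^sup>2) / t\<^sup>2)" for h using t2 by simp
  qed (use t in \<open>auto intro!: derivative_eq_intros simp: power2_eq_square field_simps\<close>)
  also have "(\<integral>\<^sup>+h. ennreal (pi * (1 - h\<^sup>2)) * indicator {t..1} h \<partial>lborel) =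
      ennreal (pi * (1 - 1^3/3) - pi * (t - t^3/3))"
    using t
    by (intro nn_integral_FTC_Icc)
       (auto intro!: derivative_eq_intros simp: power2_eq_square field_simps mult_le_one)
  also have "ennreal (pi * (t^3 * (1 - t\<^sup>2) / (3 * t\<^sup>2)) - pi * (0^3 * (1 - t\<^sup>2) / (3 * t\<^sup>2))) +
      ennreal (pi * (1 - 1^3/3) - pi * (t - t^3/3)) = ennreal (2 * pi / 3 * (1 - t))"
  proof -
    have e: "pi * (t^3 * (1 - t\<^sup>2) / (3 * t\<^sup>2)) - pi * (0^3 * (1 - t\<^sup>2) / (3 * t\<^sup>2)) = pi / 3 * (t * (1 - t\<^sup>2))"
      using t by (simp add: power2_eq_square power3_eq_cube)
    \<comment> \<open>\<open>2 - 3 * t + t^3\<close> factors as \<open>(1 - t)^2 * (2 + t)\<close>.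
      The sign is needed because sums in \<open>ennreal\<close> agree with real sums for nonnegative
      terms.\<close>
    have "t - t^3/3 \<le> 2/3"
    proof -
      have "0 \<le> (1 - t)\<^sup>2 * (2 + t)" using t by simp
      then show ?thesis by (simp add: power2_eq_square power3_eq_cube algebra_simps)
    qed
    then have "0 \<le> pi * (1 - 1^3/3) - pi * (t - t^3/3)"
      by (simp flip: right_diff_distrib)
    moreover have "0 \<le> pi / 3 * (t * (1 - t\<^sup>2))" using t t2 by simp
    moreover have "pi / 3 * (t * (1 - t\<^sup>2)) + (pi * (1 - 1^3/3) - pi * (t - t^3/3)) = 2 * pi / 3 * (1 - t)"
      by (simp add: power2_eq_square power3_eq_cube field_simps)
    ultimately show ?thesis unfolding e by (metis ennreal_plus)
  qed
  finally show ?thesis .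
qed

lemma space_uniform_sphere [simp]: "space uniform_sphere = UNIV"
  using sets_eq_imp_space_eq[OF sets_uniform_sphere] by simp

text \<open>Since \<open>uniform_sphere\<close> is the radial projection of the ball, a cap has the
  measure of the sector below it, divided by the volume \<open>4/3 * pi\<close> of the ball. A
  rotation moves \<open>e\<close> to the first axis.\<close>

lemma measure_uniform_sphere_cap:
  fixes e :: "real^3"
  assumes e: "norm e = 1" and t: "0 < t" "t < 1"
  shows "measure uniform_sphere {w. t < w \<bullet> e} = (1 - t) / 2"
proof -
  let ?e1 = "axis 1 1 :: real^3"
  obtain R where R: "orthogonal_transformation R" and Re: "R ?e1 = e"
    using orthogonal_transformation_exists[of ?e1 e] e by (auto simp: norm_axis_1)
  have [measurable]: "R \<in> borel_measurable borel" "vec3 \<in> borel_measurable borel"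
    using R by (auto intro!: borel_measurable_linear orthogonal_transformation_linear linear_vec3)
  have [measurable]: "(fst :: real \<times> real \<times> real \<Rightarrow> real) \<in> borel_measurable borel"
    by (intro borel_measurable_continuous_onI continuous_intros)
  have inn: "R w \<bullet> e = w $ 1" for w
    using R by (simp add: orthogonal_transformation_def inner_axis flip: Re)
  have "emeasure uniform_sphere {w. t < w \<bullet> e} =
      emeasure (distr uniform_sphere borel R) {w. t < w \<bullet> e}"
    by (simp add: uniform_sphere_orthogonal_vec[OF R])
  also have "\<dots> = emeasure uniform_sphere {w::real^3. t < w $ 1}"
    by (subst emeasure_distr) (simp_all add: inn vimage_def)
  also have "\<dots> = emeasure (distr uniform_sphere borel vec3) {w::real^3. t < w $ 1}"
    by (subst distr_uniform_sphere_isometry[OF linear_vec3 norm_vec3 lborel_vec3]) simp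
  also have "\<dots> = emeasure (uniform_sphere :: (real \<times> real \<times> real) measure) {p. t < fst p}"
    by (subst emeasure_distr) (simp_all add: vec3_nth vimage_def)
  also have "\<dots> = emeasure (uniform_measure lborel (ball 0 1)) {p :: real \<times> real \<times> real. t < fst (sgn p)}"
    unfolding uniform_sphere_def by (subst emeasure_distr) (simp_all add: vimage_def)
  also have "\<dots> = emeasure lborel (ball 0 1 \<inter> {p :: real \<times> real \<times> real. t < fst (sgn p)}) /
      emeasure lborel (ball 0 1 :: (real \<times> real \<times> real) set)"
    by (rule emeasure_uniform_measure) simp_all
  also have "ball 0 1 \<inter> {p :: real \<times> real \<times> real. t < fst (sgn p)} =
      {p. norm p < 1 \<and> t * norm p < fst p}"
  proof -
    have "t < fst (sgn p) \<longleftrightarrow> t * norm p < fst p" for p :: "real \<times> real \<times> real"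
    proof (cases "p = 0")
      case False
      then have "0 < norm p" by simp
      then show ?thesis
        by (simp add: sgn_div_norm divide_inverse[symmetric] pos_less_divide_eq mult.commute)
    qed (use t in simp)
    then show ?thesis by (auto simp: ball_def)
  qed
  also have "emeasure lborel (ball 0 1 :: (real \<times> real \<times> real) set) = ennreal (4 / 3 * pi)"
    by (simp add: emeasure_ball unit_ball_vol_3)
  also note emeasure_cone[OF t]
  also have "ennreal (2 * pi / 3 * (1 - t)) / ennreal (4 / 3 * pi) = ennreal ((1 - t) / 2)"
    using t by (subst divide_ennreal) (auto simp: field_simps)
  finally show ?thesis
    using t by (simp add: measure_def)
qed

text \<open>Finite measures on the line with equal tails agree. Caps give the tails for
  \<open>0 < t < 1\<close>, reflection of \<open>e\<close> those for \<open>-1 < t < 0\<close>, and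
  the values at the end points and at \<open>0\<close> follow by squeezing.\<close>

lemma uniform_sphere_inner:
  fixes e :: "real^3"
  assumes e: "norm e = 1"
  shows "distr uniform_sphere borel (\<lambda>w. w \<bullet> e) = uniform_measure lborel {-1..1::real}"
proof (rule measure_eqI_lessThan)
  interpret U: prob_space "uniform_sphere :: (real^3) measure"
    by (rule prob_space_uniform_sphere)
  interpret D: prob_space "distr uniform_sphere borel (\<lambda>w. w \<bullet> e)"
    by (rule U.prob_space_distr) simp
  interpret L: prob_space "uniform_measure lborel {-1..1::real}"
    by (rule prob_space_uniform_measure) auto
  let ?U = "uniform_sphere :: (real^3) measure"
  have e': "norm (- e) = 1" using e by simp
  note cap = measure_uniform_sphere_cap
  have flip: "{w. t < w \<bullet> e} = UNIV - {w. - t \<le> w \<bullet> (- e)}" for t by auto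
  have capc: "measure ?U {w. t \<le> w \<bullet> d} = (1 - t) / 2" if d: "norm d = 1" and t: "0 < t" "t < 1" for t d
  proof (rule antisym)
    show "(1 - t) / 2 \<le> measure ?U {w. t \<le> w \<bullet> d}"
      unfolding cap[OF d t, symmetric] by (intro U.finite_measure_mono) auto
    show "measure ?U {w. t \<le> w \<bullet> d} \<le> (1 - t) / 2"
    proof (rule field_le_epsilon)
      fix \<epsilon> :: real assume "0 < \<epsilon>"
      define t' where "t' = max (t - \<epsilon>) (t / 2)"
      have t': "0 < t'" "t' < 1" "t' < t" "t \<le> t' + \<epsilon>"
        using t \<open>0 < \<epsilon>\<close> by (auto simp: t'_def)
      have "measure ?U {w. t \<le> w \<bullet> d} \<le> measure ?U {w. t' < w \<bullet> d}"
        using t' by (intro U.finite_measure_mono) auto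
      also have "\<dots> = (1 - t') / 2" by (rule cap[OF d t'(1,2)])
      finally show "measure ?U {w. t \<le> w \<bullet> d} \<le> (1 - t) / 2 + \<epsilon>"
        using t' \<open>0 < \<epsilon>\<close> by (simp add: field_simps)
    qed
  qed
  have neg: "measure ?U {w. t < w \<bullet> e} = (1 - t) / 2" if "-1 < t" "t < 0" for t
    unfolding flip using capc[OF e', of "- t"] that U.prob_compl[of "{w. - t \<le> w \<bullet> (- e)}"]
    by (simp add: field_simps)
  have zero: "measure ?U {w. 0 < w \<bullet> e} = 1 / 2"
  proof (rule antisym; rule field_le_epsilon)
    fix \<epsilon> :: real assume "0 < \<epsilon>"
    define t where "t = min \<epsilon> (1/2)"
    have t: "0 < t" "t < 1" "t \<le> \<epsilon>" using \<open>0 < \<epsilon>\<close> by (auto simp: t_def)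
    have "measure ?U {w. 0 < w \<bullet> e} \<le> measure ?U {w. - t < w \<bullet> e}"
      using t by (intro U.finite_measure_mono) auto
    also have "\<dots> \<le> 1 / 2 + \<epsilon>" using t by (subst neg) (auto simp: field_simps)
    finally show "measure ?U {w. 0 < w \<bullet> e} \<le> 1 / 2 + \<epsilon>" .
    have "1 / 2 \<le> measure ?U {w. t < w \<bullet> e} + \<epsilon>" using t by (subst cap[OF e]) (auto simp: field_simps)
    also have "measure ?U {w. t < w \<bullet> e} \<le> measure ?U {w. 0 < w \<bullet> e}"
      using t by (intro U.finite_measure_mono) auto
    finally show "1 / 2 \<le> measure ?U {w. 0 < w \<bullet> e} + \<epsilon>" by simp
  qed
  have ae: "AE w in ?U. \<bar>w \<bullet> e\<bar> \<le> 1"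
    using AE_uniform_sphere
  proof eventually_elim
    case (elim w)
    then show ?case using Cauchy_Schwarz_ineq2[of w e] e by simp
  qed
  show "emeasure (distr uniform_sphere borel (\<lambda>w. w \<bullet> e)) {t<..} =
      emeasure (uniform_measure lborel {-1..1::real}) {t<..}" for t
  proof -
    have "emeasure (distr uniform_sphere borel (\<lambda>w. w \<bullet> e)) {t<..} = ennreal (measure ?U {w. t < w \<bullet> e})"
      by (subst emeasure_distr) (simp_all add: U.emeasure_eq_measure vimage_def)
    also have "measure ?U {w. t < w \<bullet> e} = measure lborel ({-1..1} \<inter> {t<..}) / 2"
    proof -
      consider "t \<le> -1" | "-1 < t" "t < 0" | "t = 0" | "0 < t" "t < 1" | "1 \<le> t" by linarith
      then show ?thesis
      proof cases
        case 1
        have "(1::real) \<le> measure ?U {w. t < w \<bullet> e}"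
        proof (rule field_le_epsilon)
          fix \<epsilon> :: real assume "0 < \<epsilon>"
          define r where "r = min (1/2) \<epsilon>"
          have r: "0 < r" "r \<le> 1/2" "r \<le> \<epsilon>" using \<open>0 < \<epsilon>\<close> by (auto simp: r_def)
          have "1 - r / 2 = measure ?U {w. -1 + r < w \<bullet> e}"
            using r by (subst neg) (auto simp: field_simps)
          also have "\<dots> \<le> measure ?U {w. t < w \<bullet> e}"
            using 1 r by (intro U.finite_measure_mono) auto
          finally show "1 \<le> measure ?U {w. t < w \<bullet> e} + \<epsilon>" using r by simp
        qed
        then have "measure ?U {w. t < w \<bullet> e} = 1" using U.prob_le_1 antisym by blast
        moreover have "emeasure lborel ({-1..1} \<inter> {t<..}) = emeasure lborel {-1..1::real}"
          by (rule emeasure_eq_AE) (use 1 AE_lborel_singleton[of "-1::real"] in \<open>auto elim!: eventually_mono\<close>)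
        ultimately show ?thesis by (simp add: measure_def)
      next
        case 2
        then have "{-1..1} \<inter> {t<..} = {t<..1}" by auto
        then show ?thesis using neg[of t] 2 by simp
      next
        case 3
        then have "{-1..1} \<inter> {t<..} = {t<..1}" by auto
        then show ?thesis using zero 3 by simp
      next
        case 4
        then have "{-1..1} \<inter> {t<..} = {t<..1}" by auto
        then show ?thesis using cap[OF e, of t] 4 by simp
      next
        case 5
        have "measure ?U {w. t < w \<bullet> e} = measure ?U {}"
          by (rule U.finite_measure_eq_AE) (use 5 ae in \<open>auto elim!: eventually_mono\<close>)
        moreover have "{-1..1} \<inter> {t<..} = {}" using 5 by auto
        ultimately show ?thesis by simp
      qed
    qed
    also have "ennreal (measure lborel ({-1..1} \<inter> {t<..}) / 2) =
        emeasure (uniform_measure lborel {-1..1::real}) {t<..}"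
      by (subst L.emeasure_eq_measure, subst measure_uniform_measure) auto
    finally show ?thesis .
  qed
  show "emeasure (distr uniform_sphere borel (\<lambda>w. w \<bullet> e)) {t<..} < \<infinity>" for t
    by (simp add: less_top[symmetric])
qed simp_all

abbreviation sphere2 :: "(real^3) measure" where
  "sphere2 \<equiv> uniform_sphere"

interpretation sphere2: prob_space sphere2
  by (rule prob_space_uniform_sphere)

section \<open>Moments of the uniform measure on the two-sphere\<close>

lemma integral_uniform_measure_Icc:
  fixes g :: "real \<Rightarrow> real"
  assumes [measurable]: "g \<in> borel_measurable borel"
  shows "(\<integral>u. g u \<partial>uniform_measure lborel {-1..1}) = (\<integral>u. indicator {-1..1} u * g u \<partial>lborel) / 2"
proof -
  have "uniform_measure lborel {-1..1::real} = density lborel (\<lambda>u. ennreal (indicator {-1..1} u / 2))"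
    unfolding uniform_measure_def
    by (intro density_cong) (auto simp: indicator_def divide_ennreal simp flip: ennreal_numeral ennreal_1)
  then show ?thesis
    by (simp add: integral_density)
qed

lemma sphere2_integral_inner:
  fixes g :: "real \<Rightarrow> real"
  assumes e: "norm e = 1" and [measurable]: "g \<in> borel_measurable borel"
  shows "(\<integral>w. g (w \<bullet> e) \<partial>sphere2) = (\<integral>u. indicator {-1..1} u * g u \<partial>lborel) / 2"
proof -
  have "(\<integral>w. g (w \<bullet> e) \<partial>sphere2) = (\<integral>u. g u \<partial>distr sphere2 borel (\<lambda>w. w \<bullet> e))"
    by (rule integral_distr[symmetric]) auto
  then show ?thesis
    unfolding uniform_sphere_inner[OF e] by (simp add: integral_uniform_measure_Icc)
qed

lemma sphere2_moment:
  assumes e: "norm e = 1"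
  shows "(\<integral>w. (w \<bullet> e)^k \<partial>sphere2) = (1 - (-1)^Suc k) / (2 * Suc k)"
  using integral_power[of "-1" 1 k]
  by (subst sphere2_integral_inner[OF e]) (simp_all add: mult.commute[of "indicator _ _"])

lemma AE_sphere2_inner_le: "AE w in sphere2. \<bar>w \<bullet> x\<bar> \<le> norm x"
  using AE_uniform_sphere
proof eventually_elim
  case (elim w)
  then show ?case using Cauchy_Schwarz_ineq2[of w x] by simp
qed

lemma integrable_sphere2_inner:
  "integrable sphere2 (\<lambda>w. (w \<bullet> x)^j * (w \<bullet> y)^k)"
proof (rule sphere2.integrable_const_bound)
  show "AE w in sphere2. norm ((w \<bullet> x)^j * (w \<bullet> y)^k) \<le> norm x ^ j * norm y ^ k"
    using AE_sphere2_inner_le[of x] AE_sphere2_inner_le[of y]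
    by eventually_elim (auto simp: abs_mult power_abs intro!: mult_mono power_mono)
qed simp

lemma sphere2_integral_uminus:
  fixes g :: "real^3 \<Rightarrow> real"
  assumes [measurable]: "g \<in> borel_measurable borel"
  shows "(\<integral>w. g (- w) \<partial>sphere2) = (\<integral>w. g w \<partial>sphere2)"
proof -
  have o: "orthogonal_transformation (uminus :: real^3 \<Rightarrow> _)"
    by (simp add: orthogonal_transformation_def linear_iff)
  show ?thesis
    by (subst (2) uniform_sphere_orthogonal_vec[OF o, symmetric]) (simp add: integral_distr)
qed

text \<open>The odd moment changes sign under \<open>w \<mapsto> - w\<close>. The other one follows
  by polarization from pure fourth moments, each equal to \<open>1/5\<close>: with \<open>p\<close>
  and \<open>q\<close> the normalized sum and difference of \<open>a\<close> and \<open>e\<close>,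
  which are unit vectors by orthogonality, it is \<open>2/15 - 2/30\<close>.\<close>

lemma sphere2_mixed_moments:
  assumes a: "norm a = 1" and e: "norm e = 1" and ae: "a \<bullet> e = 0"
  shows "(\<integral>w. (w \<bullet> a)^2 * (w \<bullet> e) \<partial>sphere2) = 0"
    and "(\<integral>w. (w \<bullet> a)^2 * (w \<bullet> e)^2 \<partial>sphere2) = 1/15"
proof -
  have "(\<integral>w. (w \<bullet> a)^2 * (w \<bullet> e) \<partial>sphere2) = - (\<integral>w. (w \<bullet> a)^2 * (w \<bullet> e) \<partial>sphere2)"
    by (subst sphere2_integral_uminus[symmetric]) simp_all
  then show "(\<integral>w. (w \<bullet> a)^2 * (w \<bullet> e) \<partial>sphere2) = 0" by simp
  define p q where pq: "p = (1 / sqrt 2) *\<^sub>R (a + e)" "q = (1 / sqrt 2) *\<^sub>R (a - e)"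
  have n: "norm p = 1" "norm q = 1"
    unfolding pq using a e ae by (simp_all add: norm_eq_sqrt_inner inner_simps inner_commute field_simps)
  have m4: "(\<integral>w. (w \<bullet> d)^4 \<partial>sphere2) = 1/5" if "norm d = 1" for d
    using sphere2_moment[OF that, of 4] by simp
  note int = integrable_sphere2_inner
  have int4: "integrable sphere2 (\<lambda>w. (w \<bullet> d)^4)" for d using int[of d 4 d 0] by simp
  have alg: "(w \<bullet> a)^2 * (w \<bullet> e)^2 =
      (1/3) * (w \<bullet> p)^4 + (1/3) * (w \<bullet> q)^4
        - (1/6) * (w \<bullet> a)^4 - (1/6) * (w \<bullet> e)^4" for w
  proof -
    have "sqrt 2 ^ 4 = (4::real)"
      by (simp add: power4_eq_xxxx)
    then have s: "(w \<bullet> ((1 / sqrt 2) *\<^sub>R v))^4 = (w \<bullet> v)^4 / 4" for v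
      by (simp add: power_divide)
    show ?thesis
      unfolding pq s inner_add_right inner_diff_right
      by (simp add: power4_eq_xxxx power2_eq_square field_simps)
  qed
  show "(\<integral>w. (w \<bullet> a)^2 * (w \<bullet> e)^2 \<partial>sphere2) = 1/15"
    unfolding alg by (simp add: int4 m4[OF a] m4[OF e] m4[OF n(1)] m4[OF n(2)])
qed

section \<open>Resampling one velocity\<close>

text \<open>Rescaled velocities \<open>x = v / sqrt 2\<close> lie in the unit ball. Given \<open>x\<close>, another
  rescaled velocity is \<open>resample x w\<close> with \<open>w\<close> uniform on the unit sphere.\<close>

definition wt :: "real^3 \<Rightarrow> real" where
  "wt x = 1 - (norm x)\<^sup>2"

definition resample :: "real^3 \<Rightarrow> real^3 \<Rightarrow> real^3" where
  "resample x w = (sqrt 3 / 2 * sqrt (wt x)) *\<^sub>R w - (1/2) *\<^sub>R x"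

definition cond_mean :: "(real^3 \<Rightarrow> real) \<Rightarrow> real^3 \<Rightarrow> real" where
  "cond_mean h x = (\<integral>w. h (resample x w) \<partial>sphere2)"

text \<open>The ratio \<open>1/2\<close> to \<open>1\<close> comes from the square of a sum over
  three particles: three diagonal terms face six off-diagonal ones.\<close>

definition kac_op :: "(real^3 \<Rightarrow> real) \<Rightarrow> real^3 \<Rightarrow> real" where
  "kac_op h x = 1/2 * wt x * h x + cond_mean (\<lambda>y. wt y * h y) x"

lemma wt_bounds: "norm x \<le> 1 \<Longrightarrow> 0 \<le> wt x" "wt x \<le> 1"
  by (simp_all add: wt_def power_le_one)

lemma measurable_wt [measurable]: "wt \<in> borel_measurable borel"
  unfolding wt_def by measurable

lemma measurable_resample [measurable (raw)]:
  assumes "f \<in> borel_measurable M" "g \<in> borel_measurable M"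
  shows "(\<lambda>z. resample (f z) (g z)) \<in> borel_measurable M"
  using assms unfolding resample_def by measurable

lemma measurable_cond_mean [measurable]:
  assumes [measurable]: "h \<in> borel_measurable borel"
  shows "cond_mean h \<in> borel_measurable borel"
  unfolding cond_mean_def[abs_def] by measurable

lemma measurable_kac_op [measurable]:
  assumes [measurable]: "h \<in> borel_measurable borel"
  shows "kac_op h \<in> borel_measurable borel"
  unfolding kac_op_def[abs_def] by measurable

text \<open>Law of cosines. What matters later is that the new weight is affine in
  \<open>w \<bullet> x\<close>, hence uniform on an interval by Archimedes.\<close>

lemma wt_resample:
  assumes "norm x \<le> 1" "norm w = 1"
  shows "wt (resample x w) = 3/4 - wt x / 2 + sqrt 3 / 2 * sqrt (wt x) * (w \<bullet> x)"
proof -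
  define \<rho> where "\<rho> = sqrt 3 / 2 * sqrt (wt x)"
  have \<rho>2: "\<rho>\<^sup>2 = 3/4 * wt x"
    using wt_bounds(1)[OF assms(1)] by (simp add: \<rho>_def power_mult_distrib power_divide)
  have "(norm (resample x w))\<^sup>2 = \<rho>\<^sup>2 * (norm w)\<^sup>2 - \<rho> * (w \<bullet> x) + (norm x)\<^sup>2 / 4"
    unfolding resample_def \<rho>_def[symmetric] power2_norm_eq_inner
    by (simp add: inner_simps inner_commute power2_eq_square algebra_simps)
  then show ?thesis
    unfolding \<rho>2 using assms(2) by (simp add: wt_def[of "resample x w"] \<rho>_def) (simp add: wt_def field_simps)
qed

text \<open>By \<open>wt_resample\<close> it is enough that the linear term does not exceed
  \<open>3/4 - wt x / 2\<close> in absolute value; the squares differ by at least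
  \<open>(wt x - 3/4)^2\<close>.\<close>

lemma norm_resample:
  assumes x: "norm x \<le> 1" and w: "norm w = 1"
  shows "norm (resample x w) \<le> 1"
proof -
  have s: "0 \<le> wt x" "wt x \<le> 1" using x by (simp_all add: wt_bounds)
  have "(sqrt 3 / 2 * sqrt (wt x) * (w \<bullet> x))\<^sup>2 \<le> (3/4 - wt x / 2)\<^sup>2"
  proof -
    have "(w \<bullet> x)\<^sup>2 \<le> 1 - wt x"
      using Cauchy_Schwarz_ineq[of w x] w by (simp add: wt_def power2_norm_eq_inner norm_eq_1)
    then have "3/4 * wt x * (w \<bullet> x)\<^sup>2 \<le> 3/4 * wt x * (1 - wt x)"
      using s by (intro mult_left_mono) auto
    moreover have "(3/4 - wt x / 2)\<^sup>2 - 3/4 * wt x * (1 - wt x) = (wt x - 3/4)\<^sup>2"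
      by (simp add: power2_eq_square field_simps)
    moreover have "(sqrt 3 / 2 * sqrt (wt x) * (w \<bullet> x))\<^sup>2 = 3/4 * wt x * (w \<bullet> x)\<^sup>2"
      using s by (simp add: power_mult_distrib power_divide)
    ultimately show ?thesis
      using zero_le_power2[of "wt x - 3/4"] by linarith
  qed
  then have "\<bar>sqrt 3 / 2 * sqrt (wt x) * (w \<bullet> x)\<bar> \<le> 3/4 - wt x / 2"
    using s by (subst (asm) abs_le_square_iff[symmetric]) auto
  then have "0 \<le> wt (resample x w)"
    unfolding wt_resample[OF x w] by (simp add: abs_le_iff)
  then show ?thesis by (simp add: wt_def power_le_one_iff abs_square_le_1)
qed

lemma AE_norm_resample: "norm x \<le> 1 \<Longrightarrow> AE w in sphere2. norm (resample x w) \<le> 1"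
  using AE_uniform_sphere by eventually_elim (rule norm_resample)

lemma integrable_resample:
  fixes h :: "real^3 \<Rightarrow> real"
  assumes [measurable]: "h \<in> borel_measurable borel"
    and h: "\<And>y. norm y \<le> 1 \<Longrightarrow> \<bar>h y\<bar> \<le> B" and x: "norm x \<le> 1"
  shows "integrable sphere2 (\<lambda>w. h (resample x w))"
proof (rule sphere2.integrable_const_bound)
  show "AE w in sphere2. norm (h (resample x w)) \<le> B"
    using AE_norm_resample[OF x] by eventually_elim (use h in auto)
qed measurable

lemma cond_mean_mono:
  assumes [measurable]: "g \<in> borel_measurable borel" "h \<in> borel_measurable borel"
    and g: "\<And>y. norm y \<le> 1 \<Longrightarrow> \<bar>g y\<bar> \<le> B" and h: "\<And>y. norm y \<le> 1 \<Longrightarrow> \<bar>h y\<bar> \<le> C"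
    and le: "\<And>y. norm y \<le> 1 \<Longrightarrow> g y \<le> h y" and x: "norm x \<le> 1"
  shows "cond_mean g x \<le> cond_mean h x"
  unfolding cond_mean_def
proof (rule integral_mono_AE)
  show "AE w in sphere2. g (resample x w) \<le> h (resample x w)"
    using AE_norm_resample[OF x] by eventually_elim (rule le)
qed (use integrable_resample[of g B x] integrable_resample[of h C x] g h x in auto)

text \<open>The three weights add up to \<open>3/2\<close>, so each of the other two has conditional
  mean half of \<open>3/2 - wt x\<close>. This is the identity behind the eigenvalue
  \<open>3/4\<close> on constants.\<close>

lemma cond_mean_wt:
  assumes x: "norm x \<le> 1"
  shows "cond_mean wt x = 3/4 - wt x / 2"
proof -
  have "cond_mean wt x = (\<integral>w. 3/4 - wt x / 2 + sqrt 3 / 2 * sqrt (wt x) * (w \<bullet> x) \<partial>sphere2)"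
    unfolding cond_mean_def
    by (rule integral_cong_AE) (use AE_uniform_sphere in \<open>auto simp: wt_resample[OF x] elim!: eventually_mono\<close>)
  moreover have "(\<integral>w. w \<bullet> x \<partial>sphere2) = 0"
    using sphere2_integral_uminus[of "\<lambda>w. w \<bullet> x"] by simp
  moreover have "integrable sphere2 (\<lambda>w. w \<bullet> x)"
    using integrable_sphere2_inner[of x 1 x 0] by simp
  ultimately show ?thesis using sphere2.prob_space by simp
qed

lemma kac_op_diff:
  assumes [measurable]: "g \<in> borel_measurable borel" "h \<in> borel_measurable borel"
    and g: "\<And>y. norm y \<le> 1 \<Longrightarrow> \<bar>g y\<bar> \<le> B" and h: "\<And>y. norm y \<le> 1 \<Longrightarrow> \<bar>h y\<bar> \<le> C"
    and x: "norm x \<le> 1"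
  shows "kac_op (\<lambda>y. g y - h y) x = kac_op g x - kac_op h x"
proof -
  have b: "\<bar>wt y * f y\<bar> \<le> D" if "\<And>y. norm y \<le> 1 \<Longrightarrow> \<bar>f y\<bar> \<le> D" "norm y \<le> 1" for f :: "real^3 \<Rightarrow> real" and y D
  proof -
    have "\<bar>wt y * f y\<bar> \<le> 1 * D"
      unfolding abs_mult using that wt_bounds[of y] by (intro mult_mono) auto
    then show ?thesis by simp
  qed
  have "\<And>y. norm y \<le> 1 \<Longrightarrow> \<bar>wt y * g y\<bar> \<le> B" "\<And>y. norm y \<le> 1 \<Longrightarrow> \<bar>wt y * h y\<bar> \<le> C"
    using g h by (auto intro!: b)
  then have "integrable sphere2 (\<lambda>w. wt (resample x w) * g (resample x w))"
    "integrable sphere2 (\<lambda>w. wt (resample x w) * h (resample x w))"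
    using integrable_resample[of "\<lambda>y. wt y * g y" B x] integrable_resample[of "\<lambda>y. wt y * h y" C x] x
    by simp_all
  then show ?thesis
    unfolding kac_op_def cond_mean_def by (simp add: right_diff_distrib)
qed

section \<open>Law of the weight after one resampling step\<close>

lemma cond_mean_radial:
  fixes g :: "real \<Rightarrow> real"
  assumes [measurable]: "g \<in> borel_measurable borel" and x: "norm x \<le> 1"
  defines "d \<equiv> sqrt 3 / 2 * sqrt (wt x) * norm x"
  shows "cond_mean (\<lambda>y. g (wt y)) x =
    (\<integral>u. indicator {-1..1} u * g (3/4 - wt x / 2 + d * u) \<partial>lborel) / 2"
proof -
  obtain e :: "real^3" where e: "norm e = 1" "x = norm x *\<^sub>R e"
  proof (cases "x = 0")
    case True
    then show ?thesis using that[of "axis 1 1"] by (simp add: norm_axis_1)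
  next
    case False
    then show ?thesis using that[of "x /\<^sub>R norm x"] by simp
  qed
  have "sqrt 3 / 2 * sqrt (wt x) * (w \<bullet> x) = d * (w \<bullet> e)" for w
    by (subst e(2)) (simp add: d_def)
  then have "cond_mean (\<lambda>y. g (wt y)) x = (\<integral>w. g (3/4 - wt x / 2 + d * (w \<bullet> e)) \<partial>sphere2)"
    unfolding cond_mean_def
    by (intro integral_cong_AE) (use AE_uniform_sphere in \<open>auto simp: wt_resample[OF x] elim!: eventually_mono\<close>)
  then show ?thesis
    by (simp add: sphere2_integral_inner[OF e(1), of "\<lambda>u. g (3/4 - wt x / 2 + d * u)"])
qed

text \<open>\<open>d\<close> is the half-width of the interval on which the new weight is uniform.
  It is largest at \<open>wt x = 1/2\<close>, which bounds the density \<open>1 / (2 * d)\<close>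
  below by \<open>2 / sqrt 3\<close>.\<close>

lemma radial_width:
  fixes x :: "real^3"
  assumes x: "norm x \<le> 1"
  defines "d \<equiv> sqrt 3 / 2 * sqrt (wt x) * norm x"
  shows "0 \<le> d" "d\<^sup>2 = 3/4 * (wt x * (1 - wt x))" "2 * d \<le> sqrt 3 / 2"
proof -
  have s: "0 \<le> wt x" "wt x \<le> 1" using x by (simp_all add: wt_bounds)
  show "0 \<le> d" using s by (simp add: d_def)
  show d2: "d\<^sup>2 = 3/4 * (wt x * (1 - wt x))"
    using s by (simp add: d_def power_mult_distrib power_divide) (simp add: wt_def)
  have "wt x * (1 - wt x) \<le> 1/4"
    using zero_le_power2[of "wt x - 1/2"] by (simp add: power2_eq_square algebra_simps)
  then have "(2 * d)\<^sup>2 \<le> (sqrt 3 / 2)\<^sup>2"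
    by (simp add: power_mult_distrib d2 power_divide)
  then show "2 * d \<le> sqrt 3 / 2"
    by (rule power2_le_imp_le) simp
qed

text \<open>After one resampling step \<open>wt\<close> is uniform on an interval, which contains \<open>[1/4, 3/4]\<close> if
  \<open>wt x\<close> belongs to \<open>[1/4, 3/4]\<close>.\<close>

lemma cond_mean_radial_minorization:
  fixes g :: "real \<Rightarrow> real"
  assumes [measurable]: "g \<in> borel_measurable borel"
    and g: "\<And>s. 0 \<le> s \<Longrightarrow> s \<le> 1 \<Longrightarrow> 0 \<le> g s \<and> g s \<le> B"
    and x: "norm x \<le> 1" and sx: "1/4 \<le> wt x" "wt x \<le> 3/4"
  shows "2 / sqrt 3 * (\<integral>s. indicator {1/4..3/4} s * g s \<partial>lborel) \<le> cond_mean (\<lambda>y. g (wt y)) x"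
proof -
  define d where "d = sqrt 3 / 2 * sqrt (wt x) * norm x"
  define c where "c = 3/4 - wt x / 2"
  note w = radial_width[OF x, folded d_def]
  have "0 < d\<^sup>2" unfolding w(2) using sx by simp
  then have d: "0 < d" using w(1) by (cases "d = 0") auto
  \<comment> \<open>The pairs of old and new weight fill an ellipse: \<open>d^2 - (s - c)^2\<close>
    equals \<open>3/2 * (s + t) - s^2 - s * t - t^2 - 9/16\<close> with \<open>t = wt x\<close>,
    which is symmetric in \<open>s\<close> and \<open>t\<close>. It vanishes at
    \<open>(1/4, 1/4)\<close> and \<open>(3/4, 3/4)\<close>, so the square over
    \<open>[1/4, 3/4]\<close> is inscribed in the ellipse. The identity below writes this as a sum
    of three nonnegative terms.\<close>
  have mem: "\<bar>s - c\<bar> \<le> d" if "1/4 \<le> s" "s \<le> 3/4" for s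
  proof -
    have "(s - c)\<^sup>2 \<le> d\<^sup>2"
    proof -
      let ?t = "wt x"
      have a: "(s - 1/4) * (s - 3/4) \<le> 0" "(?t - 1/4) * (?t - 3/4) \<le> 0"
        using that sx by (auto intro!: mult_nonneg_nonpos)
      have b: "(s - 1/4) * (3/4 - ?t) + (3/4 - s) * (?t - 1/4) \<ge> 0"
        using that sx by (intro add_nonneg_nonneg mult_nonneg_nonneg) auto
      have "d\<^sup>2 - (s - c)\<^sup>2 = - ((s - 1/4) * (s - 3/4)) - ((?t - 1/4) * (?t - 3/4))
          + 1/2 * ((s - 1/4) * (3/4 - ?t) + (3/4 - s) * (?t - 1/4))"
        unfolding w(2) c_def by (simp add: power2_eq_square field_simps)
      also have "\<dots> \<ge> 0"
      proof -
        have "0 \<le> - A - B + 1/2 * C" if "A \<le> 0" "B \<le> 0" "0 \<le> C" for A B C :: real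
          using that by simp
        from this[OF a b] show ?thesis .
      qed
      finally show ?thesis by simp
    qed
    then show ?thesis using d by (simp add: abs_le_square_iff[symmetric])
  qed
  \<comment> \<open>The whole interval stays in \<open>[0, 1]\<close>, where the bounds on
    \<open>g\<close> are available: \<open>c^2 - d^2\<close> and \<open>(1 - c)^2 - d^2\<close> are
    perfect squares.\<close>
  have rng: "0 \<le> c + d * u \<and> c + d * u \<le> 1" if "\<bar>u\<bar> \<le> 1" for u
  proof -
    have "d\<^sup>2 \<le> c\<^sup>2" "d\<^sup>2 \<le> (1 - c)\<^sup>2"
    proof -
      have "c\<^sup>2 - d\<^sup>2 = (wt x - 3/4)\<^sup>2" "(1 - c)\<^sup>2 - d\<^sup>2 = (wt x - 1/4)\<^sup>2"
        unfolding w(2) c_def by (simp_all add: power2_eq_square field_simps)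
      then show "d\<^sup>2 \<le> c\<^sup>2" "d\<^sup>2 \<le> (1 - c)\<^sup>2" by (smt (verit) zero_le_power2)+
    qed
    then have "d \<le> c" "d \<le> 1 - c"
      using sx by (auto intro!: power2_le_imp_le[of d] simp: c_def)
    moreover have "\<bar>d * u\<bar> \<le> d * 1"
      unfolding abs_mult using that d by (intro mult_mono) auto
    ultimately show ?thesis by (simp add: abs_le_iff)
  qed
  have "(\<integral>u. indicator {-1..1} u * g (c + d * u) \<partial>lborel) =
      (\<integral>u. indicator {c-d..c+d} (c + d * u) * g (c + d * u) \<partial>lborel)"
  proof (rule Bochner_Integration.integral_cong)
    fix u :: real
    have "c - d \<le> c + d * u \<longleftrightarrow> d * (-1) \<le> d * u" "c + d * u \<le> c + d \<longleftrightarrow> d * u \<le> d * 1"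
      by auto
    then have "(c + d * u) \<in> {c-d..c+d} \<longleftrightarrow> u \<in> {-1..1}"
      unfolding mult_le_cancel_left_pos[OF d] by simp
    then show "indicator {-1..1} u * g (c + d * u) = indicator {c-d..c+d} (c + d * u) * g (c + d * u)"
      by (simp add: indicator_def)
  qed simp
  also have "\<dots> = (\<integral>s. indicator {c-d..c+d} s * g s \<partial>lborel) / d"
    using d by (subst (2) lborel_integral_real_affine[of d _ c]) simp_all
  finally have eq: "cond_mean (\<lambda>y. g (wt y)) x = (\<integral>s. indicator {c-d..c+d} s * g s \<partial>lborel) / (2 * d)"
    using cond_mean_radial[OF assms(1) x] by (simp add: d_def c_def)
  have rng': "0 \<le> s \<and> s \<le> 1" if "s \<in> {c-d..c+d}" for s
    using rng[of "(s - c) / d"] that d by (auto simp: abs_le_iff field_simps)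
  have "(\<integral>s. indicator {1/4..3/4} s * g s \<partial>lborel) \<le> (\<integral>s. indicator {c-d..c+d} s * g s \<partial>lborel)"
  proof (rule integral_mono)
    have int: "integrable lborel (\<lambda>s. indicator {l..r} s * g s)"
      if "\<And>s. s \<in> {l..r} \<Longrightarrow> 0 \<le> s \<and> s \<le> 1" for l r :: real
    proof (rule Bochner_Integration.integrable_bound[of _ "\<lambda>s. B * indicator {l..r} s"])
      show "AE s in lborel. norm (indicator {l..r} s * g s) \<le> norm (B * indicator {l..r} s)"
      proof (rule AE_I2)
        fix s
        have "\<bar>g s\<bar> \<le> \<bar>B\<bar>" if "s \<in> {l..r}"
          using g[of s] \<open>\<And>s. s \<in> {l..r} \<Longrightarrow> 0 \<le> s \<and> s \<le> 1\<close>[OF that] by linarith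
        then show "norm (indicator {l..r} s * g s) \<le> norm (B * indicator {l..r} s)"
          by (simp add: indicator_def)
      qed
      show "integrable lborel (\<lambda>s. B * indicator {l..r} s)"
        by (intro integrable_mult_right integrable_real_indicator) (auto simp: emeasure_lborel_Icc_eq)
    qed simp_all
    show "integrable lborel (\<lambda>s. indicator {1/4..3/4} s * g s)"
      by (rule int) auto
    show "integrable lborel (\<lambda>s. indicator {c-d..c+d} s * g s)"
      by (rule int) (rule rng')
    show "indicator {1/4..3/4} s * g s \<le> indicator {c-d..c+d} s * g s" for s
      using mem[of s] g[of s] rng'[of s] by (auto simp: indicator_def abs_le_iff)
  qed
  moreover have "0 \<le> (\<integral>s. indicator {1/4..3/4} s * g s \<partial>lborel)"
    using g by (intro integral_nonneg_AE) (auto simp: indicator_def)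
  moreover have "2 / sqrt 3 \<le> 1 / (2 * d)"
    using w(3) d by (simp add: field_simps)
  ultimately have "2 / sqrt 3 * (\<integral>s. indicator {1/4..3/4} s * g s \<partial>lborel) \<le>
      1 / (2 * d) * (\<integral>s. indicator {c-d..c+d} s * g s \<partial>lborel)"
    using d by (intro mult_mono) auto
  then show ?thesis
    unfolding eq by simp
qed

text \<open>The new weight is \<open>c + d * u\<close> with \<open>u\<close> uniform on
  \<open>[-1, 1]\<close>, centre \<open>c\<close> in \<open>[1/4, 3/4]\<close> and
  \<open>d \<le> 1/2\<close>. Whatever their position, a range \<open>[l, r]\<close> of
  \<open>u\<close> of length at least \<open>1\<close> keeps it in \<open>[1/4, 3/4]\<close>; this
  has probability at least \<open>1/2\<close>, and the weight there is at least
  \<open>1/4\<close>.\<close>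

lemma cond_mean_wt_middle:
  assumes x: "norm x \<le> 1"
  shows "1/8 \<le> cond_mean (\<lambda>y. wt y * indicator {1/4..3/4} (wt y)) x"
proof -
  define d where "d = sqrt 3 / 2 * sqrt (wt x) * norm x"
  define c where "c = 3/4 - wt x / 2"
  note w = radial_width[OF x, folded d_def]
  have c: "1/4 \<le> c" "c \<le> 3/4" using wt_bounds(1)[OF x] wt_bounds(2)[of x] by (auto simp: c_def)
  have "sqrt 3 < 2" by (rule real_less_lsqrt) auto
  then have d: "0 \<le> d" "d \<le> 1/2" using w(1,3) by auto
  obtain l r where lr: "-1 \<le> l" "r \<le> 1" "l + 1 \<le> r"
    and mid: "\<And>u. l \<le> u \<Longrightarrow> u \<le> r \<Longrightarrow> 1/4 \<le> c + d * u \<and> c + d * u \<le> 3/4"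
  proof -
    have du: "d * u \<le> d" "0 \<le> d * u" if "0 \<le> u" "u \<le> 1" for u
      using that d by (auto intro: mult_left_le)
    consider "c + d \<le> 3/4" | "1/4 \<le> c - d" | "3/4 < c + d" "c - d < 1/4" by linarith
    then show thesis
    proof cases
      case 1
      have "1/4 \<le> c + d * u \<and> c + d * u \<le> 3/4" if "0 \<le> u" "u \<le> 1" for u
        using du[OF that] 1 c by linarith
      then show thesis using that[of 0 1] by simp
    next
      case 2
      have "1/4 \<le> c + d * u \<and> c + d * u \<le> 3/4" if "-1 \<le> u" "u \<le> 0" for u
        using du[of "-u"] that 2 c by simp
      then show thesis using that[of "-1" 0] by simp
    next
      case 3
      then have d0: "0 < d" using c by linarith
      have "1/4 \<le> c + d * u \<and> c + d * u \<le> 3/4"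
        if "(1/4 - c) / d \<le> u" "u \<le> (3/4 - c) / d" for u
        using that d0 by (simp add: pos_divide_le_eq pos_le_divide_eq mult.commute)
      moreover have "-1 \<le> (1/4 - c) / d" "(3/4 - c) / d \<le> 1" "(1/4 - c) / d + 1 \<le> (3/4 - c) / d"
        using 3 d0 d by (auto simp: field_simps)
      ultimately show thesis using that by blast
    qed
  qed
  have "1/4 * (r - l) = (\<integral>u. 1/4 * indicator {l..r} u \<partial>lborel)"
    using lr by simp
  also have "\<dots> \<le> (\<integral>u. indicator {-1..1} u * ((c + d * u) * indicator {1/4..3/4} (c + d * u)) \<partial>lborel)"
  proof (rule integral_mono)
    show "integrable lborel (\<lambda>u. 1/4 * indicator {l..r} u :: real)"
      using lr by (intro integrable_mult_right integrable_real_indicator) auto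
    show "integrable lborel (\<lambda>u. indicator {-1..1} u * ((c + d * u) * indicator {1/4..3/4} (c + d * u)))"
    proof (rule Bochner_Integration.integrable_bound[of _ "\<lambda>u. indicator {-1..1} u :: real"])
      show "AE u in lborel. norm (indicator {-1..1} u * ((c + d * u) * indicator {1/4..3/4} (c + d * u)))
          \<le> norm (indicator {-1..1} u :: real)"
        by (auto simp: indicator_def)
    qed simp_all
    show "1/4 * indicator {l..r} u \<le> indicator {-1..1} u * ((c + d * u) * indicator {1/4..3/4} (c + d * u))" for u
      using mid[of u] lr by (auto simp: indicator_def)
  qed
  also have "\<dots> / 2 = cond_mean (\<lambda>y. wt y * indicator {1/4..3/4} (wt y)) x"
    using cond_mean_radial[of "\<lambda>s. s * indicator {1/4..3/4} s" x] x by (simp add: c_def d_def)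
  finally show ?thesis using lr by simp
qed

section \<open>Contraction of the angular seminorm\<close>

text \<open>Reflection in the hyperplane orthogonal to \<open>v\<close>. For \<open>v = 0\<close> it
  is the identity, so it is orthogonal without exception.\<close>

definition reflect_along :: "'a::real_inner \<Rightarrow> 'a \<Rightarrow> 'a" where
  "reflect_along v y = y - (2 * (y \<bullet> v) / (v \<bullet> v)) *\<^sub>R v"

lemma orthogonal_transformation_reflect_along: "orthogonal_transformation (reflect_along v)"
proof -
  have "linear (reflect_along v)"
    by (rule linearI) (simp_all add: reflect_along_def inner_add_left add_divide_distrib algebra_simps)
  moreover have "reflect_along v y \<bullet> reflect_along v z = y \<bullet> z" for y z
    by (cases "v = 0") (simp_all add: reflect_along_def inner_simps inner_commute)
  ultimately show ?thesis by (simp add: orthogonal_transformation_def)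
qed

text \<open>\<open>R\<close> is the rotation in the plane of \<open>x\<close> and \<open>x'\<close>,
  built from two reflections: the one along \<open>x\<close> takes \<open>x\<close> to
  \<open>- x\<close>, the one along \<open>x + x'\<close> takes \<open>- x\<close> to
  \<open>x'\<close>. With axis \<open>a\<close>, it moves \<open>y\<close> by the chord
  \<open>norm (x - x') / norm x\<close> times the length of the part of \<open>y\<close> orthogonal
  to \<open>a\<close>. The angle is below \<open>pi\<close> since \<open>x' \<noteq> - x\<close>, so
  no nonzero vector goes to its opposite; thus the pairs \<open>y\<close>, \<open>R y\<close> remain
  admissible in \<open>ang_lip\<close>.\<close>

lemma rotation_between:
  fixes x x' :: "real^3"
  assumes n: "norm x' = norm x" and ne: "x \<noteq> x'" "x + x' \<noteq> 0"
  obtains R a where "orthogonal_transformation (R :: real^3 \<Rightarrow> real^3)" "R x = x'" "norm (a :: real^3) = 1" "a \<bullet> x = 0"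
    "\<And>y. (norm x * norm (R y - y))\<^sup>2 \<le> (norm (x - x'))\<^sup>2 * ((norm y)\<^sup>2 - (a \<bullet> y)\<^sup>2)"
    "\<And>y. y \<noteq> 0 \<Longrightarrow> y + R y \<noteq> 0"
proof -
  define r where "r = norm x"
  have r: "0 < r" using ne n by (cases "x = 0") (auto simp: r_def)
  define c where "c = x \<bullet> x'"
  have xx: "x \<bullet> x = r\<^sup>2" "x' \<bullet> x' = r\<^sup>2"
    using n by (simp_all add: r_def power2_norm_eq_inner[symmetric])
  have "0 < (x + x') \<bullet> (x + x')" "0 < (x - x') \<bullet> (x - x')"
    using ne by auto
  then have c: "0 < r\<^sup>2 + c" "0 < r\<^sup>2 - c"
    using xx by (simp_all add: inner_simps c_def inner_commute)
  define R where "R = reflect_along (x + x') \<circ> reflect_along x"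
  have R: "orthogonal_transformation R"
    unfolding R_def by (intro orthogonal_transformation_compose orthogonal_transformation_reflect_along)
  have Ry: "R y = y - ((x \<bullet> y + x' \<bullet> y) / (r\<^sup>2 + c)) *\<^sub>R (x + x') + (2 * (x \<bullet> y) / r\<^sup>2) *\<^sub>R x'" for y
  proof -
    have mm: "(x + x') \<bullet> (x + x') = 2 * (r\<^sup>2 + c)" "x \<bullet> (x + x') = r\<^sup>2 + c"
      using xx by (simp_all add: inner_simps c_def inner_commute)
    have lin: "linear (reflect_along (x + x'))"
      by (intro orthogonal_transformation_linear orthogonal_transformation_reflect_along)
    have a: "reflect_along (x + x') y = y - ((x \<bullet> y + x' \<bullet> y) / (r\<^sup>2 + c)) *\<^sub>R (x + x')"
    proof -
      have "y \<bullet> (x + x') = x \<bullet> y + x' \<bullet> y" by (simp add: inner_add_right inner_commute)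
      then show ?thesis
        unfolding reflect_along_def mm(1) by (subst mult_divide_mult_cancel_left) simp_all
    qed
    have b: "reflect_along (x + x') x = - x'"
      unfolding reflect_along_def mm using c by simp
    have "R y = reflect_along (x + x') (y - (2 * (x \<bullet> y) / r\<^sup>2) *\<^sub>R x)"
      by (simp add: R_def reflect_along_def[of x] xx inner_commute)
    also have "\<dots> = reflect_along (x + x') y - (2 * (x \<bullet> y) / r\<^sup>2) *\<^sub>R reflect_along (x + x') x"
      by (simp add: linear_diff[OF lin] linear_cmul[OF lin])
    finally show ?thesis unfolding a b by simp
  qed
  have Rx: "R x = x'"
  proof -
    have "(x \<bullet> x + x' \<bullet> x) / (r\<^sup>2 + c) = 1" "2 * (x \<bullet> x) / r\<^sup>2 = 2"
      using r c by (simp_all add: xx c_def inner_commute)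
    then show ?thesis unfolding Ry by (simp add: scaleR_2)
  qed
  have "dim {x, x'} < DIM(real^3)"
    using dim_le_card'[of "{x, x'}"] card_insert_le_m1[of 2 "{x'}" x] by simp
  from orthogonal_to_subspace_exists[OF this] obtain a0 where
    a0: "a0 \<noteq> 0" "\<And>y. y \<in> span {x, x'} \<Longrightarrow> orthogonal a0 y" by auto
  define a where "a = a0 /\<^sub>R norm a0"
  have a: "norm a = 1" "a \<bullet> x = 0" "a \<bullet> x' = 0"
    using a0 by (auto simp: a_def orthogonal_def span_base)
  have bound: "(norm x * norm (R y - y))\<^sup>2 \<le> (norm (x - x'))\<^sup>2 * ((norm y)\<^sup>2 - (a \<bullet> y)\<^sup>2)" for y
  proof -
    define p q \<alpha> where "p = x \<bullet> y" and "q = x' \<bullet> y" and "\<alpha> = a \<bullet> y"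
    have dd: "(norm (x - x'))\<^sup>2 = 2 * (r\<^sup>2 - c)"
      unfolding power2_norm_eq_inner using xx by (simp add: inner_simps c_def inner_commute)
    have 1: "(norm (R y - y))\<^sup>2 = 2 * (r\<^sup>2 * p\<^sup>2 + r\<^sup>2 * q\<^sup>2 - 2 * c * p * q) / (r\<^sup>2 * (r\<^sup>2 + c))"
    proof -
      define k l where "k = (p + q) / (r\<^sup>2 + c)" and "l = 2 * p / r\<^sup>2"
      have eq: "R y - y = l *\<^sub>R x' - k *\<^sub>R (x + x')" by (simp add: Ry p_def q_def k_def l_def)
      have "(norm (R y - y))\<^sup>2 = l\<^sup>2 * r\<^sup>2 - 2 * l * k * (r\<^sup>2 + c) + k\<^sup>2 * (2 * (r\<^sup>2 + c))"
        unfolding eq power2_norm_eq_inner using xx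
        by (simp add: inner_simps c_def inner_commute power2_eq_square algebra_simps)
      also have "\<dots> = 2 * (r\<^sup>2 * p\<^sup>2 + r\<^sup>2 * q\<^sup>2 - 2 * c * p * q) / (r\<^sup>2 * (r\<^sup>2 + c))"
      proof -
        have kl: "k * (r\<^sup>2 + c) = p + q" "l * r\<^sup>2 = 2 * p"
          using r c by (simp_all add: k_def l_def)
        have "l\<^sup>2 * r\<^sup>2 - 2 * l * k * (r\<^sup>2 + c) + k\<^sup>2 * (2 * (r\<^sup>2 + c)) =
            l * (l * r\<^sup>2) - 2 * l * (k * (r\<^sup>2 + c)) + 2 * k * (k * (r\<^sup>2 + c))"
          by (simp add: power2_eq_square algebra_simps)
        also have "\<dots> = 2 * k * (p + q) - 2 * l * q"
          unfolding kl by (simp add: algebra_simps)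
        finally have E: "l\<^sup>2 * r\<^sup>2 - 2 * l * k * (r\<^sup>2 + c) + k\<^sup>2 * (2 * (r\<^sup>2 + c)) = 2 * k * (p + q) - 2 * l * q" .
        have "(l\<^sup>2 * r\<^sup>2 - 2 * l * k * (r\<^sup>2 + c) + k\<^sup>2 * (2 * (r\<^sup>2 + c))) * (r\<^sup>2 * (r\<^sup>2 + c)) =
            2 * (k * (r\<^sup>2 + c)) * (p + q) * r\<^sup>2 - 2 * (l * r\<^sup>2) * q * (r\<^sup>2 + c)"
          unfolding E by (simp add: algebra_simps)
        also have "\<dots> = 2 * (r\<^sup>2 * p\<^sup>2 + r\<^sup>2 * q\<^sup>2 - 2 * c * p * q)"
          unfolding kl by (simp add: power2_eq_square algebra_simps)
        finally show ?thesis using r c by (simp add: nonzero_eq_divide_eq)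
      qed
      finally show ?thesis .
    qed
    define g where "g = r\<^sup>2 * r\<^sup>2 - c\<^sup>2"
    have g: "g = (r\<^sup>2 + c) * (r\<^sup>2 - c)" by (simp add: g_def power2_eq_square algebra_simps)
    have g0: "0 < g" unfolding g using c by simp
    \<comment> \<open>Cramer's rule with the Gram determinant \<open>g\<close>:
      \<open>A *\<^sub>R x + B *\<^sub>R x'\<close> is the orthogonal projection of \<open>y\<close>
      onto the span of \<open>x\<close> and \<open>x'\<close>. Its squared length is the quadratic
      form of step \<open>1\<close> divided by \<open>g\<close>, and the sign of the residual's
      squared norm is Bessel's inequality for this plane together with \<open>a\<close>.\<close>
    define A B where "A = (r\<^sup>2 * p - c * q) / g" and "B = (r\<^sup>2 * q - c * p) / g"
    have "0 \<le> (y - A *\<^sub>R x - B *\<^sub>R x' - \<alpha> *\<^sub>R a) \<bullet> (y - A *\<^sub>R x - B *\<^sub>R x' - \<alpha> *\<^sub>R a)" by simp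
    also have "\<dots> = (norm y)\<^sup>2 - 2 * A * p - 2 * B * q - \<alpha>\<^sup>2 + A\<^sup>2 * r\<^sup>2 + B\<^sup>2 * r\<^sup>2 + 2 * A * B * c"
      unfolding power2_norm_eq_inner using xx a(1)
      by (simp add: inner_simps c_def inner_commute p_def q_def \<alpha>_def a(2,3) norm_eq_1
          inner_commute[of x a] inner_commute[of x' a] power2_eq_square algebra_simps)
    also have "\<dots> = (norm y)\<^sup>2 - \<alpha>\<^sup>2 - (r\<^sup>2 * p\<^sup>2 + r\<^sup>2 * q\<^sup>2 - 2 * c * p * q) / g"
    proof -
      have "g * (- 2 * A * p - 2 * B * q + A\<^sup>2 * r\<^sup>2 + B\<^sup>2 * r\<^sup>2 + 2 * A * B * c) =
          - (r\<^sup>2 * p\<^sup>2 + r\<^sup>2 * q\<^sup>2 - 2 * c * p * q)"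
      proof -
        have Ag: "A * g = r\<^sup>2 * p - c * q" "B * g = r\<^sup>2 * q - c * p"
          using g0 by (simp_all add: A_def B_def)
        have u: "A * r\<^sup>2 + B * c = p" "B * r\<^sup>2 + A * c = q"
          using g0 unfolding A_def B_def by (simp_all add: divide_simps) (simp_all add: g_def power2_eq_square algebra_simps)
        have "- 2 * A * p - 2 * B * q + A\<^sup>2 * r\<^sup>2 + B\<^sup>2 * r\<^sup>2 + 2 * A * B * c
            = - 2 * A * p - 2 * B * q + A * (A * r\<^sup>2 + B * c) + B * (B * r\<^sup>2 + A * c)"
          by (simp add: power2_eq_square algebra_simps)
        also have "\<dots> = - A * p - B * q" unfolding u by simp
        finally have "g * (- 2 * A * p - 2 * B * q + A\<^sup>2 * r\<^sup>2 + B\<^sup>2 * r\<^sup>2 + 2 * A * B * c) =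
            - ((A * g) * p) - (B * g) * q" by (simp add: algebra_simps)
        then show ?thesis unfolding Ag by (simp add: power2_eq_square algebra_simps)
      qed
      then show ?thesis using g0 by (simp add: field_simps)
    qed
    finally have 2: "(r\<^sup>2 * p\<^sup>2 + r\<^sup>2 * q\<^sup>2 - 2 * c * p * q) / g \<le> (norm y)\<^sup>2 - \<alpha>\<^sup>2" by simp
    have "(norm x * norm (R y - y))\<^sup>2 = 2 * (r\<^sup>2 - c) * ((r\<^sup>2 * p\<^sup>2 + r\<^sup>2 * q\<^sup>2 - 2 * c * p * q) / g)"
    proof -
      have gen: "\<rho> * (2 * Q / (\<rho> * m)) = 2 * d * (Q / (m * d))" if "\<rho> \<noteq> 0" "m \<noteq> 0" "d \<noteq> 0" for \<rho> m d Q :: real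
        using that by (simp add: field_simps)
      show ?thesis
        unfolding power_mult_distrib 1 r_def[symmetric] g by (rule gen) (use r c in auto)
    qed
    also have "\<dots> \<le> 2 * (r\<^sup>2 - c) * ((norm y)\<^sup>2 - \<alpha>\<^sup>2)"
      using 2 c by (intro mult_left_mono) auto
    finally show ?thesis unfolding dd \<alpha>_def .
  qed
  have anti: "y + R y \<noteq> 0" if "y \<noteq> 0" for y
  proof
    assume "y + R y = 0"
    then have "R y - y = (-2) *\<^sub>R y" by (simp add: eq_neg_iff_add_eq_0[symmetric] scaleR_2 add.commute)
    then have "norm (R y - y) = 2 * norm y" by simp
    with bound[of y] have "r\<^sup>2 * (4 * (norm y)\<^sup>2) \<le> (norm (x - x'))\<^sup>2 * ((norm y)\<^sup>2 - (a \<bullet> y)\<^sup>2)"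
      by (simp add: power_mult_distrib r_def)
    also have "\<dots> \<le> (norm (x - x'))\<^sup>2 * (norm y)\<^sup>2" by (intro mult_left_mono) auto
    also have "(norm (x - x'))\<^sup>2 = 2 * (r\<^sup>2 - c)"
      unfolding power2_norm_eq_inner using xx by (simp add: inner_simps c_def inner_commute)
    finally have "(r\<^sup>2 * 4) * (norm y)\<^sup>2 \<le> (2 * (r\<^sup>2 - c)) * (norm y)\<^sup>2"
      by (simp only: mult.assoc)
    then have "r\<^sup>2 * 4 \<le> 2 * (r\<^sup>2 - c)"
      by (rule mult_right_le_imp_le) (use that in simp)
    then show False using c(1) by (simp add: algebra_simps)
  qed
  show thesis by (rule that[OF R Rx a(1,2) bound anti])
qed

text \<open>The weight \<open>1 - wt x / 25\<close> is what makes the contraction factor as small as \<open>9127/12500\<close>.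
  Antipodal points are excluded because no canonical rotation connects them.\<close>

definition ang_lip :: "real \<Rightarrow> (real^3 \<Rightarrow> real) \<Rightarrow> bool" where
  "ang_lip N h \<longleftrightarrow> (\<forall>x x'. norm x \<le> 1 \<and> norm x' = norm x \<and> x + x' \<noteq> 0 \<longrightarrow>
     norm x * \<bar>h x - h x'\<bar> \<le> N * (1 - wt x / 25) * norm (x - x'))"

text \<open>The average controls a coupled pair after one step; the term \<open>wt x / 2\<close> on
  the right is kept free for the diagonal part of \<open>kac_op\<close>. Because \<open>a\<close> is
  orthogonal to \<open>x\<close>, the integrand is a polynomial of degree at most four in
  \<open>w \<bullet> e\<close> and \<open>w \<bullet> a\<close>, so the sphere moments evaluate it
  as a polynomial in \<open>s = wt x\<close>.\<close>

lemma resample_moment: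
  assumes x: "norm x \<le> 1" "x \<noteq> 0" and a: "norm a = 1" "a \<bullet> x = 0"
  shows "(\<integral>w. wt (resample x w) * (1 - wt (resample x w) / 25) * (1 - (a \<bullet> resample x w)\<^sup>2 / 2) \<partial>sphere2)
    \<le> (9127/12500 - wt x / 2) * (1 - wt x / 25)"
proof -
  define s r e where "s = wt x" and "r = norm x" and "e = x /\<^sub>R r"
  have s: "0 \<le> s" "s \<le> 1" using x by (simp_all add: s_def wt_bounds)
  have r: "0 < r" "r\<^sup>2 = 1 - s" using x by (simp_all add: r_def s_def wt_def)
  have e: "norm e = 1" "a \<bullet> e = 0" and xe: "x = r *\<^sub>R e"
    using x a by (simp_all add: e_def r_def)
  define c D where "c = 3/4 - s/2" and "D = sqrt 3 / 2 * sqrt s * r"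
  have D2: "D\<^sup>2 = 3/4 * (s * (1 - s))"
    using s r by (simp add: D_def power_mult_distrib power_divide)
  define A0 A1 A2 where "A0 = c - c\<^sup>2 / 25" and "A1 = D * (1 - 2 * c / 25)" and "A2 = - D\<^sup>2 / 25"
  define B0 B1 B2 where B_def: "B0 = 3/8 * s * A0" "B1 = 3/8 * s * A1" "B2 = 3/8 * s * A2"
  have "(\<integral>w. wt (resample x w) * (1 - wt (resample x w) / 25) * (1 - (a \<bullet> resample x w)\<^sup>2 / 2) \<partial>sphere2) =
    (\<integral>w. A0 + A1 * (w \<bullet> e) + A2 * (w \<bullet> e)^2 - B0 * (w \<bullet> a)^2
        - B1 * ((w \<bullet> a)^2 * (w \<bullet> e)) - B2 * ((w \<bullet> a)^2 * (w \<bullet> e)^2) \<partial>sphere2)"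
  proof (rule integral_cong_AE)
    show "AE w in sphere2. wt (resample x w) * (1 - wt (resample x w) / 25) * (1 - (a \<bullet> resample x w)\<^sup>2 / 2) =
        A0 + A1 * (w \<bullet> e) + A2 * (w \<bullet> e)^2 - B0 * (w \<bullet> a)^2
        - B1 * ((w \<bullet> a)^2 * (w \<bullet> e)) - B2 * ((w \<bullet> a)^2 * (w \<bullet> e)^2)"
      using AE_uniform_sphere
    proof eventually_elim
      case (elim w)
      have "w \<bullet> x = r * (w \<bullet> e)" by (subst xe) simp
      then have 1: "wt (resample x w) = c + D * (w \<bullet> e)"
        using wt_resample[OF x(1) elim] by (simp add: c_def D_def s_def)
      have 2: "(a \<bullet> resample x w)\<^sup>2 = 3/4 * s * (w \<bullet> a)^2"
        using s a by (simp add: resample_def inner_diff_right power_mult_distrib power_divide inner_commute flip: s_def)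
      then show ?case
        unfolding 1 2 A0_def A1_def A2_def B_def by (simp add: power2_eq_square field_simps)
    qed
  qed measurable
  also have "\<dots> = A0 + A2 / 3 - (B0 / 3 + B2 / 15)"
  proof -
    note i = integrable_sphere2_inner
    have "integrable sphere2 (\<lambda>w. w \<bullet> e)" "integrable sphere2 (\<lambda>w. (w \<bullet> e)^2)"
      "integrable sphere2 (\<lambda>w. (w \<bullet> a)^2)" "integrable sphere2 (\<lambda>w. (w \<bullet> a)^2 * (w \<bullet> e))"
      "integrable sphere2 (\<lambda>w. (w \<bullet> a)^2 * (w \<bullet> e)^2)"
      using i[of e 1 e 0] i[of e 2 e 0] i[of a 2 e 0] i[of a 2 e 1] i[of a 2 e 2] by simp_all
    moreover have m: "(\<integral>w. w \<bullet> e \<partial>sphere2) = 0" "(\<integral>w. (w \<bullet> e)^2 \<partial>sphere2) = 1/3"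
      "(\<integral>w. (w \<bullet> a)^2 \<partial>sphere2) = 1/3"
      using sphere2_moment[OF e(1), of 1] sphere2_moment[OF e(1), of 2] sphere2_moment[OF a(1), of 2]
      by simp_all
    ultimately show ?thesis
      using sphere2.prob_space by (simp add: m sphere2_mixed_moments[OF a(1) e])
  qed
  also have "\<dots> = A0 + A2 / 3 - 3/8 * s * (A0 / 3 + A2 / 15)"
    by (simp add: B_def field_simps)
  \<comment> \<open>Here the constant \<open>9127/12500\<close> is tested. The left side at
    \<open>s = 0\<close> is \<open>291/400\<close>, below \<open>9127/12500\<close>. After the
    powers of \<open>s\<close> are replaced by \<open>s\<close>, the remaining coefficient
    \<open>227/3200 - 9127/312500 - 80/2000\<close> is still positive.\<close>
  also have "\<dots> \<le> (9127/12500 - s / 2) * (1 - s / 25)"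
  proof -
    have "s\<^sup>2 \<le> s" "s^3 \<le> s"
      using s power_decreasing[of 1 2 s] power_decreasing[of 1 3 s] by auto
    moreover have "(9127/12500 - s / 2) * (1 - s / 25) - (A0 + A2 / 3 - 3/8 * s * (A0 / 3 + A2 / 15)) =
        9127/12500 - 291/400 + (227/3200 - 9127/312500) * s - 79/2000 * s\<^sup>2 - 1/2000 * s^3"
      unfolding A0_def A2_def D2 c_def by (simp add: power2_eq_square power3_eq_cube field_simps)
    ultimately show ?thesis using s by simp
  qed
  finally show ?thesis by (simp add: s_def)
qed

lemma ang_lip_kac_op:
  assumes meas [measurable]: "h \<in> borel_measurable borel"
    and B: "\<And>y. norm y \<le> 1 \<Longrightarrow> \<bar>h y\<bar> \<le> B" and N: "0 \<le> N" "ang_lip N h"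
  shows "ang_lip (9127/12500 * N) (kac_op h)"
  unfolding ang_lip_def
proof (intro allI impI, elim conjE)
  fix x x' :: "real^3" assume x: "norm x \<le> 1" and nx: "norm x' = norm x" and anti: "x + x' \<noteq> 0"
  show "norm x * \<bar>kac_op h x - kac_op h x'\<bar> \<le> 9127/12500 * N * (1 - wt x / 25) * norm (x - x')"
  proof (cases "x = x'")
    case False
    define p where "p y = 1 - wt y / 25" for y
    have x0: "x \<noteq> 0" using False nx by auto
    define r t where "r = norm x" and "t = norm (x - x') / r"
    have r: "0 < r" using x0 by (simp add: r_def)
    have t: "0 \<le> t" "r * t = norm (x - x')" using r by (simp_all add: t_def)
    obtain R a where R: "orthogonal_transformation R" "R x = x'" and a: "norm a = 1" "a \<bullet> x = 0"
      and bound: "\<And>y. (norm x * norm (R y - y))\<^sup>2 \<le> (norm (x - x'))\<^sup>2 * ((norm y)\<^sup>2 - (a \<bullet> y)\<^sup>2)"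
      and antiR: "\<And>y. y \<noteq> 0 \<Longrightarrow> y + R y \<noteq> 0"
      using rotation_between[OF nx False anti] by blast
    have lin: "linear R" and nR: "norm (R y) = norm y" for y
      using R by (auto simp: orthogonal_transformation_linear orthogonal_transformation_norm)
    have [measurable]: "R \<in> borel_measurable borel" using lin by (rule borel_measurable_linear)
    have wtR: "wt (R y) = wt y" for y by (simp add: wt_def nR)
    have p0: "0 \<le> p y" for y using wt_bounds(2)[of y] by (simp add: p_def)
    \<comment> \<open>The chord from \<open>y\<close> to \<open>R y\<close> is at most
      \<open>t\<close> times the length of the part of \<open>y\<close> orthogonal to the axis. For
      \<open>norm y \<le> 1\<close> that length is at most
      \<open>norm y * (1 - (a \<bullet> y)^2 / 2)\<close>, which trades the square root for a
      polynomial whose moments are known.\<close>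
    have key: "\<bar>h y - h (R y)\<bar> \<le> N * p y * t * (1 - (a \<bullet> y)\<^sup>2 / 2)" if y: "norm y \<le> 1" for y
    proof (cases "y = 0")
      case True
      then show ?thesis using N t p0[of y] linear_0[OF lin] by simp
    next
      case y0: False
      have ay: "(a \<bullet> y)\<^sup>2 \<le> (norm y)\<^sup>2"
        using Cauchy_Schwarz_ineq[of a y] a by (simp add: power2_norm_eq_inner norm_eq_1)
      have y1: "(norm y)\<^sup>2 \<le> 1" using y by (simp add: power_le_one)
      have "(norm (R y - y))\<^sup>2 \<le> (t * norm y * (1 - (a \<bullet> y)\<^sup>2 / 2))\<^sup>2"
      proof -
        have "r\<^sup>2 * (norm (R y - y))\<^sup>2 \<le> r\<^sup>2 * (t\<^sup>2 * ((norm y)\<^sup>2 - (a \<bullet> y)\<^sup>2))"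
          using bound[of y] by (simp add: power_mult_distrib r_def[symmetric] t(2)[symmetric] mult.assoc)
        then have "(norm (R y - y))\<^sup>2 \<le> t\<^sup>2 * ((norm y)\<^sup>2 - (a \<bullet> y)\<^sup>2)"
          using r by simp
        also have "\<dots> \<le> t\<^sup>2 * ((norm y)\<^sup>2 * (1 - (a \<bullet> y)\<^sup>2 / 2)\<^sup>2)"
        proof (rule mult_left_mono)
          have "(norm y)\<^sup>2 * (a \<bullet> y)\<^sup>2 \<le> 1 * (a \<bullet> y)\<^sup>2" using y1 by (intro mult_right_mono) auto
          moreover have "0 \<le> (norm y)\<^sup>2 * ((a \<bullet> y)\<^sup>2)\<^sup>2 / 4" by simp
          moreover have "(norm y)\<^sup>2 * (1 - (a \<bullet> y)\<^sup>2 / 2)\<^sup>2 =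
              (norm y)\<^sup>2 - (norm y)\<^sup>2 * (a \<bullet> y)\<^sup>2 + (norm y)\<^sup>2 * ((a \<bullet> y)\<^sup>2)\<^sup>2 / 4"
            by (simp add: power2_eq_square field_simps)
          ultimately show "(norm y)\<^sup>2 - (a \<bullet> y)\<^sup>2 \<le> (norm y)\<^sup>2 * (1 - (a \<bullet> y)\<^sup>2 / 2)\<^sup>2" by linarith
        qed simp
        finally show ?thesis by (simp add: power_mult_distrib)
      qed
      then have Ry: "norm (R y - y) \<le> t * norm y * (1 - (a \<bullet> y)\<^sup>2 / 2)"
        using t ay y1 by (intro power2_le_imp_le[OF _ mult_nonneg_nonneg]) auto
      have "norm y * \<bar>h y - h (R y)\<bar> \<le> N * p y * norm (y - R y)"
        using N(2) y nR[of y] antiR[OF y0] unfolding ang_lip_def p_def by blast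
      also have "\<dots> \<le> N * p y * (t * norm y * (1 - (a \<bullet> y)\<^sup>2 / 2))"
        using Ry N p0[of y] by (intro mult_left_mono) (auto simp: norm_minus_commute)
      finally have "norm y * \<bar>h y - h (R y)\<bar> \<le> norm y * (N * p y * t * (1 - (a \<bullet> y)\<^sup>2 / 2))"
        by (simp add: mult_ac)
      then show ?thesis using y0 by simp
    qed
    have resR: "resample x' (R w) = R (resample x w)" for w
      using R(2) by (simp add: resample_def wt_def nx linear_diff[OF lin] linear_cmul[OF lin])
    define G where "G y = wt y * h y" for y
    have [measurable]: "G \<in> borel_measurable borel" unfolding G_def by measurable
    have GB: "\<bar>G y\<bar> \<le> B" if "norm y \<le> 1" for y
    proof -
      have "\<bar>G y\<bar> \<le> 1 * B"
        unfolding G_def abs_mult using that B[OF that] wt_bounds[of y] by (intro mult_mono) auto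
      then show ?thesis by simp
    qed
    have "cond_mean G x' = (\<integral>w. G (resample x' w) \<partial>distr sphere2 borel R)"
      by (simp add: cond_mean_def uniform_sphere_orthogonal_vec[OF R(1)])
    also have "\<dots> = (\<integral>w. G (R (resample x w)) \<partial>sphere2)"
      by (subst integral_distr) (simp_all add: resR)
    finally have cm': "cond_mean G x' = (\<integral>w. G (R (resample x w)) \<partial>sphere2)" .
    have int1: "integrable sphere2 (\<lambda>w. G (resample x w))"
      by (rule integrable_resample[OF _ GB x]) auto
    have int2: "integrable sphere2 (\<lambda>w. G (R (resample x w)))"
      by (rule integrable_resample[of "\<lambda>y. G (R y)" B]) (auto simp: nR GB x)
    have "\<bar>cond_mean G x - cond_mean G x'\<bar> = \<bar>\<integral>w. G (resample x w) - G (R (resample x w)) \<partial>sphere2\<bar>"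
      unfolding cm' using int1 int2 by (simp add: cond_mean_def)
    also have "\<dots> \<le> (\<integral>w. \<bar>G (resample x w) - G (R (resample x w))\<bar> \<partial>sphere2)"
      by (rule integral_abs_bound)
    also have "\<dots> \<le> (\<integral>w. N * t * (wt (resample x w) * p (resample x w) * (1 - (a \<bullet> resample x w)\<^sup>2 / 2)) \<partial>sphere2)"
    proof (rule integral_mono_AE)
      show "integrable sphere2 (\<lambda>w. \<bar>G (resample x w) - G (R (resample x w))\<bar>)"
        using int1 int2 by simp
      have "\<bar>wt y * p y * (1 - (a \<bullet> y)\<^sup>2 / 2)\<bar> \<le> 1 * 1 * 1" if y: "norm y \<le> 1" for y
      proof -
        have "(a \<bullet> y)\<^sup>2 \<le> (norm y)\<^sup>2"
          using Cauchy_Schwarz_ineq[of a y] a by (simp add: power2_norm_eq_inner norm_eq_1)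
        also have "\<dots> \<le> 1" using y by (simp add: power_le_one)
        finally show ?thesis
          unfolding abs_mult using wt_bounds[of y] y
          by (intro mult_mono) (auto simp: p_def)
      qed
      then show "integrable sphere2 (\<lambda>w. N * t * (wt (resample x w) * p (resample x w) * (1 - (a \<bullet> resample x w)\<^sup>2 / 2)))"
        using x by (intro integrable_mult_right integrable_resample[of "\<lambda>y. wt y * p y * (1 - (a \<bullet> y)\<^sup>2 / 2)" 1])
          (auto simp: p_def)
      show "AE w in sphere2. \<bar>G (resample x w) - G (R (resample x w))\<bar> \<le>
          N * t * (wt (resample x w) * p (resample x w) * (1 - (a \<bullet> resample x w)\<^sup>2 / 2))"
        using AE_norm_resample[OF x]
      proof eventually_elim
        case (elim w)
        let ?y = "resample x w"
        have "\<bar>G ?y - G (R ?y)\<bar> = wt ?y * \<bar>h ?y - h (R ?y)\<bar>"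
          using wt_bounds(1)[OF elim] by (simp add: G_def wtR abs_mult flip: right_diff_distrib)
        also have "\<dots> \<le> wt ?y * (N * p ?y * t * (1 - (a \<bullet> ?y)\<^sup>2 / 2))"
          using wt_bounds(1)[OF elim] key[OF elim] by (intro mult_left_mono)
        finally show ?case by (simp add: mult_ac)
      qed
    qed
    also have "\<dots> \<le> N * t * ((9127/12500 - wt x / 2) * p x)"
      using resample_moment[OF x x0 a] N t by (simp add: p_def mult_left_mono)
    finally have cm: "\<bar>cond_mean G x - cond_mean G x'\<bar> \<le> N * t * ((9127/12500 - wt x / 2) * p x)" .
    \<comment> \<open>\<open>x\<close> and \<open>x'\<close> have equal weight, so the diagonal part
      passes the increment of \<open>h\<close> on with the factor \<open>wt x / 2\<close>. This is
      exactly the amount that \<open>resample_moment\<close> subtracts.\<close>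
    have "\<bar>kac_op h x - kac_op h x'\<bar> \<le> 1/2 * wt x * \<bar>h x - h x'\<bar> + \<bar>cond_mean G x - cond_mean G x'\<bar>"
    proof -
      have "wt x' = wt x" by (simp add: wt_def nx)
      then have "kac_op h x - kac_op h x' = 1/2 * wt x * (h x - h x') + (cond_mean G x - cond_mean G x')"
        by (simp add: kac_op_def G_def[abs_def] field_simps)
      then have "\<bar>kac_op h x - kac_op h x'\<bar> \<le> \<bar>1/2 * wt x * (h x - h x')\<bar> + \<bar>cond_mean G x - cond_mean G x'\<bar>"
        by (metis abs_triangle_ineq)
      then show ?thesis using wt_bounds(1)[OF x] by (simp add: abs_mult)
    qed
    also have "r * \<dots> \<le> 1/2 * wt x * (N * p x * (r * t)) + r * (N * t * ((9127/12500 - wt x / 2) * p x))"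
    proof -
      have "r * \<bar>h x - h x'\<bar> \<le> N * p x * (r * t)"
        using N(2) x nx anti unfolding ang_lip_def p_def r_def t(2)[unfolded r_def] by blast
      then have "1/2 * wt x * (r * \<bar>h x - h x'\<bar>) \<le> 1/2 * wt x * (N * p x * (r * t))"
        using wt_bounds(1)[OF x] by (intro mult_left_mono) auto
      moreover have "r * \<bar>cond_mean G x - cond_mean G x'\<bar> \<le> r * (N * t * ((9127/12500 - wt x / 2) * p x))"
        using cm r by (intro mult_left_mono) auto
      ultimately show ?thesis by (simp add: distrib_left mult_ac)
    qed
    also have "\<dots> = 9127/12500 * N * p x * (r * t)"
      by (simp add: algebra_simps)
    finally show ?thesis using r by (simp add: p_def r_def t(2)[unfolded r_def])
  qed simp
qed

section \<open>Positivity of the operator and the two-step minorization\<close>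

lemma integrable_indicator_Icc: "integrable lborel (indicator {a..b::real} :: real \<Rightarrow> real)"
  by (rule integrable_real_indicator) (auto simp: emeasure_lborel_Icc_eq)

lemma abs_wt_mult_le:
  assumes "\<bar>f y\<bar> \<le> B" "norm y \<le> 1"
  shows "\<bar>wt y * f y\<bar> \<le> (B :: real)"
proof -
  have "\<bar>wt y * f y\<bar> \<le> 1 * B"
    unfolding abs_mult using assms wt_bounds[of y] by (intro mult_mono) auto
  then show ?thesis by simp
qed

lemma kac_op_mono:
  assumes [measurable]: "g \<in> borel_measurable borel" "h \<in> borel_measurable borel"
    and g: "\<And>y. norm y \<le> 1 \<Longrightarrow> \<bar>g y\<bar> \<le> B" and h: "\<And>y. norm y \<le> 1 \<Longrightarrow> \<bar>h y\<bar> \<le> C"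
    and le: "\<And>y. norm y \<le> 1 \<Longrightarrow> g y \<le> h y" and x: "norm x \<le> 1"
  shows "kac_op g x \<le> kac_op h x"
  unfolding kac_op_def
proof (rule add_mono)
  show "1/2 * wt x * g x \<le> 1/2 * wt x * h x"
    using le[OF x] wt_bounds(1)[OF x] by (intro mult_left_mono) auto
  show "cond_mean (\<lambda>y. wt y * g y) x \<le> cond_mean (\<lambda>y. wt y * h y) x"
    using g h le wt_bounds(1)
    by (intro cond_mean_mono[where B = B and C = C] x) (auto intro!: abs_wt_mult_le mult_left_mono)
qed

lemma kac_op_cong:
  assumes [measurable]: "g \<in> borel_measurable borel" "h \<in> borel_measurable borel"
    and eq: "\<And>y. norm y \<le> 1 \<Longrightarrow> g y = h y" and x: "norm x \<le> 1"
  shows "kac_op g x = kac_op h x"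
  unfolding kac_op_def cond_mean_def
proof (intro arg_cong2[of _ _ _ _ "(+)"])
  show "1/2 * wt x * g x = 1/2 * wt x * h x" using eq x by simp
  show "(\<integral>w. wt (resample x w) * g (resample x w) \<partial>sphere2) = (\<integral>w. wt (resample x w) * h (resample x w) \<partial>sphere2)"
    by (rule integral_cong_AE) (use AE_norm_resample[OF x] eq in \<open>auto elim!: eventually_mono\<close>)
qed

lemma kac_op_cmult: "kac_op (\<lambda>y. c * h y) x = c * kac_op h x"
proof -
  have "cond_mean (\<lambda>y. wt y * (c * h y)) x = c * cond_mean (\<lambda>y. wt y * h y) x"
    unfolding cond_mean_def by (subst integral_mult_right_zero[symmetric]) (simp add: mult_ac)
  then show ?thesis by (simp add: kac_op_def algebra_simps)
qed

lemma kac_op_const: "norm x \<le> 1 \<Longrightarrow> kac_op (\<lambda>_. c) x = 3/4 * c"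
proof -
  assume x: "norm x \<le> 1"
  have "kac_op (\<lambda>_. 1) x = 3/4"
    using cond_mean_wt[OF x] by (simp add: kac_op_def)
  then show ?thesis using kac_op_cmult[of c "\<lambda>_. 1" x] by simp
qed

text \<open>Monotonicity squeezes \<open>kac_op h\<close> between the images
  \<open>- 3/4 * B\<close> and \<open>3/4 * B\<close> of the constants.\<close>

lemma abs_kac_op_le:
  assumes [measurable]: "h \<in> borel_measurable borel"
    and h: "\<And>y. norm y \<le> 1 \<Longrightarrow> \<bar>h y\<bar> \<le> B" and x: "norm x \<le> 1"
  shows "\<bar>kac_op h x\<bar> \<le> 3/4 * B"
proof -
  have B: "0 \<le> B" using h[OF x] by simp
  have h': "h y \<le> B" "- B \<le> h y" if "norm y \<le> 1" for y using h[OF that] by auto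
  have "kac_op h x \<le> kac_op (\<lambda>_. B) x"
    by (rule kac_op_mono[where B = B and C = B]) (use h h' x B in auto)
  moreover have "kac_op (\<lambda>_. - B) x \<le> kac_op h x"
    by (rule kac_op_mono[where B = B and C = B]) (use h h' x B in auto)
  ultimately show ?thesis
    using kac_op_const[OF x] by (simp add: abs_le_iff)
qed

text \<open>A Doeblin condition. The outer application, started anywhere, carries weight at least
  \<open>1/8\<close> to points with \<open>wt\<close> in \<open>[1/4, 3/4]\<close>; from there the
  inner one spreads \<open>wt\<close> over all of \<open>[1/4, 3/4]\<close> with density at least
  \<open>2 / sqrt 3\<close>. The constant is \<open>23/20 * 1/8\<close>, where \<open>23/20\<close>
  is a rational lower bound for \<open>2 / sqrt 3\<close>.\<close>

lemma kac_op_twice_minorization: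
  fixes g :: "real \<Rightarrow> real"
  assumes [measurable]: "g \<in> borel_measurable borel"
    and g: "\<And>s. 0 \<le> s \<Longrightarrow> s \<le> 1 \<Longrightarrow> 0 \<le> g s \<and> g s \<le> B"
    and x: "norm x \<le> 1"
  shows "23/160 * (\<integral>s. indicator {1/4..3/4} s * (s * g s) \<partial>lborel) \<le> kac_op (kac_op (\<lambda>y. g (wt y))) x"
proof -
  define L where "L = (\<integral>s. indicator {1/4..3/4} s * (s * g s) \<partial>lborel)"
  have L0: "0 \<le> L"
    unfolding L_def using g by (intro integral_nonneg_AE) (auto simp: indicator_def)
  let ?G = "\<lambda>y. g (wt y)"
  have wt01: "0 \<le> wt y \<and> wt y \<le> 1" if "norm y \<le> 1" for y using wt_bounds[of y] that by simp
  have G0: "0 \<le> ?G y" "\<bar>?G y\<bar> \<le> B" if "norm y \<le> 1" for y using g[of "wt y"] wt01[OF that] by auto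
  have wtGB: "\<bar>wt y * ?G y\<bar> \<le> B" if "norm y \<le> 1" for y
    using abs_wt_mult_le[of ?G y B] G0(2) that by blast
  have wtG: "0 \<le> cond_mean (\<lambda>y. wt y * ?G y) y" if "norm y \<le> 1" for y
  proof -
    have "cond_mean (\<lambda>_. 0) y \<le> cond_mean (\<lambda>y. wt y * ?G y) y"
      by (rule cond_mean_mono[where B = 0 and C = B])
        (use that G0(1) wtGB wt01 in auto)
    then show ?thesis by (simp add: cond_mean_def)
  qed
  have KG: "2 / sqrt 3 * L * indicator {1/4..3/4} (wt y) \<le> kac_op ?G y" if y: "norm y \<le> 1" for y
  proof -
    have "2 / sqrt 3 * L * indicator {1/4..3/4} (wt y) \<le> cond_mean (\<lambda>y. wt y * ?G y) y"
    proof (cases "wt y \<in> {1/4..3/4}")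
      case True
      have "2 / sqrt 3 * L \<le> cond_mean (\<lambda>y. (\<lambda>s. s * g s) (wt y)) y"
        unfolding L_def
      proof (rule cond_mean_radial_minorization[where B = B])
        show "0 \<le> s * g s \<and> s * g s \<le> B" if "0 \<le> s" "s \<le> 1" for s
          using g[OF that] that mult_left_le_one_le[of "g s" s] by auto
      qed (use True y in auto)
      then show ?thesis using True by simp
    qed (use wtG[OF y] in simp)
    moreover have "0 \<le> 1/2 * wt y * ?G y" using wt01[OF y] G0[OF y] by simp
    ultimately show ?thesis unfolding kac_op_def by linarith
  qed
  have KB: "\<bar>kac_op ?G y\<bar> \<le> 3/4 * B" if "norm y \<le> 1" for y
    using G0 that by (intro abs_kac_op_le) auto
  have i1: "\<bar>2 / sqrt 3 * L * indicator {1/4..3/4} (wt y)\<bar> \<le> 2 / sqrt 3 * L" for y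
    using L0 by (auto simp: indicator_def)
  have "sqrt 3 \<le> 40/23" by (rule real_le_lsqrt) (auto simp: power2_eq_square)
  then have "23/20 \<le> 2 / sqrt 3" by (simp add: field_simps)
  then have "23/20 * L \<le> 2 / sqrt 3 * L" using L0 by (rule mult_right_mono)
  then have "23/160 * L \<le> 2 / sqrt 3 * L * (1/8)" by simp
  also have "\<dots> \<le> 2 / sqrt 3 * L * cond_mean (\<lambda>y. wt y * indicator {1/4..3/4} (wt y)) x"
    using cond_mean_wt_middle[OF x] L0 by (intro mult_left_mono) auto
  also have "\<dots> = cond_mean (\<lambda>y. wt y * (2 / sqrt 3 * L * indicator {1/4..3/4} (wt y))) x"
    unfolding cond_mean_def by (subst integral_mult_right_zero[symmetric]) (simp add: mult_ac)
  also have "\<dots> \<le> cond_mean (\<lambda>y. wt y * kac_op ?G y) x"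
  proof (rule cond_mean_mono[where B = "2 / sqrt 3 * L" and C = "3/4 * B"])
    show "\<bar>wt y * (2 / sqrt 3 * L * indicator {1/4..3/4} (wt y))\<bar> \<le> 2 / sqrt 3 * L" if "norm y \<le> 1" for y
      using abs_wt_mult_le[OF i1 that] .
    show "\<bar>wt y * kac_op ?G y\<bar> \<le> 3/4 * B" if "norm y \<le> 1" for y
      using abs_wt_mult_le[OF KB that] that by simp
    show "wt y * (2 / sqrt 3 * L * indicator {1/4..3/4} (wt y)) \<le> wt y * kac_op ?G y" if "norm y \<le> 1" for y
      using KG[OF that] wt01[OF that] by (intro mult_left_mono) auto
  qed (use x in auto)
  also have "\<dots> \<le> kac_op (kac_op ?G) x"
  proof -
    have "0 \<le> 2 / sqrt 3 * L * indicator {1/4..3/4} (wt x)" using L0 by simp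
    then have "0 \<le> kac_op ?G x" using KG[OF x] by linarith
    then show ?thesis using wt01[OF x] by (simp add: kac_op_def[of "kac_op ?G"])
  qed
  finally show ?thesis by (simp add: L_def)
qed

section \<open>Oscillation and spectral bound\<close>

text \<open>Stated through a lower bound \<open>m\<close> rather than a supremum and an infimum: the
  minorization produces such an \<open>m\<close> explicitly.\<close>

definition osc_le :: "real \<Rightarrow> (real^3 \<Rightarrow> real) \<Rightarrow> bool" where
  "osc_le r h \<longleftrightarrow> (\<exists>m. \<forall>x. norm x \<le> 1 \<longrightarrow> m \<le> h x \<and> h x \<le> m + r)"

text \<open>A pair that is not antipodal has chord at most \<open>2 * norm x\<close>, hence a
  difference of at most \<open>2 * N\<close>. Antipodal points are joined through a third vector of
  the same norm orthogonal to them. So \<open>h\<close> is within \<open>4 * N\<close> of a radial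
  function.\<close>

lemma ang_lip_antipodal:
  assumes N: "0 \<le> N" "ang_lip N h" and x: "norm x \<le> 1" and n: "norm x' = norm x"
  shows "\<bar>h x - h x'\<bar> \<le> 4 * N"
proof -
  have *: "\<bar>h y - h z\<bar> \<le> 2 * N" if y: "norm y \<le> 1" "norm z = norm y" "y + z \<noteq> 0" "y \<noteq> 0" for y z
  proof -
    have "norm y * \<bar>h y - h z\<bar> \<le> N * (1 - wt y / 25) * norm (y - z)"
      using N y unfolding ang_lip_def by blast
    also have "\<dots> \<le> N * 1 * (2 * norm y)"
      using wt_bounds(1)[OF y(1)] wt_bounds(2)[of y] N norm_triangle_ineq4[of y z] y(2)
      by (intro mult_mono) auto
    finally have "norm y * \<bar>h y - h z\<bar> \<le> norm y * (2 * N)" by (simp add: mult_ac)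
    then show ?thesis using y(4) by simp
  qed
  consider "x = 0" | "x \<noteq> 0" "x + x' \<noteq> 0" | "x \<noteq> 0" "x' = - x" by (auto simp: eq_neg_iff_add_eq_0 add.commute)
  then show ?thesis
  proof cases
    case 1
    then show ?thesis using n N by simp
  next
    case 2
    then show ?thesis using *[of x x'] x n N by linarith
  next
    case 3
    have "dim {x} < DIM(real^3)" using dim_le_card'[of "{x}"] by simp
    from orthogonal_to_subspace_exists[OF this] obtain z0 where
      z0: "z0 \<noteq> 0" "\<And>y. y \<in> span {x} \<Longrightarrow> orthogonal z0 y" by auto
    define z where "z = (norm x / norm z0) *\<^sub>R z0"
    have z: "norm z = norm x" "z \<bullet> x = 0" using z0(1) z0(2)[of x] by (auto simp: z_def orthogonal_def span_base)
    have "x + z \<noteq> 0" "z + x' \<noteq> 0"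
    proof -
      have "(x + z) \<bullet> x \<noteq> 0" "(z + x') \<bullet> x \<noteq> 0" using z 3 by (auto simp: inner_simps)
      then show "x + z \<noteq> 0" "z + x' \<noteq> 0" by auto
    qed
    moreover have "z \<noteq> 0" using z(1) 3 by auto
    ultimately have "\<bar>h x - h z\<bar> \<le> 2 * N" "\<bar>h z - h x'\<bar> \<le> 2 * N"
      using *[of x z] *[of z x'] x z(1) n 3 by auto
    then show ?thesis by linarith
  qed
qed

text \<open>For the radial part the minorization is applied to \<open>g - m\<close> and to
  \<open>m + r - g\<close>. The functional takes the value \<open>c / 4\<close> on a constant
  \<open>c\<close>, so the two bounds approach each other by \<open>23/160 * r / 4\<close>, which
  leaves \<open>9/16 - 23/640 = 337/640\<close>. The nonradial remainder, at most
  \<open>4 * N\<close>, costs \<open>(3/4)^2 * 4 * N\<close> on either side.\<close>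

lemma osc_le_kac_op_twice:
  assumes [measurable]: "h \<in> borel_measurable borel"
    and B: "\<And>y. norm y \<le> 1 \<Longrightarrow> \<bar>h y\<bar> \<le> B"
    and N: "0 \<le> N" "ang_lip N h" and r: "osc_le r h"
  shows "osc_le (337/640 * r + 9/2 * N) (kac_op (kac_op h))"
proof -
  from r obtain m where m: "\<And>x. norm x \<le> 1 \<Longrightarrow> m \<le> h x \<and> h x \<le> m + r"
    by (auto simp: osc_le_def)
  let ?e = "axis 1 1 :: real^3"
  \<comment> \<open>The radial profile is read off along one ray; \<open>sqrt (1 - s)\<close> is the
    norm that belongs to the weight \<open>s\<close>.\<close>
  define g where "g s = h (sqrt (1 - s) *\<^sub>R ?e)" for s
  have [measurable]: "g \<in> borel_measurable borel" unfolding g_def by measurable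
  have gh: "g (wt y) = h (norm y *\<^sub>R ?e)" for y by (simp add: g_def wt_def)
  have gm: "m \<le> g s \<and> g s \<le> m + r" if "0 \<le> s" "s \<le> 1" for s
    unfolding g_def using that by (intro m) (simp add: norm_axis_1)
  have near: "\<bar>h y - g (wt y)\<bar> \<le> 4 * N" if "norm y \<le> 1" for y
    unfolding gh by (rule ang_lip_antipodal[OF N that]) (simp add: norm_axis_1)
  have gB: "\<bar>g (wt y)\<bar> \<le> \<bar>m\<bar> + \<bar>m + r\<bar>" if "norm y \<le> 1" for y
    using gm[of "wt y"] wt_bounds(1)[OF that] wt_bounds(2)[of y] by linarith
  define D where "D = \<bar>m\<bar> + \<bar>m + r\<bar>"
  note gB = gB[folded D_def]
  define L where "L = (\<integral>s. indicator {1/4..3/4} s * (s * g s) \<partial>lborel)"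
  have intc: "integrable lborel (\<lambda>s::real. indicator {1/4..3/4} s * (s * c))" for c
  proof (rule Bochner_Integration.integrable_bound[of _ "\<lambda>s. \<bar>c\<bar> * indicator {1/4..3/4} s"])
    show "integrable lborel (\<lambda>s::real. \<bar>c\<bar> * indicator {1/4..3/4} s)"
      by (intro integrable_mult_right integrable_indicator_Icc)
    show "AE s in lborel. norm (indicator {1/4..3/4} s * (s * c)) \<le> norm (\<bar>c\<bar> * indicator {1/4..3/4} (s::real))"
      by (auto simp: indicator_def abs_mult mult_left_le_one_le)
  qed simp
  have intg: "integrable lborel (\<lambda>s. indicator {1/4..3/4} s * (s * g s))"
  proof (rule Bochner_Integration.integrable_bound[OF intc[of D]])
    have D: "\<bar>g s\<bar> \<le> \<bar>D\<bar>" if "1/4 \<le> s" "s \<le> 3/4" for s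
    proof -
      have "m \<le> g s" "g s \<le> m + r" using gm[of s] that by auto
      then show ?thesis unfolding D_def by linarith
    qed
    show "AE s in lborel. norm (indicator {1/4..3/4} s * (s * g s)) \<le> norm (indicator {1/4..3/4} s * (s * D))"
      by (rule AE_I2) (simp add: indicator_def abs_mult mult_left_mono D)
  qed simp
  have Lc: "(\<integral>s. indicator {1/4..3/4} s * (s * c) \<partial>lborel) = c / 4" for c :: real
    using integral_power[of "1/4" "3/4" 1]
    by (simp add: mult.assoc[symmetric] mult.commute[of "indicator _ _"] power2_eq_square)
  let ?K = "\<lambda>h. kac_op (kac_op h)"
  have Kc: "?K (\<lambda>_. c) x = 9/16 * c" if "norm x \<le> 1" for c x
    using that kac_op_cong[of "kac_op (\<lambda>_. c)" "\<lambda>_. 3/4 * c" x] by (simp add: kac_op_const)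
  have Kdiff: "?K (\<lambda>y. u y - v y) x = ?K u x - ?K v x"
    if [measurable]: "u \<in> borel_measurable borel" "v \<in> borel_measurable borel"
      and u: "\<And>y. norm y \<le> 1 \<Longrightarrow> \<bar>u y\<bar> \<le> C" and v: "\<And>y. norm y \<le> 1 \<Longrightarrow> \<bar>v y\<bar> \<le> E" and x: "norm x \<le> 1"
    for u v C E x
  proof -
    have "?K (\<lambda>y. u y - v y) x = kac_op (\<lambda>y. kac_op u y - kac_op v y) x"
      by (rule kac_op_cong) (use kac_op_diff[of u v C E] u v x in auto)
    also have "\<dots> = ?K u x - ?K v x"
      by (rule kac_op_diff[where B = "3/4 * C" and C = "3/4 * E"]) (use abs_kac_op_le u v x in auto)
    finally show ?thesis .
  qed
  have lo: "9/16 * m + 23/160 * (L - m / 4) \<le> ?K (\<lambda>y. g (wt y)) x" if x: "norm x \<le> 1" for x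
  proof -
    have "23/160 * (\<integral>s. indicator {1/4..3/4} s * (s * (g s - m)) \<partial>lborel) \<le> ?K (\<lambda>y. g (wt y) - m) x"
      by (rule kac_op_twice_minorization[of "\<lambda>s. g s - m" r x]) (use gm x in \<open>auto simp: diff_le_eq add.commute\<close>)
    moreover have "(\<integral>s. indicator {1/4..3/4} s * (s * (g s - m)) \<partial>lborel) = L - m / 4"
      using intc[of m] intg by (simp add: right_diff_distrib L_def Lc)
    moreover have "?K (\<lambda>y. g (wt y) - m) x = ?K (\<lambda>y. g (wt y)) x - 9/16 * m"
      using Kdiff[of "\<lambda>y. g (wt y)" "\<lambda>_. m" D "\<bar>m\<bar>" x] gB x Kc[OF x] by simp
    ultimately show ?thesis by (simp add: field_simps)
  qed
  have hi: "?K (\<lambda>y. g (wt y)) x \<le> 9/16 * (m + r) - 23/160 * ((m + r) / 4 - L)" if x: "norm x \<le> 1" for x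
  proof -
    have "23/160 * (\<integral>s. indicator {1/4..3/4} s * (s * (m + r - g s)) \<partial>lborel) \<le> ?K (\<lambda>y. m + r - g (wt y)) x"
      by (rule kac_op_twice_minorization[of "\<lambda>s. m + r - g s" r x]) (use gm x in auto)
    moreover have "(\<integral>s. indicator {1/4..3/4} s * (s * (m + r - g s)) \<partial>lborel) = (m + r) / 4 - L"
      using intc[of "m + r"] intg by (simp add: right_diff_distrib L_def Lc)
    moreover have "?K (\<lambda>y. (m + r) - g (wt y)) x = 9/16 * (m + r) - ?K (\<lambda>y. g (wt y)) x"
      using Kdiff[of "\<lambda>_. m + r" "\<lambda>y. g (wt y)" "\<bar>m + r\<bar>" D x] gB x Kc[OF x] by simp
    ultimately show ?thesis by (simp add: field_simps)
  qed
  have "\<bar>?K h x - ?K (\<lambda>y. g (wt y)) x\<bar> \<le> 9/4 * N" if x: "norm x \<le> 1" for x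
  proof -
    have "?K (\<lambda>y. h y - g (wt y)) x = ?K h x - ?K (\<lambda>y. g (wt y)) x"
      by (rule Kdiff[OF _ _ B gB x]) auto
    moreover have "\<bar>?K (\<lambda>y. h y - g (wt y)) x\<bar> \<le> 3/4 * (3/4 * (4 * N))"
      by (intro abs_kac_op_le near x) auto
    ultimately show ?thesis by simp
  qed
  note near2 = this
  have "9/16 * m + 23/160 * (L - m / 4) - 9/4 * N \<le> ?K h x \<and>
      ?K h x \<le> 9/16 * m + 23/160 * (L - m / 4) - 9/4 * N + (337/640 * r + 9/2 * N)" if x: "norm x \<le> 1" for x
  proof -
    define u v where "u = ?K h x" and "v = ?K (\<lambda>y. g (wt y)) x"
    have "\<bar>u - v\<bar> \<le> 9/4 * N" "9/16 * m + 23/160 * (L - m / 4) \<le> v"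
      "v \<le> 9/16 * (m + r) - 23/160 * ((m + r) / 4 - L)"
      unfolding u_def v_def by (rule near2[OF x] lo[OF x] hi[OF x])+
    then show ?thesis
      unfolding u_def[symmetric] by argo
  qed
  then show ?thesis unfolding osc_le_def by blast
qed

lemma kac_op_funpow:
  assumes [measurable]: "h \<in> borel_measurable borel"
    and B: "\<And>y. norm y \<le> 1 \<Longrightarrow> \<bar>h y\<bar> \<le> B" and N: "0 \<le> N" "ang_lip N h"
  shows "(kac_op ^^ m) h \<in> borel_measurable borel"
    and "norm y \<le> 1 \<Longrightarrow> \<bar>(kac_op ^^ m) h y\<bar> \<le> B"
    and "ang_lip (N * (9127/12500)^m) ((kac_op ^^ m) h)"
proof -
  have B0: "0 \<le> B" using B[of 0] by simp
  have "(kac_op ^^ m) h \<in> borel_measurable borel \<and> (\<forall>y. norm y \<le> 1 \<longrightarrow> \<bar>(kac_op ^^ m) h y\<bar> \<le> B) \<and>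
    ang_lip (N * (9127/12500)^m) ((kac_op ^^ m) h)"
  proof (induction m)
    case 0
    then show ?case using B N by simp
  next
    case (Suc m)
    let ?h = "(kac_op ^^ m) h"
    have [measurable]: "?h \<in> borel_measurable borel" using Suc by simp
    have "\<bar>kac_op ?h y\<bar> \<le> B" if "norm y \<le> 1" for y
      using abs_kac_op_le[of ?h B y] Suc that B0 by simp
    moreover have "ang_lip (9127/12500 * (N * (9127/12500)^m)) (kac_op ?h)"
      using Suc N by (intro ang_lip_kac_op[of _ B]) auto
    ultimately show ?case by (simp add: mult_ac)
  qed
  then show "(kac_op ^^ m) h \<in> borel_measurable borel"
    and "norm y \<le> 1 \<Longrightarrow> \<bar>(kac_op ^^ m) h y\<bar> \<le> B"
    and "ang_lip (N * (9127/12500)^m) ((kac_op ^^ m) h)" by auto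
qed

lemma osc_le_mono: "osc_le r h \<Longrightarrow> r \<le> r' \<Longrightarrow> osc_le r' h"
  unfolding osc_le_def by (metis add_left_mono order_trans)

text \<open>The oscillations satisfy a recursion with factor \<open>337/640\<close> and a source
  term of order \<open>q^m\<close>. As \<open>q\<close> exceeds \<open>337/640\<close>, the source
  determines the rate, and \<open>K\<close> is chosen large enough for the start and for the
  induction step, where it has to absorb the source.\<close>

lemma osc_le_funpow:
  assumes [measurable]: "h \<in> borel_measurable borel"
    and B: "\<And>y. norm y \<le> 1 \<Longrightarrow> \<bar>h y\<bar> \<le> B" and N: "0 \<le> N" "ang_lip N h"
  obtains K where "0 \<le> K" "\<And>m. osc_le (K * ((9127/12500)\<^sup>2)^m) ((kac_op ^^ (2 * m)) h)"
proof -
  define q :: real where "q = (9127/12500)\<^sup>2"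
  have q: "337/640 < q" by (simp add: q_def power2_eq_square)
  define K where "K = max (2 * B) (9/2 * N / (q - 337/640))"
  have B0: "0 \<le> B" using B[of 0] by simp
  have K: "2 * B \<le> K" "337/640 * K + 9/2 * N \<le> K * q"
  proof -
    show "2 * B \<le> K" by (simp add: K_def)
    have "9/2 * N / (q - 337/640) \<le> K" by (simp add: K_def)
    moreover have "0 < q - 337/640" using q by simp
    ultimately have "9/2 * N \<le> K * (q - 337/640)" by (simp only: pos_divide_le_eq)
    then show "337/640 * K + 9/2 * N \<le> K * q" by argo
  qed
  have "osc_le (K * q^m) ((kac_op ^^ (2 * m)) h)" for m
  proof (induction m)
    case 0
    have "osc_le (2 * B) h"
      unfolding osc_le_def using B by (intro exI[of _ "- B"]) (auto simp: abs_le_iff minus_le_iff)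
    then show ?case using K by (auto intro: osc_le_mono)
  next
    case (Suc m)
    note it = kac_op_funpow[OF assms, where m = "2 * m"]
    have "osc_le (337/640 * (K * q^m) + 9/2 * (N * (9127/12500)^(2 * m))) (kac_op (kac_op ((kac_op ^^ (2 * m)) h)))"
      using it N Suc by (intro osc_le_kac_op_twice[of _ B]) auto
    moreover have "337/640 * (K * q^m) + 9/2 * (N * (9127/12500)^(2 * m)) = (337/640 * K + 9/2 * N) * q^m"
      unfolding q_def power_mult[symmetric] by (simp add: algebra_simps)
    moreover have "(337/640 * K + 9/2 * N) * q^m \<le> K * q * q^m"
      using K q by (intro mult_right_mono) auto
    ultimately show ?case by (auto intro: osc_le_mono simp: mult_ac)
  qed
  moreover have "0 \<le> K" using K B0 by linarith
  ultimately show thesis using that q_def by blast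
qed

text \<open>If \<open>a 1 / a 0\<close> exceeded \<open>d\<close>, log-convexity would keep every
  later ratio at least as large and force geometric growth faster than \<open>d^m\<close>. The
  growth assumption along even indices excludes this whatever the constant \<open>K\<close>
  is.\<close>

lemma log_convex_ratio_le:
  fixes a :: "nat \<Rightarrow> real"
  assumes nn: "\<And>m. 0 \<le> a m" and conv: "\<And>m. (a (Suc m))\<^sup>2 \<le> a m * a (Suc (Suc m))"
    and growth: "\<And>m. a (2 * m) \<le> K * d^(2 * m)" and d: "0 < d"
  shows "a 1 \<le> d * a 0"
proof (rule ccontr)
  assume "\<not> a 1 \<le> d * a 0"
  then have less: "d * a 0 < a 1" by simp
  have a0: "0 < a 0"
  proof (rule ccontr)
    assume "\<not> 0 < a 0"
    then have "a 0 = 0" using nn[of 0] by simp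
    with less conv[of 0] show False by simp
  qed
  define r where "r = a 1 / a 0"
  have r: "d < r" using less a0 by (simp add: r_def pos_less_divide_eq)
  have step: "0 < a m \<and> r * a m \<le> a (Suc m)" for m
  proof (induction m)
    case 0
    then show ?case using a0 by (simp add: r_def)
  next
    case (Suc m)
    have "0 < r * a m" using Suc r d by simp
    then have pos: "0 < a (Suc m)" using Suc by linarith
    have "(r * a m) * a (Suc m) \<le> (a (Suc m))\<^sup>2"
      using Suc pos unfolding power2_eq_square by (intro mult_right_mono) auto
    also have "\<dots> \<le> a m * a (Suc (Suc m))" by (rule conv)
    finally have "a m * (r * a (Suc m)) \<le> a m * a (Suc (Suc m))" by (simp add: mult_ac)
    then show ?case using Suc pos by simp
  qed
  have grow: "r^m * a 0 \<le> a m" for m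
  proof (induction m)
    case (Suc m)
    have "r ^ Suc m * a 0 = r * (r^m * a 0)" by simp
    also have "\<dots> \<le> r * a m" using Suc r d by (intro mult_left_mono) auto
    also have "\<dots> \<le> a (Suc m)" using step by blast
    finally show ?case .
  qed simp
  have "(r / d)^(2 * m) \<le> K / a 0" for m
  proof -
    have "r^(2 * m) * a 0 \<le> K * d^(2 * m)" using grow[of "2 * m"] growth[of m] by linarith
    then show ?thesis using a0 d by (simp add: power_divide field_simps)
  qed
  moreover have "1 < (r / d)\<^sup>2" using r d by (intro one_less_power) auto
  then obtain m where "K / a 0 < ((r / d)\<^sup>2)^m"
    using real_arch_pow by blast
  ultimately show False by (metis not_le power_mult)
qed

text \<open>Applied to \<open>a m\<close>, the squared norm of the \<open>m\<close>-th iterate: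
  self-adjointness and Cauchy-Schwarz give log-convexity, the decay of oscillations gives growth
  with \<open>d = c^2\<close>. The resulting \<open>a 1 \<le> c^2 * a 0\<close> becomes the bound on
  the quadratic form by another use of Cauchy-Schwarz. Of the law \<open>\<mu>\<close> only its
  support, the symmetry of resampling and the positive mass of \<open>wt\<close> enter.\<close>

lemma kac_op_spectral_bound:
  assumes "prob_space \<mu>" and sets [measurable_cong]: "sets \<mu> = sets borel"
    and ball: "AE x in \<mu>. norm x \<le> 1"
    and sym: "\<And>g h :: real^3 \<Rightarrow> real. g \<in> borel_measurable borel \<Longrightarrow> h \<in> borel_measurable borel \<Longrightarrow>
      bounded (g ` cball 0 1) \<Longrightarrow> bounded (h ` cball 0 1) \<Longrightarrow>
      (\<integral>x. wt x * g x * cond_mean (\<lambda>y. wt y * h y) x \<partial>\<mu>) =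
      (\<integral>x. wt x * h x * cond_mean (\<lambda>y. wt y * g y) x \<partial>\<mu>)"
    and h [measurable]: "h \<in> borel_measurable borel"
    and B: "\<And>y. norm y \<le> 1 \<Longrightarrow> \<bar>h y\<bar> \<le> B" and N: "0 \<le> N" "ang_lip N h"
    and mean0: "(\<integral>x. wt x * h x \<partial>\<mu>) = 0" and wt_pos: "0 < (\<integral>x. wt x \<partial>\<mu>)"
  shows "(\<integral>x. wt x * h x * kac_op h x \<partial>\<mu>) \<le> 9127/12500 * (\<integral>x. wt x * (h x)\<^sup>2 \<partial>\<mu>)"
proof -
  interpret prob_space \<mu> by fact
  define c :: real where "c = 9127/12500"
  define ip where "ip g h = (\<integral>x. wt x * g x * h x \<partial>\<mu>)" for g h
  have int: "integrable \<mu> (\<lambda>x. wt x * g x * h x)"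
    if [measurable]: "g \<in> borel_measurable borel" "h \<in> borel_measurable borel"
      and b: "\<And>y. norm y \<le> 1 \<Longrightarrow> \<bar>g y\<bar> \<le> C" "\<And>y. norm y \<le> 1 \<Longrightarrow> \<bar>h y\<bar> \<le> D" for g h C D
  proof (rule integrable_const_bound)
    show "AE x in \<mu>. norm (wt x * g x * h x) \<le> 1 * C * D"
      using ball
    proof eventually_elim
      case (elim x)
      then show ?case
        unfolding real_norm_def abs_mult using b[of x] wt_bounds(1)[OF elim] wt_bounds(2)[of x]
        by (intro mult_mono) auto
    qed
  qed measurable
  have sa: "ip g (kac_op h) = ip h (kac_op g)"
    if [measurable]: "g \<in> borel_measurable borel" "h \<in> borel_measurable borel"
      and b: "\<And>y. norm y \<le> 1 \<Longrightarrow> \<bar>g y\<bar> \<le> C" "\<And>y. norm y \<le> 1 \<Longrightarrow> \<bar>h y\<bar> \<le> D" for g h C D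
  proof -
    have exp: "ip g (kac_op h) = (\<integral>x. 1/2 * (wt x * (wt x * g x) * h x) \<partial>\<mu>) +
        (\<integral>x. wt x * g x * cond_mean (\<lambda>y. wt y * h y) x \<partial>\<mu>)"
      if [measurable]: "g \<in> borel_measurable borel" "h \<in> borel_measurable borel"
        and b: "\<And>y. norm y \<le> 1 \<Longrightarrow> \<bar>g y\<bar> \<le> C" "\<And>y. norm y \<le> 1 \<Longrightarrow> \<bar>h y\<bar> \<le> D" for g h C D
    proof -
      have D: "\<bar>cond_mean (\<lambda>y. wt y * h y) x\<bar> \<le> D" if x: "norm x \<le> 1" for x
      proof -
        have "\<bar>wt y * h y\<bar> \<le> D" if "norm y \<le> 1" for y by (intro abs_wt_mult_le b that)
        then have "AE w in sphere2. \<bar>(\<lambda>y. wt y * h y) (resample x w)\<bar> \<le> D"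
          using AE_norm_resample[OF x] by (auto elim!: eventually_mono)
        then have "(\<integral>w. \<bar>(\<lambda>y. wt y * h y) (resample x w)\<bar> \<partial>sphere2) \<le> D"
          by (intro sphere2.integral_le_const sphere2.integrable_const_bound[of _ D]) auto
        then show ?thesis unfolding cond_mean_def by (intro order_trans[OF integral_abs_bound]) simp
      qed
      have "integrable \<mu> (\<lambda>x. wt x * (wt x * g x) * h x)"
        using b by (intro int[of _ _ C D]) (auto intro: abs_wt_mult_le)
      moreover have "integrable \<mu> (\<lambda>x. wt x * g x * cond_mean (\<lambda>y. wt y * h y) x)"
        using b D by (intro int[of _ _ C D]) auto
      ultimately show ?thesis
        unfolding ip_def kac_op_def
        by (subst Bochner_Integration.integral_add[symmetric]) (auto simp: algebra_simps)
    qed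
    have bd: "bounded (g ` cball 0 1)" "bounded (h ` cball 0 1)"
      using b by (auto simp: bounded_iff intro: exI[of _ C] exI[of _ D])
    show ?thesis
      using exp[of g h C D] exp[of h g D C] b sym[of g h] bd by (simp add: mult_ac)
  qed
  define H where "H m = (kac_op ^^ m) h" for m
  have [measurable]: "H m \<in> borel_measurable borel" and HB: "\<And>y. norm y \<le> 1 \<Longrightarrow> \<bar>H m y\<bar> \<le> B" for m
    unfolding H_def using kac_op_funpow[OF h B N] by auto
  have HS: "kac_op (H m) = H (Suc m)" for m by (simp add: H_def)
  have H0: "H 0 = h" by (simp add: H_def)
  have mean: "ip (\<lambda>_. 1) (H m) = 0" for m
  proof (induction m)
    case 0
    then show ?case using mean0 by (simp add: ip_def H0)
  next
    case (Suc m)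
    have "ip (\<lambda>_. 1) (kac_op (H m)) = ip (H m) (kac_op (\<lambda>_. 1))"
      by (rule sa[of _ _ 1 B]) (use HB in auto)
    also have "\<dots> = (\<integral>x. 3/4 * (wt x * H m x) \<partial>\<mu>)"
      unfolding ip_def by (rule integral_cong_AE) (use ball kac_op_const[of _ 1] in \<open>auto elim!: eventually_mono\<close>)
    also have "\<dots> = 0" using Suc by (simp add: ip_def)
    finally show ?case by (simp add: HS)
  qed
  define a where "a m = ip (H m) (H m)" for m
  have intH: "integrable \<mu> (\<lambda>x. wt x * H i x * H j x)" for i j
    by (rule int) (use HB in auto)
  have cs: "(ip (H i) (H j))\<^sup>2 \<le> a i * a j" for i j
  proof -
    have quad: "0 \<le> a i + 2 * t * ip (H i) (H j) + t\<^sup>2 * a j" for t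
    proof -
      have "0 \<le> (\<integral>x. wt x * (H i x + t * H j x)\<^sup>2 \<partial>\<mu>)"
        by (rule integral_nonneg_AE) (use ball wt_bounds(1) in \<open>auto elim!: eventually_mono\<close>)
      also have "(\<lambda>x. wt x * (H i x + t * H j x)\<^sup>2) =
          (\<lambda>x. wt x * H i x * H i x + 2 * t * (wt x * H i x * H j x) + t\<^sup>2 * (wt x * H j x * H j x))"
        by (auto simp: power2_eq_square algebra_simps)
      finally show ?thesis
        using intH by (simp add: a_def ip_def)
    qed
    have aj: "0 \<le> a j"
      unfolding a_def ip_def
      by (rule integral_nonneg_AE) (use ball wt_bounds(1) in \<open>auto elim!: eventually_mono simp: mult.assoc\<close>)
    show ?thesis
    proof (cases "a j = 0")
      case True
      have "ip (H i) (H j) = 0"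
      proof (rule ccontr)
        assume "ip (H i) (H j) \<noteq> 0"
        \<comment> \<open>For \<open>a j = 0\<close> the quadratic is affine in \<open>t\<close>;
          this choice of \<open>t\<close> makes it equal to \<open>-1\<close>.\<close>
        then show False using quad[of "- (a i + 1) / (2 * ip (H i) (H j))"] True by (simp add: field_simps)
      qed
      then show ?thesis using True by simp
    next
      case False
      then have "0 < a j" using aj by simp
      have "0 \<le> a j * (a i + 2 * (- ip (H i) (H j) / a j) * ip (H i) (H j) + (- ip (H i) (H j) / a j)\<^sup>2 * a j)"
        using quad[of "- ip (H i) (H j) / a j"] \<open>0 < a j\<close> by (intro mult_nonneg_nonneg) auto
      also have "\<dots> = a i * a j - (ip (H i) (H j))\<^sup>2"
        using \<open>0 < a j\<close> by (simp add: power2_eq_square field_simps)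
      finally show ?thesis by simp
    qed
  qed
  have a_nn: "0 \<le> a m" for m
    unfolding a_def ip_def
    by (rule integral_nonneg_AE) (use ball wt_bounds(1) in \<open>auto elim!: eventually_mono simp: mult.assoc\<close>)
  have conv: "(a (Suc m))\<^sup>2 \<le> a m * a (Suc (Suc m))" for m
  proof -
    have "a (Suc m) = ip (H (Suc m)) (kac_op (H m))" by (simp add: a_def HS)
    also have "\<dots> = ip (H m) (kac_op (H (Suc m)))"
      by (rule sa[of _ _ B B]) (use HB in auto)
    finally have "a (Suc m) = ip (H m) (H (Suc (Suc m)))" by (simp add: HS)
    then show ?thesis using cs[of m "Suc (Suc m)"] by simp
  qed
  obtain K where K: "0 \<le> K" "\<And>m. osc_le (K * ((9127/12500)\<^sup>2)^m) ((kac_op ^^ (2 * m)) h)"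
    using osc_le_funpow[OF h B N] by blast
  have growth: "a (2 * m) \<le> K\<^sup>2 * (c\<^sup>2)^(2 * m)" for m
  proof -
    define r where "r = K * (c\<^sup>2)^m"
    have r0: "0 \<le> r" using K by (simp add: r_def)
    obtain l where l: "\<And>x. norm x \<le> 1 \<Longrightarrow> l \<le> H (2 * m) x \<and> H (2 * m) x \<le> l + r"
      using K(2)[of m] by (auto simp: osc_le_def H_def r_def c_def)
    have intw: "integrable \<mu> (\<lambda>x. wt x)" "integrable \<mu> (\<lambda>x. wt x * H (2 * m) x)"
      using int[of "\<lambda>_. 1" "\<lambda>_. 1" 1 1] int[of "\<lambda>_. 1" "H (2 * m)" 1 B] HB by auto
    have m0: "(\<integral>x. wt x * H (2 * m) x \<partial>\<mu>) = 0" using mean[of "2 * m"] by (simp add: ip_def)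
    \<comment> \<open>Orthogonality to constants places \<open>0\<close> between \<open>l\<close>
      and \<open>l + r\<close>, which turns the bound on the oscillation into a bound on the
      supremum.\<close>
    have "(\<integral>x. l * wt x \<partial>\<mu>) \<le> (\<integral>x. wt x * H (2 * m) x \<partial>\<mu>)"
      by (rule integral_mono_AE)
        (use intw ball l wt_bounds(1) in \<open>auto elim!: eventually_mono simp: mult.commute[of l] intro!: mult_left_mono\<close>)
    then have l1: "l \<le> 0" using wt_pos m0 by (simp add: mult_le_0_iff)
    have "(\<integral>x. wt x * H (2 * m) x \<partial>\<mu>) \<le> (\<integral>x. (l + r) * wt x \<partial>\<mu>)"
      by (rule integral_mono_AE)
        (use intw ball l wt_bounds(1) in \<open>auto elim!: eventually_mono simp: mult.commute[of "l + r"] intro!: mult_left_mono\<close>)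
    then have l2: "0 \<le> l + r" using wt_pos m0 by (simp add: zero_le_mult_iff)
    have "a (2 * m) \<le> (\<integral>x. r\<^sup>2 \<partial>\<mu>)"
      unfolding a_def ip_def
    proof (rule integral_mono_AE)
      show "AE x in \<mu>. wt x * H (2 * m) x * H (2 * m) x \<le> r\<^sup>2"
        using ball
      proof eventually_elim
        case (elim x)
        have "\<bar>H (2 * m) x\<bar> \<le> r" using l[OF elim] l1 l2 by (simp add: abs_le_iff)
        then have "(H (2 * m) x)\<^sup>2 \<le> r\<^sup>2" using r0 by (simp add: abs_le_square_iff[symmetric])
        then have "wt x * (H (2 * m) x)\<^sup>2 \<le> 1 * r\<^sup>2"
          using wt_bounds(1)[OF elim] wt_bounds(2)[of x] by (intro mult_mono) auto
        then show ?case by (simp add: power2_eq_square mult.assoc)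
      qed
    qed (use intH in auto)
    also have "\<dots> = r\<^sup>2" using prob_space by simp
    also have "\<dots> = K\<^sup>2 * (c\<^sup>2)^(2 * m)"
      by (simp add: r_def power_mult_distrib power_mult[symmetric] mult.commute)
    finally show ?thesis .
  qed
  have "a 1 \<le> c\<^sup>2 * a 0"
    by (rule log_convex_ratio_le[OF a_nn conv growth]) (simp add: c_def)
  then have "a 0 * a 1 \<le> a 0 * (c\<^sup>2 * a 0)" using a_nn by (intro mult_left_mono) auto
  then have "(ip (H 0) (H 1))\<^sup>2 \<le> (c * a 0)\<^sup>2"
    using cs[of 0 1] by (simp add: power2_eq_square mult_ac)
  then have "ip (H 0) (H 1) \<le> c * a 0"
    using a_nn[of 0] by (intro power2_le_imp_le[of "ip (H 0) (H 1)"]) (simp_all add: c_def)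
  then show ?thesis
    using HS[of 0] by (simp add: ip_def H0 a_def c_def power2_eq_square mult.assoc)
qed

section \<open>Density of Lipschitz functions\<close>

text \<open>The closure of the bounded Lipschitz functions in the square-integral distance, phrased
  for representatives. Lipschitz functions are the target because they satisfy
  \<open>ang_lip\<close> automatically.\<close>

definition lipschitz_L2_limit :: "'a::euclidean_space measure \<Rightarrow> ('a \<Rightarrow> real) \<Rightarrow> bool" where
  "lipschitz_L2_limit M f \<longleftrightarrow> (\<forall>\<epsilon>>0. \<exists>h B L. (\<forall>x. \<bar>h x\<bar> \<le> B) \<and> L-lipschitz_on UNIV h \<and>
     integrable M (\<lambda>x. (f x - h x)\<^sup>2) \<and> (\<integral>x. (f x - h x)\<^sup>2 \<partial>M) < \<epsilon>)"

lemma lipschitz_on_borel_measurable: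
  "L-lipschitz_on UNIV (h :: 'a::euclidean_space \<Rightarrow> real) \<Longrightarrow> h \<in> borel_measurable borel"
  by (intro borel_measurable_continuous_onI lipschitz_on_continuous_on)

lemma lipschitz_L2_limit_trans:
  fixes f :: "'a::euclidean_space \<Rightarrow> real"
  assumes sets [measurable_cong]: "sets M = sets borel" and f [measurable]: "f \<in> borel_measurable borel"
    and approx: "\<And>\<epsilon>. 0 < \<epsilon> \<Longrightarrow> \<exists>g\<in>borel_measurable borel. lipschitz_L2_limit M g \<and>
      integrable M (\<lambda>x. (f x - g x)\<^sup>2) \<and> (\<integral>x. (f x - g x)\<^sup>2 \<partial>M) < \<epsilon>"
  shows "lipschitz_L2_limit M f"
  unfolding lipschitz_L2_limit_def
proof (intro allI impI)
  fix \<epsilon> :: real assume e: "0 < \<epsilon>"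
  from approx[of "\<epsilon> / 4"] e obtain g where [measurable]: "g \<in> borel_measurable borel"
    and g: "lipschitz_L2_limit M g" "integrable M (\<lambda>x. (f x - g x)\<^sup>2)" "(\<integral>x. (f x - g x)\<^sup>2 \<partial>M) < \<epsilon> / 4"
    by auto
  have e4: "0 < \<epsilon> / 4" using e by simp
  obtain h B L where h: "\<forall>x. \<bar>h x\<bar> \<le> B" "L-lipschitz_on UNIV h"
    "integrable M (\<lambda>x. (g x - h x)\<^sup>2)" "(\<integral>x. (g x - h x)\<^sup>2 \<partial>M) < \<epsilon> / 4"
    using g(1) e4 unfolding lipschitz_L2_limit_def by blast
  have [measurable]: "h \<in> borel_measurable borel" using h(2) by (rule lipschitz_on_borel_measurable)
  have le: "(f x - h x)\<^sup>2 \<le> 2 * (f x - g x)\<^sup>2 + 2 * (g x - h x)\<^sup>2" for x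
    using zero_le_power2[of "(f x - g x) - (g x - h x)"] by (simp add: power2_eq_square algebra_simps)
  have int: "integrable M (\<lambda>x. 2 * (f x - g x)\<^sup>2 + 2 * (g x - h x)\<^sup>2)"
    using g h by simp
  have int2: "integrable M (\<lambda>x. (f x - h x)\<^sup>2)"
    by (rule Bochner_Integration.integrable_bound[OF int]) (use le in auto)
  have "(\<integral>x. (f x - h x)\<^sup>2 \<partial>M) \<le> (\<integral>x. 2 * (f x - g x)\<^sup>2 + 2 * (g x - h x)\<^sup>2 \<partial>M)"
    by (rule integral_mono[OF int2 int le])
  also have "\<dots> < \<epsilon>" using g h by simp
  finally show "\<exists>h B L. (\<forall>x. \<bar>h x\<bar> \<le> B) \<and> L-lipschitz_on UNIV h \<and>
     integrable M (\<lambda>x. (f x - h x)\<^sup>2) \<and> (\<integral>x. (f x - h x)\<^sup>2 \<partial>M) < \<epsilon>"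
    using h int2 by blast
qed

text \<open>Regularity of the measure gives a compact \<open>K\<close> inside \<open>A\<close> and
  an open \<open>U\<close> around it with \<open>U - K\<close> of measure below
  \<open>\<epsilon>\<close>. A cut-off of the distance to \<open>K\<close> that is \<open>1\<close>
  on \<open>K\<close> and \<open>0\<close> off \<open>U\<close> differs from the indicator on
  \<open>U - K\<close> alone, and there by at most \<open>1\<close>.\<close>

lemma lipschitz_L2_limit_indicator:
  fixes A :: "'a::euclidean_space set"
  assumes "finite_measure M" and sets [measurable_cong]: "sets M = sets borel"
    and A [measurable]: "A \<in> sets borel"
  shows "lipschitz_L2_limit M (indicator A)"
  unfolding lipschitz_L2_limit_def
proof (intro allI impI)
  interpret finite_measure M by fact
  fix \<epsilon> :: real assume e: "0 < \<epsilon>"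
  have fin: "emeasure M (space M) \<noteq> \<infinity>" by simp
  have "\<exists>K. K \<subseteq> A \<and> compact K \<and> measure M A < measure M K + \<epsilon> / 2"
  proof (cases "measure M A = 0")
    case True
    then show ?thesis using e by (intro exI[of _ "{}"]) simp
  next
    case False
    then have "0 < measure M A" by (simp add: zero_less_measure_iff)
    then have "ennreal (measure M A - \<epsilon> / 2) < emeasure M A"
      unfolding emeasure_eq_measure using e by (intro ennreal_lessI) auto
    then have "ennreal (measure M A - \<epsilon> / 2) < (SUP K \<in> {K. K \<subseteq> A \<and> compact K}. emeasure M K)"
      by (simp only: inner_regular[OF sets fin A])
    then obtain K where K: "K \<subseteq> A" "compact K" "ennreal (measure M A - \<epsilon> / 2) < emeasure M K"
      unfolding less_SUP_iff by auto
    have "measure M A - \<epsilon> / 2 < measure M K"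
    proof (cases "0 \<le> measure M A - \<epsilon> / 2")
      case True
      then show ?thesis using K(3) by (simp add: emeasure_eq_measure ennreal_less_iff)
    next
      case False
      then show ?thesis using measure_nonneg[of M K] by linarith
    qed
    then show ?thesis using K by (intro exI[of _ K]) auto
  qed
  then obtain K where K: "K \<subseteq> A" "compact K" "measure M A < measure M K + \<epsilon> / 2" by auto
  have "emeasure M A < ennreal (measure M A + \<epsilon> / 2)"
    unfolding emeasure_eq_measure using e by (intro ennreal_lessI) (auto intro: add_nonneg_pos)
  then have "(INF U \<in> {U. A \<subseteq> U \<and> open U}. emeasure M U) < ennreal (measure M A + \<epsilon> / 2)"
    by (simp only: outer_regular[OF sets fin A])
  then obtain U where U: "A \<subseteq> U" "open U" "emeasure M U < ennreal (measure M A + \<epsilon> / 2)"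
    unfolding INF_less_iff by auto
  then have U3: "measure M U < measure M A + \<epsilon> / 2"
    unfolding emeasure_eq_measure by (simp add: ennreal_less_iff)
  have [measurable]: "K \<in> sets borel" "U \<in> sets borel"
    using K U by (auto intro: borel_compact)
  have diff: "measure M (U - K) < \<epsilon>"
    using K U U3 by (subst finite_measure_Diff) (auto simp: sets)
  obtain h B L where hBL: "\<And>x. \<bar>h x\<bar> \<le> B" "L-lipschitz_on UNIV h"
    and h: "\<And>x. 0 \<le> h x \<and> h x \<le> 1" "\<And>x. x \<in> K \<Longrightarrow> h x = 1" "\<And>x. x \<notin> U \<Longrightarrow> h x = (0 :: real)"
  proof (cases "K = {}")
    case True
    show thesis by (rule that[of "\<lambda>_. 0" 0 0]) (use True in \<open>auto intro: lipschitz_intros\<close>)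
  next
    case False
    then obtain d where d: "0 < d" "{x. infdist x K \<le> d} \<subseteq> U"
      using compact_in_open_separated[OF False K(2) U(2)] K U by auto
    show thesis
    proof (rule that[of "\<lambda>x. max 0 (1 - infdist x K / d)" 1 "1 / d"])
      show "(1 / d)-lipschitz_on UNIV (\<lambda>x. max 0 (1 - infdist x K / d))"
      proof (rule lipschitz_onI)
        fix x y :: 'a
        have "\<bar>infdist x K / d - infdist y K / d\<bar> \<le> dist x y / d"
          using d infdist_triangle_abs[of x K y]
          by (simp add: diff_divide_distrib[symmetric] abs_divide divide_right_mono)
        then show "dist (max 0 (1 - infdist x K / d)) (max 0 (1 - infdist y K / d)) \<le> 1 / d * dist x y"
          unfolding dist_real_def by (simp add: max_def abs_le_iff)
      qed (use d in simp)
      show "max 0 (1 - infdist x K / d) = 0" if "x \<notin> U" for x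
      proof -
        have "d < infdist x K" using d(2) that by (metis mem_Collect_eq not_le subsetD)
        then show ?thesis using d by (simp add: field_simps)
      qed
    qed (use d in \<open>auto simp: infdist_nonneg\<close>)
  qed
  have [measurable]: "h \<in> borel_measurable borel" using hBL(2) by (rule lipschitz_on_borel_measurable)
  have le: "(indicator A x - h x)\<^sup>2 \<le> indicator (U - K) x" for x
  proof (cases "x \<in> U - K")
    case True
    have "\<bar>indicator A x - h x\<bar> \<le> 1" using h(1)[of x] by (auto simp: indicator_def)
    then show ?thesis using True abs_le_square_iff[of "indicator A x - h x" 1] by simp
  next
    case False
    then show ?thesis using h(2,3)[of x] K(1) U(1) by (auto simp: indicator_def)
  qed
  have int: "integrable M (\<lambda>x. (indicator A x - h x)\<^sup>2)"
    by (rule Bochner_Integration.integrable_bound[of _ "indicator (U - K) :: 'a \<Rightarrow> real"])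
      (use le in \<open>auto simp: integrable_indicator_iff less_top[symmetric]\<close>)
  have "(\<integral>x. (indicator A x - h x)\<^sup>2 \<partial>M) \<le> (\<integral>x. indicator (U - K) x \<partial>M)"
    by (rule integral_mono[OF int _ le]) (auto simp: less_top[symmetric])
  also have "\<dots> < \<epsilon>" using diff by simp
  finally show "\<exists>h B L. (\<forall>x. \<bar>h x\<bar> \<le> B) \<and> L-lipschitz_on UNIV h \<and>
     integrable M (\<lambda>x. (indicator A x - h x)\<^sup>2) \<and> (\<integral>x. (indicator A x - h x)\<^sup>2 \<partial>M) < \<epsilon>"
    using hBL int by blast
qed

lemma lipschitz_L2_limit_add_scale:
  fixes f g :: "'a::euclidean_space \<Rightarrow> real"
  assumes sets [measurable_cong]: "sets M = sets borel"
    and [measurable]: "f \<in> borel_measurable borel" "g \<in> borel_measurable borel"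
    and f: "lipschitz_L2_limit M f" and g: "lipschitz_L2_limit M g"
  shows "lipschitz_L2_limit M (\<lambda>x. c * f x + g x)"
  unfolding lipschitz_L2_limit_def
proof (intro allI impI)
  fix \<epsilon> :: real assume e: "0 < \<epsilon>"
  define \<delta> where "\<delta> = \<epsilon> / (4 * (c\<^sup>2 + 1))"
  have e4: "0 < \<epsilon> / 4" using e by simp
  have cc: "0 < c\<^sup>2 + 1" by (simp add: add_nonneg_pos)
  have d: "0 < \<delta>" using e cc by (simp add: \<delta>_def)
  obtain h B L where h: "\<forall>x. \<bar>h x\<bar> \<le> B" "L-lipschitz_on UNIV h"
    "integrable M (\<lambda>x. (f x - h x)\<^sup>2)" "(\<integral>x. (f x - h x)\<^sup>2 \<partial>M) < \<delta>"
    using f d unfolding lipschitz_L2_limit_def by blast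
  obtain k D E where k: "\<forall>x. \<bar>k x\<bar> \<le> D" "E-lipschitz_on UNIV k"
    "integrable M (\<lambda>x. (g x - k x)\<^sup>2)" "(\<integral>x. (g x - k x)\<^sup>2 \<partial>M) < \<epsilon> / 4"
    using g e4 unfolding lipschitz_L2_limit_def by blast
  have [measurable]: "h \<in> borel_measurable borel" "k \<in> borel_measurable borel"
    using h(2) k(2) by (auto intro: lipschitz_on_borel_measurable)
  have le: "(c * f x + g x - (c * h x + k x))\<^sup>2 \<le> 2 * c\<^sup>2 * (f x - h x)\<^sup>2 + 2 * (g x - k x)\<^sup>2" for x
    using zero_le_power2[of "c * (f x - h x) - (g x - k x)"] by (simp add: power2_eq_square algebra_simps)
  have int: "integrable M (\<lambda>x. 2 * c\<^sup>2 * (f x - h x)\<^sup>2 + 2 * (g x - k x)\<^sup>2)"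
    using h k by simp
  have int2: "integrable M (\<lambda>x. (c * f x + g x - (c * h x + k x))\<^sup>2)"
    by (rule Bochner_Integration.integrable_bound[OF int]) (use le in auto)
  have "(\<integral>x. (c * f x + g x - (c * h x + k x))\<^sup>2 \<partial>M) \<le> (\<integral>x. 2 * c\<^sup>2 * (f x - h x)\<^sup>2 + 2 * (g x - k x)\<^sup>2 \<partial>M)"
    by (rule integral_mono[OF int2 int le])
  also have "\<dots> = 2 * c\<^sup>2 * (\<integral>x. (f x - h x)\<^sup>2 \<partial>M) + 2 * (\<integral>x. (g x - k x)\<^sup>2 \<partial>M)"
    using h k by simp
  also have "\<dots> < 2 * (c\<^sup>2 + 1) * \<delta> + 2 * (\<epsilon> / 4)"
  proof (rule add_le_less_mono)
    have "c\<^sup>2 * (\<integral>x. (f x - h x)\<^sup>2 \<partial>M) \<le> (c\<^sup>2 + 1) * \<delta>"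
      using h(4) by (intro mult_mono) auto
    then show "2 * c\<^sup>2 * (\<integral>x. (f x - h x)\<^sup>2 \<partial>M) \<le> 2 * (c\<^sup>2 + 1) * \<delta>"
      unfolding mult.assoc by (rule mult_left_mono) simp
  qed (use k in simp)
  also have "\<dots> = \<epsilon>" using cc by (simp add: \<delta>_def field_simps)
  finally have small: "(\<integral>x. (c * f x + g x - (c * h x + k x))\<^sup>2 \<partial>M) < \<epsilon>" .
  have bd: "\<bar>c * h x + k x\<bar> \<le> \<bar>c\<bar> * B + D" for x
  proof -
    have "\<bar>c * h x + k x\<bar> \<le> \<bar>c * h x\<bar> + \<bar>k x\<bar>" by (rule abs_triangle_ineq)
    also have "\<dots> \<le> \<bar>c\<bar> * B + D" using h(1) k(1) by (intro add_mono) (auto simp: abs_mult intro!: mult_left_mono)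
    finally show ?thesis .
  qed
  have "(\<bar>c\<bar> * L + E)-lipschitz_on UNIV (\<lambda>x. c * h x + k x)"
    using h(2) k(2) by (intro lipschitz_on_add lipschitz_on_cmult_real) auto
  then show "\<exists>h B L. (\<forall>x. \<bar>h x\<bar> \<le> B) \<and> L-lipschitz_on UNIV h \<and>
     integrable M (\<lambda>x. (c * f x + g x - h x)\<^sup>2) \<and> (\<integral>x. (c * f x + g x - h x)\<^sup>2 \<partial>M) < \<epsilon>"
    using bd int2 small
    by - (rule exI[of _ "\<lambda>x. c * h x + k x"], rule exI[of _ "\<bar>c\<bar> * B + D"], rule exI[of _ "\<bar>c\<bar> * L + E"], blast)
qed

text \<open>The approximating simple functions are bounded by \<open>2 * \<bar>f x\<bar>\<close>, so
  the squared error is dominated by \<open>9 * (f x)^2\<close> and dominated convergence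
  applies.\<close>

lemma lipschitz_L2_dense:
  fixes f :: "'a::euclidean_space \<Rightarrow> real"
  assumes "finite_measure M" and sets [measurable_cong]: "sets M = sets borel"
    and f [measurable]: "f \<in> borel_measurable borel" and f2: "integrable M (\<lambda>x. (f x)\<^sup>2)"
  shows "lipschitz_L2_limit M f"
proof (rule lipschitz_L2_limit_trans[OF sets f])
  interpret finite_measure M by fact
  have fM: "f \<in> borel_measurable M" by measurable
  obtain F where F: "\<And>i. simple_function M (F i)" "\<And>x. x \<in> space M \<Longrightarrow> (\<lambda>i. F i x) \<longlonglongrightarrow> f x"
    "\<And>i x. x \<in> space M \<Longrightarrow> dist (F i x) 0 \<le> 2 * dist (f x) 0"
    using borel_measurable_implies_sequence_metric[OF fM, of 0] by blast
  have sp: "space M = UNIV" using sets_eq_imp_space_eq[OF sets] by simp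
  have FM [measurable]: "F i \<in> borel_measurable borel" for i
    using borel_measurable_simple_function[OF F(1)] by (simp add: measurable_cong_sets[OF sets refl])
  have F_lim: "lipschitz_L2_limit M (F i)" for i
  proof -
    have fin: "finite (range (F i))" using simple_functionD(1)[OF F(1)] by (simp add: sp)
    have approx: "lipschitz_L2_limit M (\<lambda>x. \<Sum>y\<in>Y. y * indicator (F i -` {y}) x)" if "finite Y" for Y
      using that
    proof induction
      case empty
      show ?case
        unfolding lipschitz_L2_limit_def
        by (auto intro!: exI[of _ "\<lambda>_. 0"] exI[of _ 0] simp: lipschitz_intros)
    next
      case (insert y Y)
      have [measurable]: "F i -` {y} \<in> sets borel" for y
        using measurable_sets[OF FM[of i], of "{y}"] by simp
      have "lipschitz_L2_limit M (\<lambda>x. y * indicator (F i -` {y}) x + (\<Sum>y\<in>Y. y * indicator (F i -` {y}) x))"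
        by (intro lipschitz_L2_limit_add_scale sets lipschitz_L2_limit_indicator insert finite_measure_axioms) auto
      then show ?case by (simp only: sum.insert[OF insert(1,2)])
    qed
    have "(\<lambda>x. \<Sum>y\<in>range (F i). y * indicator (F i -` {y}) x) = F i"
    proof
      fix x
      have "(\<Sum>y\<in>range (F i). y * indicator (F i -` {y}) x) = (\<Sum>y\<in>{F i x}. y * indicator (F i -` {y}) x)"
        by (intro sum.mono_neutral_right fin) (auto simp: indicator_def)
      then show "(\<Sum>y\<in>range (F i). y * indicator (F i -` {y}) x) = F i x" by simp
    qed
    then show ?thesis using approx[OF fin] by simp
  qed
  have b: "(f x - F i x)\<^sup>2 \<le> 9 * (f x)\<^sup>2" for i x
  proof -
    have "\<bar>f x - F i x\<bar> \<le> \<bar>3 * f x\<bar>" using F(3)[of x i] by (simp add: sp dist_real_def)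
    then have "(f x - F i x)\<^sup>2 \<le> (3 * f x)\<^sup>2" by (simp only: abs_le_square_iff)
    then show ?thesis by (simp add: power_mult_distrib)
  qed
  have int9: "integrable M (\<lambda>x. 9 * (f x)\<^sup>2)" using f2 by simp
  have int: "integrable M (\<lambda>x. (f x - F i x)\<^sup>2)" for i
    by (rule Bochner_Integration.integrable_bound[OF int9]) (use b in auto)
  have lim: "(\<lambda>i. \<integral>x. (f x - F i x)\<^sup>2 \<partial>M) \<longlonglongrightarrow> (\<integral>x. 0 \<partial>M)"
  proof (rule integral_dominated_convergence[OF _ _ int9])
    show "AE x in M. (\<lambda>i. (f x - F i x)\<^sup>2) \<longlonglongrightarrow> 0"
    proof (rule AE_I2)
      fix x
      have "(\<lambda>i. (f x - F i x)\<^sup>2) \<longlonglongrightarrow> (f x - f x)\<^sup>2"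
        using F(2)[of x] by (intro tendsto_intros) (simp add: sp)
      then show "(\<lambda>i. (f x - F i x)\<^sup>2) \<longlonglongrightarrow> 0" by simp
    qed
  qed (use b in auto)
  fix \<epsilon> :: real assume "0 < \<epsilon>"
  with lim have "eventually (\<lambda>i. (\<integral>x. (f x - F i x)\<^sup>2 \<partial>M) < \<epsilon>) sequentially"
    by (intro order_tendstoD) auto
  then obtain i where "(\<integral>x. (f x - F i x)\<^sup>2 \<partial>M) < \<epsilon>" by (auto simp: eventually_sequentially)
  then show "\<exists>g\<in>borel_measurable borel. lipschitz_L2_limit M g \<and>
      integrable M (\<lambda>x. (f x - g x)\<^sup>2) \<and> (\<integral>x. (f x - g x)\<^sup>2 \<partial>M) < \<epsilon>"
    using F_lim int FM by blast
qed

section \<open>Joint law of two velocities\<close>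

lemma emeasure_cone_scale:
  fixes S :: "(real^3) set"
  assumes [measurable]: "S \<in> sets borel" and r: "0 < r"
  shows "emeasure lborel {a. norm a < r \<and> sgn a \<in> S} = ennreal (r^3) * emeasure lborel {a. norm a < 1 \<and> sgn a \<in> S}"
proof -
  have vim: "{x. norm (r *\<^sub>R x) < r \<and> sgn (r *\<^sub>R x) \<in> S} = {a. norm a < 1 \<and> sgn a \<in> S}"
    using r by (simp add: sgn_scaleR)
  have "emeasure lborel {a. norm a < r \<and> sgn a \<in> S} =
      emeasure (density (distr lborel borel (\<lambda>x. 0 + r *\<^sub>R x)) (\<lambda>_. ennreal (\<bar>r\<bar> ^ DIM(real^3)))) {a. norm a < r \<and> sgn a \<in> S}"
    using r by (subst lborel_affine[of r 0]) auto
  also have "\<dots> = ennreal (r^3) * emeasure (distr lborel borel (\<lambda>x. r *\<^sub>R x)) {a. norm a < r \<and> sgn a \<in> S}"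
    using r by (subst emeasure_density) (simp_all add: nn_integral_cmult_indicator)
  also have "emeasure (distr lborel borel (\<lambda>x. r *\<^sub>R x)) {a. norm a < r \<and> sgn a \<in> S} =
      emeasure lborel {a. norm a < 1 \<and> sgn a \<in> S}"
    by (subst emeasure_distr) (simp_all add: vimage_def vim del: norm_scaleR)
  finally show ?thesis .
qed

text \<open>Radius and direction are independent under the uniform law of the ball because cones
  scale by \<open>r^3\<close>. The sign in \<open>- norm a\<close> is chosen for the comparison on
  half-lines \<open>{x<..}\<close>: their preimages are then balls.\<close>

lemma polar_product:
  defines "B \<equiv> uniform_measure lborel (ball 0 1 :: (real^3) set)"
  shows "distr B (borel \<Otimes>\<^sub>M borel) (\<lambda>a. (- norm a, sgn a)) = distr B borel (\<lambda>a. - norm a) \<Otimes>\<^sub>M sphere2"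
proof (rule pair_measure_eqI[symmetric])
  interpret B: prob_space B unfolding B_def by (rule prob_space_unif_ball)
  have sB [measurable_cong]: "sets B = sets borel" by (simp add: B_def)
  interpret N: prob_space "distr B borel (\<lambda>a. - norm a)" by (rule B.prob_space_distr) simp
  show "sigma_finite_measure (distr B borel (\<lambda>a. - norm a))" "sigma_finite_measure sphere2"
    by unfold_locales
  show "sets (distr B borel (\<lambda>a. - norm a) \<Otimes>\<^sub>M sphere2) = sets (distr B (borel \<Otimes>\<^sub>M borel) (\<lambda>a. (- norm a, sgn a)))"
    by (simp cong: sets_pair_measure_cong)
  fix A :: "real set" and S :: "(real^3) set"
  assume "A \<in> sets (distr B borel (\<lambda>a. - norm a))" and "S \<in> sets sphere2"
  then have [measurable]: "A \<in> sets borel" "S \<in> sets borel" by simp_all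
  define V where "V = emeasure lborel (ball 0 1 :: (real^3) set)"
  have eB: "emeasure B X = emeasure lborel (ball 0 1 \<inter> X) / V" if "X \<in> sets borel" for X
    using that unfolding B_def V_def by (subst emeasure_uniform_measure) auto
  have US: "emeasure sphere2 S = emeasure B {a. sgn a \<in> S}"
    unfolding uniform_sphere_def B_def by (subst emeasure_distr) (simp_all add: vimage_def)
  define Q where "Q = {a :: real^3. sgn a \<in> S}"
  have [measurable]: "Q \<in> sets borel" unfolding Q_def by measurable
  have cone: "emeasure B {a \<in> Q. norm a < r} = ennreal (r^3) * emeasure B Q" if "0 < r" "r \<le> 1" for r
  proof -
    have "ball 0 1 \<inter> {a \<in> Q. norm a < r} = {a. norm a < r \<and> sgn a \<in> S}"
      "ball 0 1 \<inter> Q = {a. norm a < 1 \<and> sgn a \<in> S}"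
      using that by (auto simp: Q_def)
    then show ?thesis
      using emeasure_cone_scale[of S r] that by (simp add: eB ennreal_times_divide)
  qed
  have cone1: "emeasure B {a. norm a < r} = ennreal (r^3)" if "0 < r" "r \<le> 1" for r
  proof -
    have "ball 0 1 \<inter> {a :: real^3. norm a < r} = {a. norm a < r \<and> sgn a \<in> UNIV}" "ball 0 1 = {a :: real^3. norm a < 1 \<and> sgn a \<in> UNIV}"
      using that by auto
    then have "emeasure B {a. norm a < r} = ennreal (r^3) * (V / V)"
      using emeasure_cone_scale[of UNIV r] that by (simp add: eB V_def ennreal_times_divide)
    moreover have "V / V = 1"
      using B.emeasure_space_1 eB[of UNIV] sets_eq_imp_space_eq[OF sB] by (simp add: V_def)
    ultimately show ?thesis by simp
  qed
  have AE1: "AE a in B. norm a < 1"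
    unfolding B_def by (rule AE_uniform_measureI) auto
  \<comment> \<open>With the set \<open>S\<close> of directions fixed, both sides of the product
    formula are measures in the radial variable, so it is enough to compare them on
    half-lines.\<close>
  have "density (distr B borel (\<lambda>a. - norm a)) (\<lambda>_. emeasure B Q) =
      distr (density B (indicator Q)) borel (\<lambda>a. - norm a)"
  proof (rule measure_eqI_lessThan)
    fix x :: real
    have l: "emeasure (density (distr B borel (\<lambda>a. - norm a)) (\<lambda>_. emeasure B Q)) {x<..} =
        emeasure B Q * emeasure B {a. norm a < - x}"
    proof -
      have "{a :: real^3. x < - norm a} = {a. norm a < - x}" by auto
      then show ?thesis
        by (simp add: emeasure_density nn_integral_cmult_indicator emeasure_distr vimage_def sets_eq_imp_space_eq[OF sB])
    qed
    have r: "emeasure (distr (density B (indicator Q)) borel (\<lambda>a. - norm a)) {x<..} = emeasure B {a \<in> Q. norm a < - x}"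
    proof -
      have "{a :: real^3. x < - norm a} = {a. norm a < - x}" by auto
      then have "emeasure (distr (density B (indicator Q)) borel (\<lambda>a. - norm a)) {x<..} =
          (\<integral>\<^sup>+a. indicator Q a * indicator {a. norm a < - x} a \<partial>B)"
        by (simp add: emeasure_distr emeasure_density vimage_def sets_eq_imp_space_eq[OF sB])
      also have "\<dots> = (\<integral>\<^sup>+a. indicator {a \<in> Q. norm a < - x} a \<partial>B)"
        by (intro nn_integral_cong) (auto simp: indicator_def)
      finally show ?thesis by simp
    qed
    consider "0 \<le> x" | "x < 0" "-1 \<le> x" | "x < -1" by linarith
    then have "emeasure B {a \<in> Q. norm a < - x} = emeasure B Q * emeasure B {a. norm a < - x}"
    proof cases
      case 1
      then have "{a :: real^3. norm a < - x} = {}" "{a \<in> Q. norm a < - x} = {}"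
        by (auto intro: order_trans[of _ 0]) (smt (verit) norm_ge_zero)+
      then show ?thesis by simp
    next
      case 2
      then show ?thesis using cone[of "-x"] cone1[of "-x"] by (simp add: mult.commute)
    next
      case 3
      have "emeasure B {a \<in> Q. norm a < - x} = emeasure B Q"
        by (rule emeasure_eq_AE) (use AE1 3 in \<open>auto elim!: eventually_mono\<close>)
      moreover have "emeasure B {a. norm a < - x} = emeasure B UNIV"
        by (rule emeasure_eq_AE) (use AE1 3 in \<open>auto elim!: eventually_mono\<close>)
      ultimately show ?thesis using B.emeasure_space_1 sets_eq_imp_space_eq[OF sB] by simp
    qed
    then show "emeasure (density (distr B borel (\<lambda>a. - norm a)) (\<lambda>_. emeasure B Q)) {x<..} =
        emeasure (distr (density B (indicator Q)) borel (\<lambda>a. - norm a)) {x<..}"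
      unfolding l r by simp
    show "emeasure (density (distr B borel (\<lambda>a. - norm a)) (\<lambda>_. emeasure B Q)) {x<..} < \<infinity>"
      unfolding l by (simp add: ennreal_mult_eq_top_iff less_top[symmetric])
  qed simp_all
  then have "emeasure (density (distr B borel (\<lambda>a. - norm a)) (\<lambda>_. emeasure B Q)) A =
      emeasure (distr (density B (indicator Q)) borel (\<lambda>a. - norm a)) A" by simp
  moreover have "emeasure (density (distr B borel (\<lambda>a. - norm a)) (\<lambda>_. emeasure B Q)) A =
      emeasure B Q * emeasure (distr B borel (\<lambda>a. - norm a)) A"
    by (simp add: emeasure_density nn_integral_cmult_indicator)
  moreover have "emeasure (distr (density B (indicator Q)) borel (\<lambda>a. - norm a)) A =
      emeasure (distr B (borel \<Otimes>\<^sub>M borel) (\<lambda>a. (- norm a, sgn a))) (A \<times> S)"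
  proof -
    have "emeasure (distr (density B (indicator Q)) borel (\<lambda>a. - norm a)) A =
        (\<integral>\<^sup>+a. indicator Q a * indicator {a. - norm a \<in> A} a \<partial>B)"
      by (simp add: emeasure_distr emeasure_density vimage_def sets_eq_imp_space_eq[OF sB])
    also have "\<dots> = (\<integral>\<^sup>+a. indicator {a. - norm a \<in> A \<and> sgn a \<in> S} a \<partial>B)"
      by (intro nn_integral_cong) (auto simp: indicator_def Q_def)
    also have "\<dots> = emeasure (distr B (borel \<Otimes>\<^sub>M borel) (\<lambda>a. (- norm a, sgn a))) (A \<times> S)"
      by (subst emeasure_distr) (simp_all add: vimage_def sets_eq_imp_space_eq[OF sB])
    finally show ?thesis .
  qed
  ultimately show "emeasure (distr B borel (\<lambda>a. - norm a)) A * emeasure sphere2 S =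
      emeasure (distr B (borel \<Otimes>\<^sub>M borel) (\<lambda>a. (- norm a, sgn a))) (A \<times> S)"
    unfolding US Q_def[symmetric] by (simp add: mult.commute)
qed

lemma nn_integral_polar:
  fixes G :: "real^3 \<Rightarrow> ennreal"
  assumes [measurable]: "G \<in> borel_measurable borel"
  shows "(\<integral>\<^sup>+a. G a * indicator (ball 0 1) (a :: real^3) \<partial>lborel) =
    (\<integral>\<^sup>+a. (\<integral>\<^sup>+w. G (norm a *\<^sub>R w) \<partial>sphere2) * indicator (ball 0 1) (a :: real^3) \<partial>lborel)"
proof -
  define B where "B = uniform_measure lborel (ball 0 1 :: (real^3) set)"
  interpret B: prob_space B unfolding B_def by (rule prob_space_unif_ball)
  have sB [measurable_cong]: "sets B = sets borel" by (simp add: B_def)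
  define V where "V = emeasure lborel (ball 0 1 :: (real^3) set)"
  have m2: "(\<lambda>a :: real^3. \<integral>\<^sup>+w. G (norm a *\<^sub>R w) \<partial>sphere2) \<in> borel_measurable borel" by measurable
  have V: "V \<noteq> 0" "V \<noteq> \<infinity>"
    using content_ball_pos[of 1 "0::real^3"] emeasure_lborel_ball_finite[of "0::real^3" 1]
    by (auto simp: V_def measure_def less_top)
  have polar: "norm a *\<^sub>R sgn a = a" for a :: "real^3" by (cases "a = 0") (simp_all add: sgn_div_norm)
  have "(\<integral>\<^sup>+a. G a \<partial>B) = (\<integral>\<^sup>+p. G ((- fst p) *\<^sub>R snd p) \<partial>distr B (borel \<Otimes>\<^sub>M borel) (\<lambda>a. (- norm a, sgn a)))"
    by (subst nn_integral_distr) (simp_all add: polar)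
  also have "\<dots> = (\<integral>\<^sup>+r. (\<integral>\<^sup>+w. G ((- r) *\<^sub>R w) \<partial>sphere2) \<partial>distr B borel (\<lambda>a. - norm a))"
    unfolding B_def polar_product unfolding B_def[symmetric]
    by (subst sphere2.nn_integral_fst[symmetric]) simp_all
  also have "\<dots> = (\<integral>\<^sup>+a. (\<integral>\<^sup>+w. G (norm a *\<^sub>R w) \<partial>sphere2) \<partial>B)"
    by (subst nn_integral_distr) simp_all
  finally have e: "(\<integral>\<^sup>+a. G a \<partial>B) = (\<integral>\<^sup>+a. (\<integral>\<^sup>+w. G (norm a *\<^sub>R w) \<partial>sphere2) \<partial>B)" .
  have BV: "(\<integral>\<^sup>+a. H a \<partial>B) = (\<integral>\<^sup>+a. H a * indicator (ball 0 1) (a :: real^3) \<partial>lborel) / V"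
    if "H \<in> borel_measurable borel" for H :: "real^3 \<Rightarrow> ennreal"
    unfolding B_def V_def using that by (intro nn_integral_uniform_measure) simp_all
  have "(\<integral>\<^sup>+a. G a * indicator (ball 0 1) (a :: real^3) \<partial>lborel) / V =
    (\<integral>\<^sup>+a. (\<integral>\<^sup>+w. G (norm a *\<^sub>R w) \<partial>sphere2) * indicator (ball 0 1) (a :: real^3) \<partial>lborel) / V"
    using e unfolding BV[OF assms] BV[OF m2] .
  then have "(\<integral>\<^sup>+a. G a * indicator (ball 0 1) (a :: real^3) \<partial>lborel) / V * V =
    (\<integral>\<^sup>+a. (\<integral>\<^sup>+w. G (norm a *\<^sub>R w) \<partial>sphere2) * indicator (ball 0 1) (a :: real^3) \<partial>lborel) / V * V" by simp
  moreover have "V / V = 1" using V by (intro ennreal_divide_self) (auto simp: less_top)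
  ultimately show ?thesis by (simp add: ennreal_divide_times)
qed

section \<open>Disintegration of the uniform measure on the five-sphere\<close>

abbreviation sphere5 :: "((real^3) \<times> (real^3)) measure" where
  "sphere5 \<equiv> uniform_sphere"

lemma nn_integral_sphere5:
  fixes F :: "(real^3) \<times> (real^3) \<Rightarrow> ennreal"
  assumes [measurable]: "F \<in> borel_measurable borel"
  shows "(\<integral>\<^sup>+z. F z \<partial>sphere5) = (\<integral>\<^sup>+b. (\<integral>\<^sup>+a. F (sgn (a, b)) * indicator (ball 0 1) (a, b) \<partial>lborel) \<partial>lborel)
    / emeasure lborel (ball 0 1 :: ((real^3) \<times> (real^3)) set)"
proof -
  have [measurable]: "ball (0 :: (real^3) \<times> (real^3)) 1 \<in> sets borel" by simp
  have m: "(\<lambda>z. F (sgn z) * indicator (ball 0 1) z) \<in> borel_measurable (lborel \<Otimes>\<^sub>M lborel)"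
    unfolding lborel_prod by measurable
  have "(\<integral>\<^sup>+z. F z \<partial>sphere5) = (\<integral>\<^sup>+z. F (sgn z) * indicator (ball 0 1) z \<partial>lborel)
    / emeasure lborel (ball 0 1 :: ((real^3) \<times> (real^3)) set)"
    unfolding uniform_sphere_def by (subst nn_integral_distr) (simp_all add: nn_integral_uniform_measure)
  also have "(\<integral>\<^sup>+z. F (sgn z) * indicator (ball 0 1) z \<partial>lborel) =
      (\<integral>\<^sup>+b. (\<integral>\<^sup>+a. F (sgn (a, b)) * indicator (ball 0 1) (a, b) \<partial>lborel) \<partial>lborel)"
    unfolding lborel_prod[symmetric] using lborel_pair.nn_integral_snd[OF m] by simp
  finally show ?thesis .
qed

text \<open>Given its second component, a uniform point of the five-sphere has a first component of
  uniform direction. In the ball this is the polar formula in \<open>a\<close> for fixed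
  \<open>b\<close>; it survives the radial projection since \<open>norm (a, b)\<close> depends on
  \<open>a\<close> through \<open>norm a\<close> alone.\<close>

lemma nn_integral_sphere5_disintegrate:
  fixes F :: "(real^3) \<times> (real^3) \<Rightarrow> ennreal"
  assumes F [measurable]: "F \<in> borel_measurable borel"
  shows "(\<integral>\<^sup>+z. F z \<partial>sphere5) = (\<integral>\<^sup>+z. (\<integral>\<^sup>+w. F (norm (fst z) *\<^sub>R w, snd z) \<partial>sphere2) \<partial>sphere5)"
proof -
  have [measurable]: "ball (0 :: (real^3) \<times> (real^3)) 1 \<in> sets borel" by simp
  define F' :: "(real^3) \<times> (real^3) \<Rightarrow> ennreal" where "F' z = (\<integral>\<^sup>+w. F (norm (fst z) *\<^sub>R w, snd z) \<partial>sphere2)" for z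
  have [measurable]: "F \<in> borel_measurable (borel \<Otimes>\<^sub>M borel)" using F by (simp add: borel_prod)
  have F'm: "F' \<in> borel_measurable (borel \<Otimes>\<^sub>M borel)" unfolding F'_def by measurable
  note F'm' [measurable] = F'm[unfolded borel_prod]
  have "(\<integral>\<^sup>+a. F (sgn (a, b)) * indicator (ball 0 1) (a, b) \<partial>lborel) =
      (\<integral>\<^sup>+a. F' (sgn (a, b)) * indicator (ball 0 1) (a, b) \<partial>lborel)" for b
  proof -
    define G where "G a = F (sgn (a, b)) * indicator (ball 0 1) (a, b)" for a
    have pm: "(\<lambda>a. (a, b)) \<in> borel_measurable borel"
      by (intro borel_measurable_continuous_onI continuous_intros)
    have "(\<lambda>z. F (sgn z) * indicator (ball 0 1) z) \<in> borel_measurable borel" by measurable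
    from measurable_compose[OF pm this] have [measurable]: "G \<in> borel_measurable borel"
      unfolding G_def by simp
    have le: "norm a \<le> norm (a, b)" for a using norm_fst_le[of a b] .
    have Gi: "G a = G a * indicator (ball 0 1) a" for a
      using le[of a] by (auto simp: G_def indicator_def)
    have "(\<integral>\<^sup>+a. G a \<partial>lborel) = (\<integral>\<^sup>+a. G a * indicator (ball 0 1) (a :: real^3) \<partial>lborel)"
      using Gi by (intro nn_integral_cong) blast
    also have "\<dots> = (\<integral>\<^sup>+a. (\<integral>\<^sup>+w. G (norm a *\<^sub>R w) \<partial>sphere2) * indicator (ball 0 1) (a :: real^3) \<partial>lborel)"
      by (rule nn_integral_polar) simp
    also have "\<dots> = (\<integral>\<^sup>+a. F' (sgn (a, b)) * indicator (ball 0 1) (a, b) \<partial>lborel)"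
    proof (rule nn_integral_cong)
      fix a :: "real^3"
      have "(\<integral>\<^sup>+w. G (norm a *\<^sub>R w) \<partial>sphere2) =
          (\<integral>\<^sup>+w. F (norm (fst (sgn (a, b))) *\<^sub>R w, snd (sgn (a, b))) * indicator (ball 0 1) (a, b) \<partial>sphere2)"
      proof (rule nn_integral_cong_AE)
        show "AE w in sphere2. G (norm a *\<^sub>R w) = F (norm (fst (sgn (a, b))) *\<^sub>R w, snd (sgn (a, b))) * indicator (ball 0 1) (a, b)"
          using AE_uniform_sphere
        proof eventually_elim
          case (elim w)
          then have n: "norm (norm a *\<^sub>R w, b) = norm (a, b)" by (simp add: norm_Pair)
          have "sgn (norm a *\<^sub>R w, b) = (norm (fst (sgn (a, b))) *\<^sub>R w, snd (sgn (a, b)))"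
            using n by (simp add: sgn_div_norm)
          then show ?case using n by (simp add: G_def indicator_def)
        qed
      qed
      also have "\<dots> = F' (sgn (a, b)) * indicator (ball 0 1) (a, b)"
        unfolding F'_def by (rule nn_integral_multc) simp
      finally show "(\<integral>\<^sup>+w. G (norm a *\<^sub>R w) \<partial>sphere2) * indicator (ball 0 1) a =
          F' (sgn (a, b)) * indicator (ball 0 1) (a, b)"
        using le[of a] by (auto simp: indicator_def)
    qed
    finally show ?thesis by (simp add: G_def)
  qed
  then show ?thesis
    unfolding F'_def[symmetric] by (simp add: nn_integral_sphere5)
qed

section \<open>From the five-sphere to pairs of particle velocities\<close>

definition rv :: "3 \<Rightarrow> real^3^3 \<Rightarrow> real^3" where
  "rv k v = (1 / sqrt 2) *\<^sub>R (v $ k)"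

interpretation sigma3: prob_space sigma3
  by (rule prob_space_sigma3)

lemma measurable_rv [measurable]: "rv k \<in> borel_measurable sigma3"
proof -
  have "rv k \<in> borel_measurable borel"
    unfolding rv_def by (intro borel_measurable_continuous_onI continuous_intros)
  then show ?thesis
    by (subst measurable_cong_sets[OF sets_sigma3 refl]) (rule measurable_restrict_space1)
qed

lemma nn_integral_sigma3:
  assumes [measurable]: "f \<in> borel_measurable borel"
  shows "(\<integral>\<^sup>+v. f v \<partial>sigma3) = (\<integral>\<^sup>+z. f (sqrt 3 *\<^sub>R jacobi z) \<partial>sphere5)"
proof -
  let ?D = "distr sphere5 borel (\<lambda>z. sqrt 3 *\<^sub>R jacobi z)"
  have "(\<integral>\<^sup>+v. f v \<partial>sigma3) = (\<integral>\<^sup>+v. f v * indicator state_space3 v \<partial>?D)"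
    unfolding sigma3_def by (subst nn_integral_restrict_space) simp_all
  also have "\<dots> = (\<integral>\<^sup>+v. f v \<partial>?D)"
    by (rule nn_integral_cong_AE) (use AE_state_space3 in \<open>auto elim!: eventually_mono\<close>)
  also have "\<dots> = (\<integral>\<^sup>+z. f (sqrt 3 *\<^sub>R jacobi z) \<partial>sphere5)"
    by (rule nn_integral_distr) simp_all
  finally show ?thesis .
qed

lemma rv_jacobi:
  "rv 3 (sqrt 3 *\<^sub>R jacobi z) = snd z"
  "rv 1 (sqrt 3 *\<^sub>R jacobi z) = (sqrt 3 / 2) *\<^sub>R fst z - (1/2) *\<^sub>R snd z"
proof -
  have s: "sqrt 6 = sqrt 2 * sqrt (3::real)" by (simp flip: real_sqrt_mult)
  show "rv 3 (sqrt 3 *\<^sub>R jacobi z) = snd z"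
    "rv 1 (sqrt 3 *\<^sub>R jacobi z) = (sqrt 3 / 2) *\<^sub>R fst z - (1/2) *\<^sub>R snd z"
    by (cases z; simp add: rv_def jacobi_nth s scaleR_diff_right)+
qed

definition permute_particles :: "(3 \<Rightarrow> 3) \<Rightarrow> real^3^3 \<Rightarrow> real^3^3" where
  "permute_particles \<pi> v = (\<chi> i. v $ \<pi> i)"

text \<open>Exchangeability is a special case of rotation invariance: permuting the particles is
  orthogonal and keeps the total momentum zero.\<close>

lemma distr_permute_particles:
  assumes "bij \<pi>"
  shows "distr sigma3 sigma3 (permute_particles \<pi>) = sigma3"
proof (rule sigma3_rotation_invariant)
  have re: "(\<Sum>i\<in>UNIV. f (\<pi> i)) = (\<Sum>i\<in>UNIV. f i)" for f :: "3 \<Rightarrow> 'b::comm_monoid_add"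
    using assms by (rule sum.reindex_bij_betw)
  show "orthogonal_transformation (permute_particles \<pi>)"
    unfolding orthogonal_transformation_def
  proof (intro conjI allI)
    show "linear (permute_particles \<pi>)"
      by (rule linearI) (simp_all add: permute_particles_def vec_eq_iff)
    show "permute_particles \<pi> v \<bullet> permute_particles \<pi> w = v \<bullet> w" for v w
    proof -
      have "permute_particles \<pi> v \<bullet> permute_particles \<pi> w = (\<Sum>i\<in>UNIV. v $ \<pi> i \<bullet> w $ \<pi> i)"
        unfolding inner_vec_def[of "permute_particles \<pi> v"] by (simp add: permute_particles_def)
      then show ?thesis
        using re[of "\<lambda>i. v $ i \<bullet> w $ i"] by (simp add: inner_vec_def[of v])
    qed
  qed
  show "permute_particles \<pi> ` momentum_space \<subseteq> momentum_space"
  proof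
    fix u assume "u \<in> permute_particles \<pi> ` momentum_space"
    then obtain v where "v \<in> momentum_space" "u = permute_particles \<pi> v" by auto
    then show "u \<in> momentum_space"
      using re[of "\<lambda>i. v $ i"] by (simp add: momentum_space_def permute_particles_def)
  qed
qed

lemma nn_integral_permute_particles:
  assumes "bij \<pi>" and [measurable]: "f \<in> borel_measurable sigma3"
  shows "(\<integral>\<^sup>+v. f (permute_particles \<pi> v) \<partial>sigma3) = (\<integral>\<^sup>+v. f v \<partial>sigma3)"
proof -
  have re: "(\<Sum>i\<in>UNIV. f (\<pi> i)) = (\<Sum>i\<in>UNIV. f i)" for f :: "3 \<Rightarrow> 'b::comm_monoid_add"
    using assms(1) by (rule sum.reindex_bij_betw)
  have "permute_particles \<pi> \<in> borel_measurable borel"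
    by (intro borel_measurable_linear linearI) (simp_all add: permute_particles_def vec_eq_iff)
  moreover have "permute_particles \<pi> v \<in> state_space3" if "v \<in> state_space3" for v
    using that re[of "\<lambda>i. v $ i"] re[of "\<lambda>i. (norm (v $ i))\<^sup>2"] by (simp add: state_space3_def permute_particles_def)
  ultimately have "permute_particles \<pi> \<in> measurable sigma3 sigma3"
    unfolding measurable_cong_sets[OF sets_sigma3 sets_sigma3] by (intro measurable_restrict_space3) auto
  then show ?thesis
    by (subst (2) distr_permute_particles[OF assms(1), symmetric]) (simp add: nn_integral_distr)
qed

lemma ex_bij_three:
  assumes "j \<noteq> (k :: 3)"
  obtains \<pi> :: "3 \<Rightarrow> 3" where "bij \<pi>" "\<pi> 3 = j" "\<pi> 1 = k"
proof -
  obtain l where l: "l \<noteq> j" "l \<noteq> k"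
  proof -
    have "\<exists>l :: 3. l \<notin> {j, k}"
      using card_mono[of "{j, k}" "UNIV :: 3 set"] card_insert_le_m1[of 2 "{k}" j] by force
    then show thesis using that by auto
  qed
  define \<pi> :: "3 \<Rightarrow> 3" where "\<pi> i = (if i = 3 then j else if i = 1 then k else l)" for i
  have "inj \<pi>"
  proof (rule injI)
    fix a b assume "\<pi> a = \<pi> b"
    then show "a = b"
      using exhaust_3[of a] exhaust_3[of b] assms l by (auto simp: \<pi>_def split: if_splits)
  qed
  then have "bij \<pi>" using finite_UNIV_inj_surj[of \<pi>] by (simp add: bij_def)
  then show thesis by (rule that) (auto simp: \<pi>_def)
qed

definition mu :: "(real^3) measure" where
  "mu = distr sigma3 borel (rv 3)"

text \<open>By exchangeability the pair may be taken as particles \<open>3\<close> and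
  \<open>1\<close>, which are explicit in Jacobi coordinates. Given \<open>snd z\<close>, the vector
  \<open>fst z\<close> is uniform on the sphere of radius \<open>sqrt (wt (snd z))\<close>, and
  inserting it gives precisely \<open>resample\<close>.\<close>

lemma nn_integral_rv_pair:
  fixes F :: "(real^3) \<times> (real^3) \<Rightarrow> ennreal"
  assumes "j \<noteq> k" and F [measurable]: "F \<in> borel_measurable (borel \<Otimes>\<^sub>M borel)"
  shows "(\<integral>\<^sup>+v. F (rv j v, rv k v) \<partial>sigma3) = (\<integral>\<^sup>+x. (\<integral>\<^sup>+w. F (x, resample x w) \<partial>sphere2) \<partial>mu)"
proof -
  obtain \<pi> :: "3 \<Rightarrow> 3" where \<pi>: "bij \<pi>" "\<pi> 3 = j" "\<pi> 1 = k" using ex_bij_three[OF assms(1)] .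
  have rvb [measurable]: "rv k \<in> borel_measurable borel" for k
    unfolding rv_def by (intro borel_measurable_continuous_onI continuous_intros)
  have "(\<integral>\<^sup>+v. F (rv j v, rv k v) \<partial>sigma3) = (\<integral>\<^sup>+v. F (rv 3 (permute_particles \<pi> v), rv 1 (permute_particles \<pi> v)) \<partial>sigma3)"
    by (simp add: rv_def permute_particles_def \<pi>)
  also have "\<dots> = (\<integral>\<^sup>+v. F (rv 3 v, rv 1 v) \<partial>sigma3)"
    by (rule nn_integral_permute_particles[OF \<pi>(1)]) measurable
  also have "\<dots> = (\<integral>\<^sup>+z. F (snd z, (sqrt 3 / 2) *\<^sub>R fst z - (1/2) *\<^sub>R snd z) \<partial>sphere5)"
    by (subst nn_integral_sigma3) (simp_all add: rv_jacobi)
  also have "\<dots> = (\<integral>\<^sup>+z. (\<integral>\<^sup>+w. F (snd z, (sqrt 3 / 2) *\<^sub>R (norm (fst z) *\<^sub>R w) - (1/2) *\<^sub>R snd z) \<partial>sphere2) \<partial>sphere5)"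
  proof -
    have "(\<lambda>z. F (snd z, (sqrt 3 / 2) *\<^sub>R fst z - (1/2) *\<^sub>R snd z)) \<in> borel_measurable (borel \<Otimes>\<^sub>M borel)"
      by measurable
    then show ?thesis
      unfolding borel_prod by (subst nn_integral_sphere5_disintegrate) simp_all
  qed
  also have "\<dots> = (\<integral>\<^sup>+z. (\<integral>\<^sup>+w. F (snd z, resample (snd z) w) \<partial>sphere2) \<partial>sphere5)"
  proof (rule nn_integral_cong_AE)
    show "AE z in sphere5. (\<integral>\<^sup>+w. F (snd z, (sqrt 3 / 2) *\<^sub>R (norm (fst z) *\<^sub>R w) - (1/2) *\<^sub>R snd z) \<partial>sphere2) =
        (\<integral>\<^sup>+w. F (snd z, resample (snd z) w) \<partial>sphere2)"
      using AE_uniform_sphere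
    proof eventually_elim
      case (elim z)
      have "(norm (fst z))\<^sup>2 + (norm (snd z))\<^sup>2 = 1"
        using elim by (cases z) (simp add: norm_Pair)
      then have "norm (fst z) = sqrt (wt (snd z))"
        by (intro real_sqrt_unique[symmetric]) (simp_all add: wt_def)
      then show ?case by (simp add: resample_def)
    qed
  qed
  also have "\<dots> = (\<integral>\<^sup>+v. (\<integral>\<^sup>+w. F (rv 3 v, resample (rv 3 v) w) \<partial>sphere2) \<partial>sigma3)"
    by (subst nn_integral_sigma3) (simp_all add: rv_jacobi)
  also have "\<dots> = (\<integral>\<^sup>+x. (\<integral>\<^sup>+w. F (x, resample x w) \<partial>sphere2) \<partial>mu)"
    unfolding mu_def by (subst nn_integral_distr) simp_all
  finally show ?thesis .
qed

lemma sets_mu [measurable_cong, simp]: "sets mu = sets borel"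
  by (simp add: mu_def)

lemma prob_space_mu: "prob_space mu"
  unfolding mu_def by (rule sigma3.prob_space_distr) simp

interpretation mu: prob_space mu
  by (rule prob_space_mu)

text \<open>Joint law of any two distinct rescaled velocities. The definition by resampling makes it
  a disintegration; its symmetry, inherited from the particles, is the reversibility that makes the
  operator self-adjoint.\<close>

definition pair_law :: "((real^3) \<times> (real^3)) measure" where
  "pair_law = distr (mu \<Otimes>\<^sub>M sphere2) (borel \<Otimes>\<^sub>M borel) (\<lambda>p. (fst p, resample (fst p) (snd p)))"

lemma distr_rv_pair:
  assumes "j \<noteq> k"
  shows "distr sigma3 (borel \<Otimes>\<^sub>M borel) (\<lambda>v. (rv j v, rv k v)) = pair_law"
proof (rule measure_eqI)
  fix X assume "X \<in> sets (distr sigma3 (borel \<Otimes>\<^sub>M borel) (\<lambda>v. (rv j v, rv k v)))"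
  then have [measurable]: "X \<in> sets (borel \<Otimes>\<^sub>M borel)" by simp
  have "emeasure (distr sigma3 (borel \<Otimes>\<^sub>M borel) (\<lambda>v. (rv j v, rv k v))) X =
      (\<integral>\<^sup>+v. indicator X (rv j v, rv k v) \<partial>sigma3)"
    by (subst nn_integral_indicator[symmetric], simp, subst nn_integral_distr) simp_all
  also have "\<dots> = (\<integral>\<^sup>+x. (\<integral>\<^sup>+w. indicator X (x, resample x w) \<partial>sphere2) \<partial>mu)"
    by (rule nn_integral_rv_pair[OF assms]) simp
  also have "\<dots> = (\<integral>\<^sup>+p. indicator X (fst p, resample (fst p) (snd p)) \<partial>(mu \<Otimes>\<^sub>M sphere2))"
    by (subst sphere2.nn_integral_fst[symmetric]) simp_all
  also have "\<dots> = (\<integral>\<^sup>+q. indicator X q \<partial>pair_law)"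
    unfolding pair_law_def by (subst nn_integral_distr) simp_all
  also have "\<dots> = emeasure pair_law X"
    by (rule nn_integral_indicator) (simp add: pair_law_def)
  finally show "emeasure (distr sigma3 (borel \<Otimes>\<^sub>M borel) (\<lambda>v. (rv j v, rv k v))) X = emeasure pair_law X" .
qed (simp add: pair_law_def)

lemma distr_rv: "distr sigma3 borel (rv j) = mu"
proof -
  have "j \<noteq> j + 1" by simp
  then obtain k where "j \<noteq> k" by blast
  have "distr sigma3 borel (rv j) = distr (distr sigma3 (borel \<Otimes>\<^sub>M borel) (\<lambda>v. (rv j v, rv k v))) borel fst"
    by (simp add: distr_distr comp_def)
  also have "\<dots> = distr pair_law borel fst"
    unfolding distr_rv_pair[OF \<open>j \<noteq> k\<close>] ..
  also have "\<dots> = distr (distr sigma3 (borel \<Otimes>\<^sub>M borel) (\<lambda>v. (rv 3 v, rv 1 v))) borel fst"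
    by (subst distr_rv_pair) simp_all
  also have "\<dots> = mu"
    by (simp add: distr_distr comp_def mu_def)
  finally show ?thesis .
qed

lemma wt_rv_sum: "v \<in> state_space3 \<Longrightarrow> (\<Sum>k\<in>UNIV. wt (rv k v)) = 3/2"
  by (simp add: state_space3_def wt_def rv_def power_divide power_mult_distrib sum_3)

text \<open>Each velocity is minus the sum of the other two, so its square is at most
  \<open>2 * (3 - (norm (v $ k))^2)\<close>, whence it is at most \<open>2\<close>.\<close>

lemma norm_rv_le: "v \<in> state_space3 \<Longrightarrow> norm (rv k v) \<le> 1"
proof -
  assume v: "v \<in> state_space3"
  have "v $ 1 + v $ 2 + v $ 3 = 0" and e: "(norm (v $ 1))\<^sup>2 + (norm (v $ 2))\<^sup>2 + (norm (v $ 3))\<^sup>2 = 3"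
    using v by (simp_all add: state_space3_def sum_3)
  then have s: "v $ 1 = - (v $ 2 + v $ 3)" "v $ 2 = - (v $ 1 + v $ 3)" "v $ 3 = - (v $ 1 + v $ 2)"
    by (simp_all add: eq_neg_iff_add_eq_0 algebra_simps)
  have p: "(norm (- (a + b)))\<^sup>2 \<le> 2 * ((norm a)\<^sup>2 + (norm b)\<^sup>2)" for a b :: "real^3"
    using zero_le_power2[of "norm (a - b)"]
    unfolding norm_minus_cancel power2_norm_eq_inner by (simp add: inner_simps inner_commute)
  have "(norm (v $ k))\<^sup>2 \<le> 2"
    using p[of "v $ 2" "v $ 3"] p[of "v $ 1" "v $ 3"] p[of "v $ 1" "v $ 2"] e exhaust_3[of k]
    unfolding s[symmetric] by auto
  then have "(norm (rv k v))\<^sup>2 \<le> 1" by (simp add: rv_def power_divide)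
  then show ?thesis by (simp add: power_le_one_iff abs_square_le_1)
qed

lemma AE_mu: "AE x in mu. norm x \<le> 1"
  unfolding mu_def by (subst AE_distr_iff) (auto intro!: AE_I2 norm_rv_le simp: space_sigma3)

lemma sets_pair_law [measurable_cong, simp]: "sets pair_law = sets (borel \<Otimes>\<^sub>M borel)"
  by (simp add: pair_law_def)

lemma distr_pair_law:
  "distr pair_law borel fst = mu" "distr pair_law borel snd = mu"
  "distr pair_law (borel \<Otimes>\<^sub>M borel) (\<lambda>p. (snd p, fst p)) = pair_law"
proof -
  have "(3::3) \<noteq> 1" "(1::3) \<noteq> 3" by simp_all
  note p = this[THEN distr_rv_pair]
  show "distr pair_law borel fst = mu" "distr pair_law borel snd = mu"
    unfolding p(1)[symmetric] by (simp_all add: distr_distr comp_def distr_rv)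
  have "distr pair_law (borel \<Otimes>\<^sub>M borel) (\<lambda>p. (snd p, fst p)) =
      distr (distr sigma3 (borel \<Otimes>\<^sub>M borel) (\<lambda>v. (rv 3 v, rv 1 v))) (borel \<Otimes>\<^sub>M borel) (\<lambda>p. (snd p, fst p))"
    by (simp only: p(1))
  also have "\<dots> = distr sigma3 (borel \<Otimes>\<^sub>M borel) (\<lambda>v. (rv 1 v, rv 3 v))"
    by (subst distr_distr) (simp_all add: comp_def)
  also have "\<dots> = pair_law" by (rule p(2))
  finally show "distr pair_law (borel \<Otimes>\<^sub>M borel) (\<lambda>p. (snd p, fst p)) = pair_law" .
qed

lemma pair_law_marginal:
  fixes f :: "real^3 \<Rightarrow> real"
  assumes [measurable]: "f \<in> borel_measurable borel"
  shows "integrable pair_law (\<lambda>p. f (fst p)) \<longleftrightarrow> integrable mu f"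
    and "integrable pair_law (\<lambda>p. f (snd p)) \<longleftrightarrow> integrable mu f"
    and "(\<integral>p. f (fst p) \<partial>pair_law) = (\<integral>x. f x \<partial>mu)"
    and "(\<integral>p. f (snd p) \<partial>pair_law) = (\<integral>x. f x \<partial>mu)"
proof -
  have fs: "fst \<in> measurable pair_law borel" "snd \<in> measurable pair_law borel" by measurable
  show "integrable pair_law (\<lambda>p. f (fst p)) \<longleftrightarrow> integrable mu f"
    "integrable pair_law (\<lambda>p. f (snd p)) \<longleftrightarrow> integrable mu f"
    "(\<integral>p. f (fst p) \<partial>pair_law) = (\<integral>x. f x \<partial>mu)" "(\<integral>p. f (snd p) \<partial>pair_law) = (\<integral>x. f x \<partial>mu)"
    using integrable_distr_eq[OF fs(1), of f] integrable_distr_eq[OF fs(2), of f]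
      integral_distr[OF fs(1), of f] integral_distr[OF fs(2), of f]
    by (simp_all add: distr_pair_law)
qed

lemma AE_pair_law: "AE p in pair_law. norm (fst p) \<le> 1 \<and> norm (snd p) \<le> 1"
proof -
  have "AE p in distr sigma3 (borel \<Otimes>\<^sub>M borel) (\<lambda>v. (rv 3 v, rv 1 v)). norm (fst p) \<le> 1 \<and> norm (snd p) \<le> 1"
    by (subst AE_distr_iff) (auto intro!: AE_I2 norm_rv_le simp: space_sigma3)
  then show ?thesis by (subst (asm) distr_rv_pair) simp_all
qed

lemma integral_pair_law_swap:
  fixes f :: "(real^3) \<times> (real^3) \<Rightarrow> real"
  assumes [measurable]: "f \<in> borel_measurable (borel \<Otimes>\<^sub>M borel)"
  shows "(\<integral>p. f (snd p, fst p) \<partial>pair_law) = (\<integral>p. f p \<partial>pair_law)"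
  by (subst (2) distr_pair_law(3)[symmetric]) (simp add: integral_distr)

lemma integral_pair_law:
  fixes f :: "(real^3) \<times> (real^3) \<Rightarrow> real"
  assumes f: "integrable pair_law f"
  shows "(\<integral>p. f p \<partial>pair_law) = (\<integral>x. (\<integral>w. f (x, resample x w) \<partial>sphere2) \<partial>mu)"
proof -
  interpret pair_sigma_finite mu sphere2 ..
  have [measurable]: "f \<in> borel_measurable (borel \<Otimes>\<^sub>M borel)"
    using borel_measurable_integrable[OF f] by (simp add: measurable_cong_sets[OF sets_pair_law refl])
  have "integrable (mu \<Otimes>\<^sub>M sphere2) (\<lambda>p. f (fst p, resample (fst p) (snd p)))"
    using f unfolding pair_law_def by (subst (asm) integrable_distr_eq) simp_all
  from integral_fst'[OF this] show ?thesis
    unfolding pair_law_def by (subst integral_distr) simp_all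
qed

text \<open>The three weights have the same mean and the constant sum \<open>3/2\<close>.\<close>

lemma integral_wt_mu: "(\<integral>x. wt x \<partial>mu) = 1/2"
proof -
  have i: "integrable mu wt"
    by (rule mu.integrable_const_bound[of _ 1]) (use AE_mu wt_bounds in \<open>auto elim!: eventually_mono\<close>)
  have e: "(\<integral>v. wt (rv k v) \<partial>sigma3) = (\<integral>x. wt x \<partial>mu)" and ii: "integrable sigma3 (\<lambda>v. wt (rv k v))" for k
    using i unfolding distr_rv[of k, symmetric] by (simp_all add: integral_distr integrable_distr_eq)
  have "3/2 = (\<integral>v. (\<Sum>k\<in>UNIV. wt (rv k v)) \<partial>sigma3)"
    by (subst Bochner_Integration.integral_cong[OF refl wt_rv_sum])
      (auto simp: space_sigma3 sigma3.prob_space[unfolded space_sigma3])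
  also have "\<dots> = 3 * (\<integral>x. wt x \<partial>mu)"
    by (subst Bochner_Integration.integral_sum) (simp_all add: e ii)
  finally show ?thesis by simp
qed

section \<open>Quadratic forms of the resampling operator\<close>

definition wt_L2 :: "(real^3 \<Rightarrow> real) \<Rightarrow> bool" where
  "wt_L2 g \<longleftrightarrow> g \<in> borel_measurable borel \<and> integrable mu (\<lambda>x. wt x * (g x)\<^sup>2)"

definition wt_inner :: "(real^3 \<Rightarrow> real) \<Rightarrow> (real^3 \<Rightarrow> real) \<Rightarrow> real" where
  "wt_inner g h = (\<integral>x. wt x * g x * h x \<partial>mu)"

text \<open>\<open>diag_form\<close> and \<open>cross_form\<close> are the inner products in
  \<open>L^2\<close> of \<open>wt * g\<close> and \<open>wt * h\<close>, evaluated at the same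
  particle and at two different particles respectively.\<close>

definition diag_form :: "(real^3 \<Rightarrow> real) \<Rightarrow> (real^3 \<Rightarrow> real) \<Rightarrow> real" where
  "diag_form g h = (\<integral>x. (wt x)\<^sup>2 * g x * h x \<partial>mu)"

definition cross_form :: "(real^3 \<Rightarrow> real) \<Rightarrow> (real^3 \<Rightarrow> real) \<Rightarrow> real" where
  "cross_form g h = (\<integral>p. wt (fst p) * wt (snd p) * (g (fst p) * h (snd p)) \<partial>pair_law)"

lemma wt_L2_measurable: "wt_L2 g \<Longrightarrow> g \<in> borel_measurable borel"
  by (simp add: wt_L2_def)

lemma abs_mult_le_weighted:
  fixes a b t :: real
  assumes "0 < t"
  shows "\<bar>a * b\<bar> \<le> (t * a\<^sup>2 + b\<^sup>2 / t) / 2"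
proof -
  have "0 \<le> (t * \<bar>a\<bar> - \<bar>b\<bar>)\<^sup>2 / t" using assms by simp
  also have "\<dots> = t * a\<^sup>2 - 2 * \<bar>a * b\<bar> + b\<^sup>2 / t"
    using assms by (simp add: power2_eq_square abs_mult field_simps)
  finally show ?thesis by simp
qed

lemma wt_L2_inner:
  assumes g: "wt_L2 g" and h: "wt_L2 h"
  shows "integrable mu (\<lambda>x. wt x * g x * h x)" "integrable mu (\<lambda>x. (wt x)\<^sup>2 * g x * h x)"
proof -
  note [measurable] = wt_L2_measurable[OF g] wt_L2_measurable[OF h]
  have gh: "integrable mu (\<lambda>x. wt x * (g x)\<^sup>2 + wt x * (h x)\<^sup>2)"
    using g h by (simp add: wt_L2_def)
  have b: "\<bar>g x * h x\<bar> \<le> (g x)\<^sup>2 + (h x)\<^sup>2" for x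
    using abs_mult_le_weighted[of 1 "g x" "h x"] zero_le_power2[of "g x"] zero_le_power2[of "h x"] by simp
  have 1: "\<bar>wt x * g x * h x\<bar> \<le> wt x * (g x)\<^sup>2 + wt x * (h x)\<^sup>2" if "norm x \<le> 1" for x
    using mult_left_mono[OF b[of x] wt_bounds(1)[OF that]] wt_bounds(1)[OF that]
    by (simp add: abs_mult mult.assoc distrib_left)
  show i: "integrable mu (\<lambda>x. wt x * g x * h x)"
    by (rule Bochner_Integration.integrable_bound[OF gh])
      (use AE_mu 1 in \<open>auto elim!: eventually_mono intro: order_trans[OF _ abs_ge_self]\<close>)
  show "integrable mu (\<lambda>x. (wt x)\<^sup>2 * g x * h x)"
  proof (rule Bochner_Integration.integrable_bound[OF i])
    show "AE x in mu. norm ((wt x)\<^sup>2 * g x * h x) \<le> norm (wt x * g x * h x)"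
      using AE_mu
    proof eventually_elim
      case (elim x)
      have "\<bar>wt x\<bar> * \<bar>wt x * g x * h x\<bar> \<le> 1 * \<bar>wt x * g x * h x\<bar>"
        using wt_bounds(1)[OF elim] wt_bounds(2)[of x] by (intro mult_right_mono) auto
      then show ?case by (simp add: abs_mult power2_eq_square mult_ac)
    qed
  qed simp
qed

lemma wt_L2_cross:
  assumes g: "wt_L2 g" and h: "wt_L2 h"
  shows "integrable pair_law (\<lambda>p. wt (fst p) * wt (snd p) * (g (fst p) * h (snd p)))"
    and "0 < t \<Longrightarrow> \<bar>cross_form g h\<bar> \<le> (t * wt_inner g g + wt_inner h h / t) / 2"
proof -
  note [measurable] = wt_L2_measurable[OF g] wt_L2_measurable[OF h]
  have bnd: "AE p in pair_law. \<bar>wt (fst p) * wt (snd p) * (g (fst p) * h (snd p))\<bar>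
      \<le> (t * (wt (fst p) * (g (fst p))\<^sup>2) + wt (snd p) * (h (snd p))\<^sup>2 / t) / 2" if t: "0 < t" for t
    using AE_pair_law
  proof eventually_elim
    case (elim p)
    let ?s = "wt (fst p)" and ?r = "wt (snd p)"
    have w: "0 \<le> ?s" "?s \<le> 1" "0 \<le> ?r" "?r \<le> 1" using elim wt_bounds by auto
    have "\<bar>?s * ?r * (g (fst p) * h (snd p))\<bar> = ?s * ?r * \<bar>g (fst p) * h (snd p)\<bar>"
      using w by (simp add: abs_mult)
    also have "\<dots> \<le> ?s * ?r * ((t * (g (fst p))\<^sup>2 + (h (snd p))\<^sup>2 / t) / 2)"
      using w by (intro mult_left_mono abs_mult_le_weighted t) auto
    also have "\<dots> = ?r * (t * (?s * (g (fst p))\<^sup>2) / 2) + ?s * (?r * (h (snd p))\<^sup>2 / t / 2)"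
      by (simp add: field_simps)
    also have "\<dots> \<le> 1 * (t * (?s * (g (fst p))\<^sup>2) / 2) + 1 * (?r * (h (snd p))\<^sup>2 / t / 2)"
      using w t by (intro add_mono mult_right_mono) auto
    finally show ?case by (simp add: add_divide_distrib)
  qed
  have ig: "integrable pair_law (\<lambda>p. wt (fst p) * (g (fst p))\<^sup>2)"
    using g pair_law_marginal(1)[of "\<lambda>x. wt x * (g x)\<^sup>2"] by (simp add: wt_L2_def)
  have ih: "integrable pair_law (\<lambda>p. wt (snd p) * (h (snd p))\<^sup>2)"
    using h pair_law_marginal(2)[of "\<lambda>x. wt x * (h x)\<^sup>2"] by (simp add: wt_L2_def)
  have igh: "integrable pair_law (\<lambda>p. (t * (wt (fst p) * (g (fst p))\<^sup>2) + wt (snd p) * (h (snd p))\<^sup>2 / t) / 2)" for t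
    using ig ih by simp
  show i: "integrable pair_law (\<lambda>p. wt (fst p) * wt (snd p) * (g (fst p) * h (snd p)))"
    by (rule Bochner_Integration.integrable_bound[OF igh[of 1]])
      (use bnd[of 1] in \<open>auto elim!: eventually_mono intro: order_trans[OF _ abs_ge_self]\<close>)
  assume t: "0 < t"
  have "\<bar>cross_form g h\<bar> \<le> (\<integral>p. \<bar>wt (fst p) * wt (snd p) * (g (fst p) * h (snd p))\<bar> \<partial>pair_law)"
    unfolding cross_form_def by (rule integral_abs_bound)
  also have "\<dots> \<le> (\<integral>p. (t * (wt (fst p) * (g (fst p))\<^sup>2) + wt (snd p) * (h (snd p))\<^sup>2 / t) / 2 \<partial>pair_law)"
    by (rule integral_mono_AE[OF integrable_abs[OF i] igh bnd[OF t]])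
  also have "\<dots> = (t * wt_inner g g + wt_inner h h / t) / 2"
    using ig ih pair_law_marginal(3)[of "\<lambda>x. wt x * (g x)\<^sup>2"] pair_law_marginal(4)[of "\<lambda>x. wt x * (h x)\<^sup>2"]
    by (simp add: wt_inner_def power2_eq_square mult.assoc)
  finally show "\<bar>cross_form g h\<bar> \<le> (t * wt_inner g g + wt_inner h h / t) / 2" .
qed

lemma wt_L2_add_scale:
  assumes g: "wt_L2 g" and h: "wt_L2 h"
  shows "wt_L2 (\<lambda>x. c * g x + h x)"
proof -
  note [measurable] = wt_L2_measurable[OF g] wt_L2_measurable[OF h]
  have "integrable mu (\<lambda>x. c\<^sup>2 * (wt x * (g x)\<^sup>2) + 2 * c * (wt x * g x * h x) + wt x * (h x)\<^sup>2)"
    using g h wt_L2_inner(1)[OF g h] by (simp add: wt_L2_def)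
  also have "(\<lambda>x. c\<^sup>2 * (wt x * (g x)\<^sup>2) + 2 * c * (wt x * g x * h x) + wt x * (h x)\<^sup>2) =
      (\<lambda>x. wt x * (c * g x + h x)\<^sup>2)"
    by (auto simp: power2_eq_square algebra_simps)
  finally show ?thesis unfolding wt_L2_def by simp
qed

lemma wt_L2_bounded:
  assumes [measurable]: "h \<in> borel_measurable borel" and B: "\<And>y. norm y \<le> 1 \<Longrightarrow> \<bar>h y\<bar> \<le> B"
  shows "wt_L2 h"
  unfolding wt_L2_def
proof
  show "integrable mu (\<lambda>x. wt x * (h x)\<^sup>2)"
  proof (rule mu.integrable_const_bound[of _ "1 * B\<^sup>2"])
    show "AE x in mu. norm (wt x * (h x)\<^sup>2) \<le> 1 * B\<^sup>2"
      using AE_mu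
    proof eventually_elim
      case (elim x)
      have "(h x)\<^sup>2 \<le> B\<^sup>2" using B[OF elim] by (simp add: abs_le_square_iff[symmetric])
      then show ?case
        unfolding real_norm_def abs_mult using wt_bounds(1)[OF elim] wt_bounds(2)[of x]
        by (intro mult_mono) auto
    qed
  qed simp
qed simp

lemma wt_inner_nonneg: "0 \<le> wt_inner g g"
  unfolding wt_inner_def
  by (rule integral_nonneg_AE) (use AE_mu wt_bounds(1) in \<open>auto elim!: eventually_mono simp: mult.assoc\<close>)

lemma cross_form_eq_cond_mean:
  assumes g: "wt_L2 g" and h: "wt_L2 h"
  shows "cross_form g h = (\<integral>x. wt x * g x * cond_mean (\<lambda>y. wt y * h y) x \<partial>mu)"
  unfolding cross_form_def
  by (subst integral_pair_law[OF wt_L2_cross(1)[OF g h]])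
     (simp add: cond_mean_def mult_ac flip: integral_mult_right_zero)

lemma cross_form_commute:
  assumes g: "wt_L2 g" and h: "wt_L2 h"
  shows "cross_form g h = cross_form h g"
proof -
  note [measurable] = wt_L2_measurable[OF g] wt_L2_measurable[OF h]
  show ?thesis
    unfolding cross_form_def
    by (subst integral_pair_law_swap[symmetric]) (simp_all add: mult_ac)
qed

text \<open>Integrate \<open>wt * wt * (g + g)^2 \<ge> 0\<close> over two different velocities. The
  two squares have the same integral by symmetry, and the conditional mean
  \<open>3/4 - wt x / 2\<close> of the second weight evaluates it. This serves for the deviations,
  whose cross terms enter with a negative sign.\<close>

lemma minus_cross_form_le:
  assumes g: "wt_L2 g"
  shows "- cross_form g g \<le> 3/4 * wt_inner g g - 1/2 * diag_form g g"
proof -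
  note [measurable] = wt_L2_measurable[OF g]
  have gg: "integrable mu (\<lambda>x. wt x * (g x)\<^sup>2)" using g by (simp add: wt_L2_def)
  have ip: "integrable pair_law (\<lambda>p. wt (fst p) * wt (snd p) * (g (fst p))\<^sup>2)"
  proof (rule Bochner_Integration.integrable_bound)
    show "integrable pair_law (\<lambda>p. wt (fst p) * (g (fst p))\<^sup>2)"
      using gg pair_law_marginal(1)[of "\<lambda>x. wt x * (g x)\<^sup>2"] by simp
    show "AE p in pair_law. norm (wt (fst p) * wt (snd p) * (g (fst p))\<^sup>2) \<le> norm (wt (fst p) * (g (fst p))\<^sup>2)"
      using AE_pair_law
    proof eventually_elim
      case (elim p)
      have "\<bar>wt (snd p)\<bar> * \<bar>wt (fst p) * (g (fst p))\<^sup>2\<bar> \<le> 1 * \<bar>wt (fst p) * (g (fst p))\<^sup>2\<bar>"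
        using elim wt_bounds(1)[of "snd p"] wt_bounds(2)[of "snd p"] by (intro mult_right_mono) auto
      then show ?case by (simp add: abs_mult mult_ac)
    qed
  qed simp
  have ip': "integrable pair_law (\<lambda>p. wt (fst p) * wt (snd p) * (g (snd p))\<^sup>2)"
  proof -
    have "integrable (distr pair_law (borel \<Otimes>\<^sub>M borel) (\<lambda>p. (snd p, fst p))) (\<lambda>p. wt (fst p) * wt (snd p) * (g (fst p))\<^sup>2)"
      using ip by (simp only: distr_pair_law)
    then show ?thesis by (subst (asm) integrable_distr_eq) (simp_all add: mult.commute)
  qed
  have eq: "(\<integral>p. wt (fst p) * wt (snd p) * (g (snd p))\<^sup>2 \<partial>pair_law) = (\<integral>p. wt (fst p) * wt (snd p) * (g (fst p))\<^sup>2 \<partial>pair_law)"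
    by (subst integral_pair_law_swap[symmetric]) (simp_all add: mult.commute)
  have val: "(\<integral>p. wt (fst p) * wt (snd p) * (g (fst p))\<^sup>2 \<partial>pair_law) = 3/4 * wt_inner g g - 1/2 * diag_form g g"
  proof -
    have "(\<integral>p. wt (fst p) * wt (snd p) * (g (fst p))\<^sup>2 \<partial>pair_law) =
        (\<integral>x. (\<integral>w. wt x * (g x)\<^sup>2 * wt (resample x w) \<partial>sphere2) \<partial>mu)"
      by (subst integral_pair_law[OF ip]) (simp add: mult_ac)
    also have "\<dots> = (\<integral>x. 3/4 * (wt x * g x * g x) - 1/2 * ((wt x)\<^sup>2 * g x * g x) \<partial>mu)"
    proof (rule integral_cong_AE)
      show "AE x in mu. (\<integral>w. wt x * (g x)\<^sup>2 * wt (resample x w) \<partial>sphere2) =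
          3/4 * (wt x * g x * g x) - 1/2 * ((wt x)\<^sup>2 * g x * g x)"
        using AE_mu
      proof eventually_elim
        case (elim x)
        have "(\<integral>w. wt x * (g x)\<^sup>2 * wt (resample x w) \<partial>sphere2) = wt x * (g x)\<^sup>2 * (3/4 - wt x / 2)"
          using cond_mean_wt[OF elim] by (simp add: cond_mean_def)
        then show ?case by (simp add: power2_eq_square algebra_simps)
      qed
    qed measurable
    also have "\<dots> = 3/4 * wt_inner g g - 1/2 * diag_form g g"
      using wt_L2_inner[OF g g] by (simp add: wt_inner_def diag_form_def)
    finally show ?thesis .
  qed
  have "- cross_form g g = (\<integral>p. - (wt (fst p) * wt (snd p) * (g (fst p) * g (snd p))) \<partial>pair_law)"
    by (simp add: cross_form_def)
  also have "\<dots> \<le> (\<integral>p. (wt (fst p) * wt (snd p) * (g (fst p))\<^sup>2 + wt (fst p) * wt (snd p) * (g (snd p))\<^sup>2) / 2 \<partial>pair_law)"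
  proof (rule integral_mono_AE)
    show "integrable pair_law (\<lambda>p. - (wt (fst p) * wt (snd p) * (g (fst p) * g (snd p))))"
      using wt_L2_cross(1)[OF g g] by simp
    show "integrable pair_law (\<lambda>p. (wt (fst p) * wt (snd p) * (g (fst p))\<^sup>2 + wt (fst p) * wt (snd p) * (g (snd p))\<^sup>2) / 2)"
      using ip ip' by simp
    show "AE p in pair_law. - (wt (fst p) * wt (snd p) * (g (fst p) * g (snd p))) \<le>
        (wt (fst p) * wt (snd p) * (g (fst p))\<^sup>2 + wt (fst p) * wt (snd p) * (g (snd p))\<^sup>2) / 2"
      using AE_pair_law
    proof eventually_elim
      case (elim p)
      have "0 \<le> wt (fst p) * wt (snd p) * (g (fst p) + g (snd p))\<^sup>2"
        using elim wt_bounds by (intro mult_nonneg_nonneg) auto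
      then show ?case by (simp add: power2_eq_square algebra_simps)
    qed
  qed
  also have "\<dots> = 3/4 * wt_inner g g - 1/2 * diag_form g g"
    using ip ip' by (simp add: eq val)
  finally show ?thesis .
qed

lemma diag_form_le:
  assumes g: "wt_L2 g"
  shows "diag_form g g \<le> wt_inner g g" "0 \<le> diag_form g g"
proof -
  have w: "AE x in mu. (wt x)\<^sup>2 * g x * g x \<le> wt x * g x * g x"
    using AE_mu
  proof eventually_elim
    case (elim x)
    have "wt x * (wt x * (g x)\<^sup>2) \<le> 1 * (wt x * (g x)\<^sup>2)"
      using wt_bounds(1)[OF elim] wt_bounds(2)[of x] by (intro mult_right_mono) auto
    then show ?case by (simp add: power2_eq_square mult_ac)
  qed
  show "diag_form g g \<le> wt_inner g g"
    unfolding diag_form_def wt_inner_def using wt_L2_inner[OF g g] w by (intro integral_mono_AE)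
  show "0 \<le> diag_form g g"
    unfolding diag_form_def by (rule integral_nonneg_AE) (simp add: mult.assoc)
qed

lemma wt_inner_commute: "wt_inner g h = wt_inner h g"
  unfolding wt_inner_def by (simp add: mult_ac)

lemma form_add_left:
  assumes f: "wt_L2 f" and g: "wt_L2 g" and h: "wt_L2 h"
  shows "wt_inner (\<lambda>x. c * f x + g x) h = c * wt_inner f h + wt_inner g h"
    and "diag_form (\<lambda>x. c * f x + g x) h = c * diag_form f h + diag_form g h"
    and "cross_form (\<lambda>x. c * f x + g x) h = c * cross_form f h + cross_form g h"
proof -
  have "wt_inner (\<lambda>x. c * f x + g x) h = (\<integral>x. c * (wt x * f x * h x) + wt x * g x * h x \<partial>mu)"
    unfolding wt_inner_def by (rule Bochner_Integration.integral_cong) (simp_all add: algebra_simps)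
  then show "wt_inner (\<lambda>x. c * f x + g x) h = c * wt_inner f h + wt_inner g h"
    using wt_L2_inner[OF f h] wt_L2_inner[OF g h] by (simp add: wt_inner_def)
  have "diag_form (\<lambda>x. c * f x + g x) h = (\<integral>x. c * ((wt x)\<^sup>2 * f x * h x) + (wt x)\<^sup>2 * g x * h x \<partial>mu)"
    unfolding diag_form_def by (rule Bochner_Integration.integral_cong) (simp_all add: algebra_simps)
  then show "diag_form (\<lambda>x. c * f x + g x) h = c * diag_form f h + diag_form g h"
    using wt_L2_inner[OF f h] wt_L2_inner[OF g h] by (simp add: diag_form_def)
  have "cross_form (\<lambda>x. c * f x + g x) h = (\<integral>p. c * (wt (fst p) * wt (snd p) * (f (fst p) * h (snd p)))
      + wt (fst p) * wt (snd p) * (g (fst p) * h (snd p)) \<partial>pair_law)"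
    unfolding cross_form_def by (rule Bochner_Integration.integral_cong) (simp_all add: algebra_simps)
  then show "cross_form (\<lambda>x. c * f x + g x) h = c * cross_form f h + cross_form g h"
    using wt_L2_cross(1)[OF f h] wt_L2_cross(1)[OF g h] by (simp add: cross_form_def)
qed

section \<open>The quadratic form of the operator on functions orthogonal to constants\<close>

definition kac_form :: "(real^3 \<Rightarrow> real) \<Rightarrow> (real^3 \<Rightarrow> real) \<Rightarrow> real" where
  "kac_form g h = 1/2 * diag_form g h + cross_form g h"

lemma kac_form_eq_kac_op:
  assumes [measurable]: "h \<in> borel_measurable borel" and B: "\<And>y. norm y \<le> 1 \<Longrightarrow> \<bar>h y\<bar> \<le> B"
  shows "(\<integral>x. wt x * h x * kac_op h x \<partial>mu) = kac_form h h"
proof -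
  have h: "wt_L2 h" using assms by (rule wt_L2_bounded)
  have D: "\<bar>cond_mean (\<lambda>y. wt y * h y) x\<bar> \<le> 3/4 * B + B" if x: "norm x \<le> 1" for x
  proof -
    have "\<bar>wt x * h x\<bar> \<le> B" by (intro abs_wt_mult_le B x)
    moreover have "\<bar>kac_op h x\<bar> \<le> 3/4 * B" by (rule abs_kac_op_le[OF assms x])
    moreover have "0 \<le> B" using B[of 0] by simp
    moreover have "kac_op h x = 1/2 * (wt x * h x) + cond_mean (\<lambda>y. wt y * h y) x"
      by (simp add: kac_op_def)
    ultimately show ?thesis by linarith
  qed
  have "wt_L2 (cond_mean (\<lambda>y. wt y * h y))"
    by (rule wt_L2_bounded[OF _ D]) measurable
  then have "integrable mu (\<lambda>x. wt x * h x * cond_mean (\<lambda>y. wt y * h y) x)"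
    by (rule wt_L2_inner(1)[OF h])
  then have "(\<integral>x. 1/2 * ((wt x)\<^sup>2 * h x * h x) + wt x * h x * cond_mean (\<lambda>y. wt y * h y) x \<partial>mu) =
      1/2 * diag_form h h + cross_form h h"
    using wt_L2_inner(2)[OF h h] by (simp add: cross_form_eq_cond_mean[OF h h] diag_form_def)
  moreover have "wt x * h x * kac_op h x = 1/2 * ((wt x)\<^sup>2 * h x * h x) + wt x * h x * cond_mean (\<lambda>y. wt y * h y) x" for x
    by (simp add: kac_op_def power2_eq_square field_simps)
  ultimately show ?thesis by (simp add: kac_form_def)
qed

text \<open>On the ball the angular weight \<open>1 - wt x / 25\<close> is at least
  \<open>24/25\<close>, so a Lipschitz function with constant \<open>L\<close> has angular constant
  \<open>25/24 * L\<close>.\<close>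

lemma kac_form_lipschitz:
  assumes L: "L-lipschitz_on UNIV h" and B: "\<And>y. \<bar>h y\<bar> \<le> B" and mean0: "wt_inner (\<lambda>_. 1) h = 0"
  shows "kac_form h h \<le> 9127/12500 * wt_inner h h"
proof -
  have h [measurable]: "h \<in> borel_measurable borel" using L by (rule lipschitz_on_borel_measurable)
  have L0: "0 \<le> L" using L by (rule lipschitz_on_nonneg)
  have ang: "ang_lip (25/24 * L) h"
    unfolding ang_lip_def
  proof (intro allI impI, elim conjE)
    fix x x' :: "real^3" assume x: "norm x \<le> 1"
    have "norm x * \<bar>h x - h x'\<bar> \<le> 1 * (L * norm (x - x'))"
      using x lipschitz_onD[OF L, of x x'] by (intro mult_mono) (auto simp: dist_norm)
    also have "\<dots> \<le> (25/24 * (1 - wt x / 25)) * (L * norm (x - x'))"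
      using wt_bounds(2)[of x] L0 by (intro mult_right_mono) auto
    finally show "norm x * \<bar>h x - h x'\<bar> \<le> 25/24 * L * (1 - wt x / 25) * norm (x - x')"
      by (simp add: mult_ac)
  qed
  have sym: "(\<integral>x. wt x * f x * cond_mean (\<lambda>y. wt y * g y) x \<partial>mu) = (\<integral>x. wt x * g x * cond_mean (\<lambda>y. wt y * f y) x \<partial>mu)"
    if fg: "f \<in> borel_measurable borel" "g \<in> borel_measurable borel"
      "bounded (f ` cball 0 1)" "bounded (g ` cball 0 1)" for f g :: "real^3 \<Rightarrow> real"
  proof -
    from fg(3) obtain C where "\<forall>y\<in>cball 0 1. \<bar>f y\<bar> \<le> C" by (auto simp: bounded_iff)
    then have C: "\<And>y. norm y \<le> 1 \<Longrightarrow> \<bar>f y\<bar> \<le> C" by simp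
    from fg(4) obtain D where "\<forall>y\<in>cball 0 1. \<bar>g y\<bar> \<le> D" by (auto simp: bounded_iff)
    then have D: "\<And>y. norm y \<le> 1 \<Longrightarrow> \<bar>g y\<bar> \<le> D" by simp
    have "wt_L2 f" "wt_L2 g" using wt_L2_bounded fg(1,2) C D by blast+
    then show ?thesis by (simp add: cross_form_commute flip: cross_form_eq_cond_mean)
  qed
  have "(\<integral>x. wt x * h x * kac_op h x \<partial>mu) \<le> 9127/12500 * (\<integral>x. wt x * (h x)\<^sup>2 \<partial>mu)"
    by (rule kac_op_spectral_bound[OF prob_space_mu sets_mu AE_mu sym h B _ ang])
      (use mean0 L0 in \<open>auto simp: wt_inner_def integral_wt_mu\<close>)
  then show ?thesis
    using kac_form_eq_kac_op[OF h B] by (simp add: wt_inner_def power2_eq_square mult.assoc)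
qed

text \<open>A Lipschitz approximation from density is corrected by a constant to be orthogonal to
  constants. As \<open>g\<close> already is, this replaces the error \<open>u\<close> by its
  projection orthogonal to constants, so the error does not grow:
  \<open>wt_inner u' u' = wt_inner u u - m^2 / 2\<close>.\<close>

lemma wt_L2_lipschitz_approx:
  assumes g: "wt_L2 g" and mean0: "wt_inner (\<lambda>_. 1) g = 0" and e: "0 < \<epsilon>"
  obtains h L B where "L-lipschitz_on UNIV h" "\<And>y. \<bar>h y\<bar> \<le> B" "wt_inner (\<lambda>_. 1) h = 0"
    "wt_inner (\<lambda>x. g x - h x) (\<lambda>x. g x - h x) \<le> \<epsilon>"
proof -
  note [measurable] = wt_L2_measurable[OF g]
  \<comment> \<open>\<open>wt\<close> is negative outside the unit ball; the maximum makes the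
    density nonnegative everywhere and changes it only on a null set of \<open>mu\<close>.\<close>
  define M where "M = density mu (\<lambda>x. ennreal (max 0 (wt x)))"
  have AE_eq: "AE x in mu. max 0 (wt x) = wt x"
    using AE_mu by eventually_elim (simp add: wt_bounds max_def)
  have one: "wt_L2 (\<lambda>_. 1)" by (rule wt_L2_bounded[of _ 1]) auto
  have sp: "space mu = UNIV" using sets_eq_imp_space_eq[OF sets_mu] by simp
  have "emeasure M (space M) = (\<integral>\<^sup>+x. ennreal (max 0 (wt x)) \<partial>mu)"
    unfolding M_def by (subst emeasure_density) (auto intro!: nn_integral_cong simp: sp)
  also have "\<dots> \<le> (\<integral>\<^sup>+x. 1 \<partial>mu)"
    using wt_bounds(2) by (intro nn_integral_mono) (simp add: max_def)
  also have "\<dots> = 1" using mu.emeasure_space_1 by simp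
  finally have "emeasure M (space M) \<noteq> \<infinity>" by (auto simp: top_unique)
  then have fin: "finite_measure M" by (rule finite_measureI)
  have setsM: "sets M = sets borel" by (simp add: M_def)
  have int_M: "integrable M f \<longleftrightarrow> integrable mu (\<lambda>x. wt x * f x)" "(\<integral>x. f x \<partial>M) = (\<integral>x. wt x * f x \<partial>mu)"
    if [measurable]: "f \<in> borel_measurable borel" for f :: "real^3 \<Rightarrow> real"
  proof -
    have ae: "AE x in mu. max 0 (wt x) *\<^sub>R f x = wt x * f x" using AE_eq by eventually_elim simp
    have "integrable mu (\<lambda>x. max 0 (wt x) *\<^sub>R f x) = integrable mu (\<lambda>x. wt x * f x)"
      by (rule integrable_cong_AE[OF _ _ ae]) measurable
    then show "integrable M f \<longleftrightarrow> integrable mu (\<lambda>x. wt x * f x)"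
      unfolding M_def by (subst integrable_density) simp_all
    have "(\<integral>x. max 0 (wt x) *\<^sub>R f x \<partial>mu) = (\<integral>x. wt x * f x \<partial>mu)"
      by (rule integral_cong_AE[OF _ _ ae]) measurable
    then show "(\<integral>x. f x \<partial>M) = (\<integral>x. wt x * f x \<partial>mu)"
      unfolding M_def by (subst integral_density) simp_all
  qed
  have "lipschitz_L2_limit M g"
    using g by (intro lipschitz_L2_dense fin setsM) (auto simp: wt_L2_def int_M)
  then obtain h B L where h: "\<And>x. \<bar>h x\<bar> \<le> B" "L-lipschitz_on UNIV h"
    and small: "(\<integral>x. (g x - h x)\<^sup>2 \<partial>M) < \<epsilon>"
    using e unfolding lipschitz_L2_limit_def by blast
  have hm [measurable]: "h \<in> borel_measurable borel" using h(2) by (rule lipschitz_on_borel_measurable)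
  have hL: "wt_L2 h" using h by (intro wt_L2_bounded[of _ B]) auto
  define u where "u = (\<lambda>x. -1 * h x + g x)"
  have uL: "wt_L2 u" unfolding u_def by (rule wt_L2_add_scale[OF hL g])
  have u_small: "wt_inner u u < \<epsilon>"
  proof -
    have "(\<integral>x. (g x - h x)\<^sup>2 \<partial>M) = wt_inner u u"
      by (subst int_M) (simp_all add: wt_inner_def u_def power2_eq_square mult.assoc)
    with small show ?thesis by simp
  qed
  \<comment> \<open>The factor \<open>2\<close> is the reciprocal of
    \<open>wt_inner (\<lambda>_. 1) (\<lambda>_. 1)\<close>.\<close>
  define m where "m = 2 * wt_inner (\<lambda>_. 1) h"
  have one1: "wt_inner (\<lambda>_. 1) (\<lambda>_. 1) = 1/2" by (simp add: wt_inner_def integral_wt_mu)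
  define h' where "h' = (\<lambda>x. - m * 1 + h x)"
  have lip: "L-lipschitz_on UNIV h'"
    unfolding h'_def using lipschitz_onD[OF h(2)] lipschitz_on_nonneg[OF h(2)]
    by (intro lipschitz_onI) (auto simp: dist_real_def)
  have bd: "\<bar>h' y\<bar> \<le> \<bar>m\<bar> + B" for y
    using h(1)[of y] unfolding h'_def by linarith
  have "wt_inner h' (\<lambda>_. 1) = - m * wt_inner (\<lambda>_. 1) (\<lambda>_. 1) + wt_inner h (\<lambda>_. 1)"
    unfolding h'_def by (rule form_add_left(1)[OF one hL one])
  then have mean': "wt_inner (\<lambda>_. 1) h' = 0"
    by (simp add: one1 m_def wt_inner_commute[of _ "\<lambda>_. 1"])
  define u' where "u' = (\<lambda>x. m * 1 + u x)"
  have u'L: "wt_L2 u'" unfolding u'_def by (rule wt_L2_add_scale[OF one uL])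
  have gh': "(\<lambda>x. g x - h' x) = u'" by (auto simp: h'_def u'_def u_def)
  have u1: "wt_inner u (\<lambda>_. 1) = - m / 2"
    unfolding u_def form_add_left(1)[OF hL g one]
    using mean0 by (simp add: wt_inner_commute[of _ "\<lambda>_. 1"] m_def)
  have "wt_inner u' u' = m * wt_inner (\<lambda>_. 1) u' + wt_inner u u'"
    by (subst u'_def) (rule form_add_left(1)[OF one uL u'L])
  also have "wt_inner (\<lambda>_. 1) u' = m * (1/2) + wt_inner u (\<lambda>_. 1)"
    by (subst wt_inner_commute, subst u'_def, subst form_add_left(1)[OF one uL one]) (simp add: one1)
  also have "wt_inner u u' = m * wt_inner u (\<lambda>_. 1) + wt_inner u u"
    by (subst wt_inner_commute, subst u'_def, subst form_add_left(1)[OF one uL uL])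
      (simp add: wt_inner_commute[of "\<lambda>_. 1" u])
  finally have "wt_inner u' u' = wt_inner u u - m\<^sup>2 / 2"
    unfolding u1 by (simp add: power2_eq_square)
  also have "\<dots> \<le> wt_inner u u" by simp
  finally have "wt_inner u' u' \<le> \<epsilon>" using u_small by simp
  with lip bd mean' show thesis unfolding gh'[symmetric] by (rule that)
qed

lemma kac_form_add:
  assumes f: "wt_L2 f" and g: "wt_L2 g"
  shows "kac_form (\<lambda>x. f x + g x) (\<lambda>x. f x + g x) = kac_form f f + 2 * kac_form f g + kac_form g g"
    "wt_inner (\<lambda>x. f x + g x) (\<lambda>x. f x + g x) = wt_inner f f + 2 * wt_inner f g + wt_inner g g"
proof -
  have fg: "wt_L2 (\<lambda>x. f x + g x)" using wt_L2_add_scale[OF f g, of 1] by simp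
  have dc: "diag_form a b = diag_form b a" for a b unfolding diag_form_def by (simp add: mult_ac)
  note l = form_add_left[OF f g, where c = 1, simplified]
  let ?s = "\<lambda>x. f x + g x"
  show "kac_form (\<lambda>x. f x + g x) (\<lambda>x. f x + g x) = kac_form f f + 2 * kac_form f g + kac_form g g"
  proof -
    have "diag_form ?s ?s = diag_form f f + 2 * diag_form f g + diag_form g g"
      using l(2)[OF fg] l(2)[OF f] l(2)[OF g] dc[of f ?s] dc[of g ?s] dc[of g f] by simp
    moreover have "cross_form ?s ?s = cross_form f f + 2 * cross_form f g + cross_form g g"
      using l(3)[OF fg] l(3)[OF f] l(3)[OF g] cross_form_commute[OF f fg] cross_form_commute[OF g fg]
        cross_form_commute[OF g f] by simp
    ultimately show ?thesis by (simp add: kac_form_def algebra_simps)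
  qed
  show "wt_inner (\<lambda>x. f x + g x) (\<lambda>x. f x + g x) = wt_inner f f + 2 * wt_inner f g + wt_inner g g"
    using l(1)[OF fg] l(1)[OF f] l(1)[OF g] wt_inner_commute[of f ?s] wt_inner_commute[of g ?s]
      wt_inner_commute[of g f] by simp
qed

lemma abs_forms_le:
  assumes f: "wt_L2 f" and g: "wt_L2 g" and t: "0 < t"
  shows "\<bar>wt_inner f g\<bar> \<le> (t * wt_inner f f + wt_inner g g / t) / 2"
    and "\<bar>kac_form f g\<bar> \<le> t * wt_inner f f + wt_inner g g / t"
proof -
  note [measurable] = wt_L2_measurable[OF f] wt_L2_measurable[OF g]
  have pt: "\<bar>wt x * f x * g x\<bar> \<le> (t * (wt x * f x * f x) + wt x * g x * g x / t) / 2" if "norm x \<le> 1" for x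
  proof -
    have "wt x * \<bar>f x * g x\<bar> \<le> wt x * ((t * (f x)\<^sup>2 + (g x)\<^sup>2 / t) / 2)"
      using wt_bounds(1)[OF that] by (intro mult_left_mono abs_mult_le_weighted t)
    then show ?thesis using wt_bounds(1)[OF that] by (simp add: abs_mult power2_eq_square field_simps)
  qed
  have int: "integrable mu (\<lambda>x. (t * (wt x * f x * f x) + wt x * g x * g x / t) / 2)"
    using wt_L2_inner(1)[OF f f] wt_L2_inner(1)[OF g g] by simp
  have val: "(\<integral>x. (t * (wt x * f x * f x) + wt x * g x * g x / t) / 2 \<partial>mu) = (t * wt_inner f f + wt_inner g g / t) / 2"
    using wt_L2_inner(1)[OF f f] wt_L2_inner(1)[OF g g] by (simp add: wt_inner_def)
  show "\<bar>wt_inner f g\<bar> \<le> (t * wt_inner f f + wt_inner g g / t) / 2"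
    unfolding val[symmetric] unfolding wt_inner_def
    by (rule order_trans[OF integral_abs_bound integral_mono_AE])
      (use wt_L2_inner(1)[OF f g] int pt AE_mu in \<open>auto elim!: eventually_mono\<close>)
  have "\<bar>diag_form f g\<bar> \<le> (t * wt_inner f f + wt_inner g g / t) / 2"
    unfolding val[symmetric] unfolding diag_form_def
  proof (rule order_trans[OF integral_abs_bound integral_mono_AE])
    show "AE x in mu. \<bar>(wt x)\<^sup>2 * f x * g x\<bar> \<le> (t * (wt x * f x * f x) + wt x * g x * g x / t) / 2"
      using AE_mu
    proof eventually_elim
      case (elim x)
      have "\<bar>wt x\<bar> * \<bar>wt x * f x * g x\<bar> \<le> 1 * \<bar>wt x * f x * g x\<bar>"
        using wt_bounds(1)[OF elim] wt_bounds(2)[of x] by (intro mult_right_mono) auto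
      then have "\<bar>(wt x)\<^sup>2 * f x * g x\<bar> \<le> \<bar>wt x * f x * g x\<bar>"
        by (simp add: abs_mult power2_eq_square mult_ac)
      also note pt[OF elim]
      finally show ?case .
    qed
  qed (use wt_L2_inner(2)[OF f g] int in auto)
  moreover have "\<bar>cross_form f g\<bar> \<le> (t * wt_inner f f + wt_inner g g / t) / 2"
    by (rule wt_L2_cross(2)[OF f g t])
  moreover have "0 \<le> t * wt_inner f f + wt_inner g g / t"
    using t wt_inner_nonneg by (intro add_nonneg_nonneg) auto
  ultimately show "\<bar>kac_form f g\<bar> \<le> t * wt_inner f f + wt_inner g g / t"
    unfolding kac_form_def by argo
qed

text \<open>Density argument with explicit errors. When the squared error is at most
  \<open>t^2\<close>, the weighted inequalities with the same \<open>t\<close> make every error term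
  of order \<open>t\<close>. They add up to \<open>t * (3 * H + 5)\<close>, and
  \<open>H \<le> 2 * G + 1\<close> turns this into \<open>t * K\<close>, which explains
  \<open>K = 6 * G + 8\<close>.\<close>

lemma kac_form_spectral_bound:
  assumes g: "wt_L2 g" and mean0: "wt_inner (\<lambda>_. 1) g = 0"
  shows "kac_form g g \<le> 9127/12500 * wt_inner g g"
proof (rule field_le_epsilon)
  fix e :: real assume e: "0 < e"
  define c :: real where "c = 9127/12500"
  define G where "G = wt_inner g g"
  define K where "K = 6 * G + 8"
  have G: "0 \<le> G" unfolding G_def by (rule wt_inner_nonneg)
  have K: "0 < K" using G by (simp add: K_def)
  define t where "t = min (1/2) (e / K)"
  have t: "0 < t" "t \<le> 1/2"
  proof -
    show "0 < t" using e K by (simp add: t_def)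
    show "t \<le> 1/2" unfolding t_def by (rule min.cobounded1)
  qed
  have "t \<le> e / K" by (simp add: t_def)
  then have tK: "t * K \<le> e" using K by (simp add: pos_le_divide_eq)
  have t2: "0 < t\<^sup>2" using t by simp
  obtain L h B where h: "L-lipschitz_on UNIV h" "\<And>y. \<bar>h y\<bar> \<le> B" "wt_inner (\<lambda>_. 1) h = 0"
    and small: "wt_inner (\<lambda>x. g x - h x) (\<lambda>x. g x - h x) \<le> t\<^sup>2"
    by (rule wt_L2_lipschitz_approx[OF g mean0 t2]) (rule that)
  have hL: "wt_L2 h"
    using h lipschitz_on_borel_measurable[OF h(1)] by (intro wt_L2_bounded[of _ B]) auto
  define u where "u = (\<lambda>x. g x - h x)"
  have uL: "wt_L2 u"
    using wt_L2_add_scale[OF hL g, of "-1"] by (simp add: u_def)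
  define U H where "U = wt_inner u u" and "H = wt_inner h h"
  have U: "0 \<le> U" "U \<le> t * t" using small wt_inner_nonneg by (simp_all add: U_def u_def power2_eq_square)
  have Ut: "U / t \<le> t" using U t by (simp add: pos_divide_le_eq)
  have "t * t \<le> t * 1" using t by (intro mult_left_mono) auto
  then have Ut2: "U \<le> t" using U by simp
  have H0: "0 \<le> H" unfolding H_def by (rule wt_inner_nonneg)
  have ghu: "g = (\<lambda>x. h x + u x)" by (auto simp: u_def)
  have expand: "kac_form g g = kac_form h h + 2 * kac_form h u + kac_form u u"
    by (subst (1 2) ghu) (rule kac_form_add(1)[OF hL uL])
  have hh: "kac_form h h \<le> c * H"
    unfolding c_def H_def by (rule kac_form_lipschitz[OF h])
  have hu: "\<bar>kac_form h u\<bar> \<le> t * H + U / t"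
    unfolding H_def U_def by (rule abs_forms_le(2)[OF hL uL t(1)])
  have uu: "\<bar>kac_form u u\<bar> \<le> 1 * U + U / 1"
    unfolding U_def by (rule abs_forms_le(2)[OF uL uL]) simp
  have 1: "kac_form g g \<le> c * H + 2 * (t * H) + 4 * t"
    using expand hh hu uu Ut Ut2 by linarith
  have "G = H + 2 * wt_inner h u + U"
    unfolding G_def H_def U_def by (subst (1 2) ghu) (rule kac_form_add(2)[OF hL uL])
  moreover have "2 * \<bar>wt_inner h u\<bar> \<le> t * H + U / t"
    using abs_forms_le(1)[OF hL uL t(1)] unfolding H_def U_def by simp
  ultimately have HG: "H \<le> G + t * H + t" using Ut U by linarith
  have "t * H \<le> 1/2 * H" using t H0 by (intro mult_right_mono) auto
  then have H2: "H \<le> 2 * G + 1" using HG t by linarith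
  have "c * H \<le> c * (G + t * H + t)" using HG by (intro mult_left_mono) (simp_all add: c_def)
  also have "\<dots> \<le> c * G + (t * H + t)"
    using t H0 mult_right_mono[of c 1 "t * H + t"] by (simp add: c_def distrib_left)
  finally have "kac_form g g \<le> c * G + (3 * (t * H) + 5 * t)" using 1 by linarith
  also have "3 * (t * H) + 5 * t = t * (3 * H + 5)" by (simp add: algebra_simps)
  also have "\<dots> \<le> t * K" using H2 t unfolding K_def by (intro mult_left_mono) auto
  also have "\<dots> \<le> e" by (rule tK)
  finally show "kac_form g g \<le> 9127/12500 * wt_inner g g + e"
    by (simp add: c_def G_def)
qed

section \<open>The spectral gap\<close>

text \<open>Doob-Dynkin factorization. Level sets of simple functions are preimages under
  \<open>\<phi>\<close>, so simple functions factor. The pointwise limit of the factors is taken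
  with \<open>lim\<close>, which is measurable on all of \<open>N\<close>, also off the image of
  \<open>\<phi>\<close> where the sequence may diverge.\<close>

lemma vimage_algebra_factor:
  fixes f :: "'a \<Rightarrow> real"
  assumes f: "f \<in> borel_measurable (vimage_algebra X \<phi> N)" and \<phi>: "\<phi> \<in> X \<rightarrow> space N"
  obtains g where "g \<in> borel_measurable N" "\<And>x. x \<in> X \<Longrightarrow> f x = g (\<phi> x)"
proof -
  obtain F where F: "\<And>i. simple_function (vimage_algebra X \<phi> N) (F i)"
    "\<And>x. x \<in> space (vimage_algebra X \<phi> N) \<Longrightarrow> (\<lambda>i. F i x) \<longlonglongrightarrow> f x"
    using borel_measurable_implies_sequence_metric[OF f, of 0] by blast
  have "\<exists>B\<in>sets N. F i -` {y} \<inter> X = \<phi> -` B \<inter> X" for i y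
    using simple_functionD(2)[OF F(1), of i "{y}"] \<phi> by (auto simp: sets_vimage_algebra2)
  then obtain B where B: "\<And>i y. B i y \<in> sets N" "\<And>i y. F i -` {y} \<inter> X = \<phi> -` B i y \<inter> X"
    by metis
  define G where "G i z = (\<Sum>y\<in>F i ` X. y * indicator (B i y) z)" for i z
  have [measurable]: "G i \<in> borel_measurable N" for i
    unfolding G_def[abs_def] using B(1) by (intro borel_measurable_sum borel_measurable_times) auto
  have GF: "G i (\<phi> x) = F i x" if x: "x \<in> X" for i x
  proof -
    have fin: "finite (F i ` X)" using simple_functionD(1)[OF F(1), of i] by simp
    have "G i (\<phi> x) = (\<Sum>y\<in>F i ` X. y * indicator {F i x} y)"
      unfolding G_def
    proof (intro sum.cong refl arg_cong[where f = "(*) _"])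
      fix y
      have "\<phi> x \<in> B i y \<longleftrightarrow> F i x = y" using B(2)[of i y] x by blast
      then show "indicator (B i y) (\<phi> x) = (indicator {F i x} y :: real)" by (auto simp: indicator_def)
    qed
    also have "\<dots> = (\<Sum>y\<in>{F i x}. y * indicator {F i x} y)"
      using x by (intro sum.mono_neutral_right fin) (auto simp: indicator_def)
    finally show ?thesis by simp
  qed
  show thesis
  proof (rule that)
    show "(\<lambda>z. lim (\<lambda>i. G i z)) \<in> borel_measurable N" by (rule borel_measurable_lim_metric) simp
    show "f x = lim (\<lambda>i. G i (\<phi> x))" if "x \<in> X" for x
      using F(2)[of x] that by (simp add: GF limI)
  qed
qed

lemma kac_weight_rv: "kac_weight 3 (v $ k) = 3/2 * wt (rv k v)"
  by (simp add: kac_weight_3 wt_def rv_def power_mult_distrib power_divide)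

lemma sigma_finite_subalgebra_v: "sigma_finite_subalgebra sigma3 (sigma_alg_v k)"
proof -
  have "finite_measure_subalgebra sigma3 (sigma_alg_v k)"
    by (intro finite_measure_subalgebra.intro finite_measure_subalgebra_axioms.intro
        sigma3.finite_measure_axioms subalgebra_sigma_alg_v)
  then interpret finite_measure_subalgebra sigma3 "sigma_alg_v k" .
  show ?thesis ..
qed

lemma measurable_rv_sigma_alg: "rv k \<in> borel_measurable (sigma_alg_v k)"
proof -
  have "(\<lambda>v. v $ k) \<in> borel_measurable (sigma_alg_v k)"
    unfolding sigma_alg_v_def by (rule measurable_vimage_algebra1) simp
  then show ?thesis unfolding rv_def[abs_def] by measurable
qed

lemma P_cond_factor:
  obtains g where "g \<in> borel_measurable borel" "\<And>v. v \<in> state_space3 \<Longrightarrow> P_cond k f v = g (rv k v)"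
proof -
  have "P_cond k f \<in> borel_measurable (sigma_alg_v k)"
    unfolding P_cond_def by simp
  then have m: "P_cond k f \<in> borel_measurable (vimage_algebra state_space3 (\<lambda>v. v $ k) borel)"
    by (simp only: sigma_alg_v_def)
  have sp: "(\<lambda>v. v $ k) \<in> state_space3 \<rightarrow> space (borel :: (real^3) measure)" by simp
  obtain h where h: "h \<in> borel_measurable borel" "\<And>v. v \<in> state_space3 \<Longrightarrow> P_cond k f v = h (v $ k)"
    by (rule vimage_algebra_factor[OF m sp]) (rule that)
  show thesis
  proof (rule that)
    show "(\<lambda>x. h (sqrt 2 *\<^sub>R x)) \<in> borel_measurable borel" using h(1) by measurable
    show "P_cond k f v = h (sqrt 2 *\<^sub>R rv k v)" if "v \<in> state_space3" for v
      using h(2)[OF that] by (simp add: rv_def)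
  qed
qed

lemma P_cond_L2:
  assumes f: "f \<in> L2_sigma3"
  shows "integrable sigma3 f" "P_cond k f \<in> L2_sigma3"
proof -
  interpret sigma_finite_subalgebra sigma3 "sigma_alg_v k" by (rule sigma_finite_subalgebra_v)
  have [measurable]: "f \<in> borel_measurable sigma3" and f2: "integrable sigma3 (\<lambda>v. (f v)\<^sup>2)"
    using f by (auto simp: L2_sigma3_def)
  show fi: "integrable sigma3 f"
  proof (rule Bochner_Integration.integrable_bound[of _ "\<lambda>v. 1 + (f v)\<^sup>2"])
    have "\<bar>a\<bar> \<le> 1 + a\<^sup>2" for a :: real
      using abs_mult_le_weighted[of 1 1 a] zero_le_power2[of a] by simp
    then show "AE v in sigma3. norm (f v) \<le> norm (1 + (f v)\<^sup>2)"
      by (intro AE_I2) (simp add: order_trans[OF _ abs_ge_self])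
  qed (use f2 in simp_all)
  have "integrable sigma3 (\<lambda>v. (real_cond_exp sigma3 (sigma_alg_v k) f v)\<^sup>2)"
  proof (rule integrable_convex_cond_exp[where I = UNIV and q = "\<lambda>x. x\<^sup>2"])
    show "convex_on UNIV (\<lambda>x::real. x\<^sup>2)" by (rule convex_power2)
  qed (use fi f2 in auto)
  then show "P_cond k f \<in> L2_sigma3" by (simp add: L2_sigma3_def P_cond_def)
qed

lemma integrable_L2_mult:
  assumes "f \<in> L2_sigma3" "g \<in> L2_sigma3"
  shows "integrable sigma3 (\<lambda>v. f v * g v)"
proof (rule Bochner_Integration.integrable_bound[of _ "\<lambda>v. (f v)\<^sup>2 + (g v)\<^sup>2"])
  have "\<bar>a * b\<bar> \<le> a\<^sup>2 + b\<^sup>2" for a b :: real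
    using abs_mult_le_weighted[of 1 a b] zero_le_power2[of a] zero_le_power2[of b] by simp
  then show "AE v in sigma3. norm (f v * g v) \<le> norm ((f v)\<^sup>2 + (g v)\<^sup>2)"
    by (intro AE_I2) (simp add: order_trans[OF _ abs_ge_self])
qed (use assms in \<open>auto simp: L2_sigma3_def\<close>)

lemma wt_rv_mult_L2:
  assumes "f \<in> L2_sigma3"
  shows "(\<lambda>v. wt (rv k v) * f v) \<in> L2_sigma3"
  unfolding L2_sigma3_def
proof (intro CollectI conjI)
  have [measurable]: "f \<in> borel_measurable sigma3" using assms by (simp add: L2_sigma3_def)
  show "(\<lambda>v. wt (rv k v) * f v) \<in> borel_measurable sigma3" by measurable
  show "integrable sigma3 (\<lambda>v. (wt (rv k v) * f v)\<^sup>2)"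
  proof (rule Bochner_Integration.integrable_bound[of _ "\<lambda>v. (f v)\<^sup>2"])
    show "AE v in sigma3. norm ((wt (rv k v) * f v)\<^sup>2) \<le> norm ((f v)\<^sup>2)"
    proof (rule AE_I2)
      fix v assume "v \<in> space sigma3"
      then have "norm (rv k v) \<le> 1" by (simp add: space_sigma3 norm_rv_le)
      then have "(wt (rv k v))\<^sup>2 \<le> 1" using wt_bounds by (simp add: power_le_one)
      then show "norm ((wt (rv k v) * f v)\<^sup>2) \<le> norm ((f v)\<^sup>2)"
        by (simp add: power_mult_distrib mult_left_le_one_le)
    qed
  qed (use assms in \<open>auto simp: L2_sigma3_def\<close>)
qed

text \<open>With \<open>G = 1/2 (s\<^sub>1 P\<^sub>1 f + s\<^sub>2 P\<^sub>2 f + s\<^sub>3 P\<^sub>3 f)\<close> and \<open>\<tau> = \<langle>f, G\<rangle>\<close> it suffices that \<open>\<parallel>G\<parallel>\<^sup>2 \<le> c \<tau>\<close>. Splitting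
  \<open>P\<^sub>k f = g\<^sub>k(v\<^sub>k)\<close> into the mean of the three functions \<open>g\<^sub>k\<close> and the deviations from it, the mean is
  controlled by the spectral bound and the deviations by the arithmetic-geometric mean inequality.\<close>

lemma sum_P_cond_bound:
  assumes f: "f \<in> L2_sigma3" and mean0: "(\<integral>v. f v \<partial>sigma3) = 0"
  shows "1/2 * (\<Sum>k\<in>UNIV. \<integral>v. wt (rv k v) * (f v * P_cond k f v) \<partial>sigma3)
    \<le> 9127/12500 * (\<integral>v. (f v)\<^sup>2 \<partial>sigma3)"
proof -
  define c :: real where "c = 9127/12500"
  define p where "p k = P_cond k f" for k
  have "\<exists>g. g \<in> borel_measurable borel \<and> (\<forall>v\<in>state_space3. p k v = g (rv k v))" for k
    unfolding p_def by (metis P_cond_factor[of k f])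
  then obtain g where g [measurable]: "\<And>k. g k \<in> borel_measurable borel"
    and pg: "\<And>k v. v \<in> state_space3 \<Longrightarrow> p k v = g k (rv k v)"
    by metis
  have pL2: "p k \<in> L2_sigma3" for k unfolding p_def by (rule P_cond_L2[OF f])
  have [measurable]: "p k \<in> borel_measurable sigma3" "f \<in> borel_measurable sigma3" for k
    using pL2[of k] f by (simp_all add: L2_sigma3_def)
  note L2 = integrable_L2_mult wt_rv_mult_L2 f pL2
  have cong: "(\<integral>v. F v \<partial>sigma3) = (\<integral>v. H v \<partial>sigma3)" "integrable sigma3 F \<longleftrightarrow> integrable sigma3 H"
    if "\<And>v. v \<in> state_space3 \<Longrightarrow> F v = H v" for F H :: "real^3^3 \<Rightarrow> real"
    using Bochner_Integration.integral_cong[of sigma3 sigma3 F H] Bochner_Integration.integrable_cong[of sigma3 sigma3 F H] that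
    by (auto simp: space_sigma3)
  have tr: "(\<integral>v. F (rv k v) \<partial>sigma3) = (\<integral>x. F x \<partial>mu)" "integrable sigma3 (\<lambda>v. F (rv k v)) \<longleftrightarrow> integrable mu F"
    if [measurable]: "F \<in> borel_measurable borel" for F :: "real^3 \<Rightarrow> real" and k
    using integral_distr[of "rv k" sigma3 borel F] integrable_distr_eq[of "rv k" sigma3 borel F]
    by (simp_all add: distr_rv)
  have tr2: "(\<integral>v. F (rv j v, rv k v) \<partial>sigma3) = (\<integral>q. F q \<partial>pair_law)"
    if "j \<noteq> k" and [measurable]: "F \<in> borel_measurable (borel \<Otimes>\<^sub>M borel)" for F :: "(real^3) \<times> (real^3) \<Rightarrow> real" and j k
    unfolding distr_rv_pair[OF that(1), symmetric] by (simp add: integral_distr)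
  have gL2: "wt_L2 (g k)" for k
    unfolding wt_L2_def
  proof
    have "integrable sigma3 (\<lambda>v. (wt (rv k v) * p k v) * p k v)" by (intro L2)
    then have "integrable sigma3 (\<lambda>v. wt (rv k v) * (g k (rv k v))\<^sup>2)"
      by (subst (asm) cong(2)[of _ "\<lambda>v. wt (rv k v) * (g k (rv k v))\<^sup>2"]) (simp_all add: pg power2_eq_square mult.assoc)
    then show "integrable mu (\<lambda>x. wt x * (g k x)\<^sup>2)"
      using tr(2)[of "\<lambda>x. wt x * (g k x)\<^sup>2" k] by simp
  qed simp
  \<comment> \<open>\<open>wt (rv k v) * p k v\<close> is measurable with respect to the velocity of
    particle \<open>k\<close>, so \<open>f\<close> may be replaced by its conditional expectation
    under the integral.\<close>
  have N: "(\<integral>v. wt (rv k v) * (f v * p k v) \<partial>sigma3) = wt_inner (g k) (g k)"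
    and mean_k: "(\<integral>v. wt (rv k v) * f v \<partial>sigma3) = wt_inner (\<lambda>_. 1) (g k)" for k
  proof -
    interpret sigma_finite_subalgebra sigma3 "sigma_alg_v k" by (rule sigma_finite_subalgebra_v)
    note [measurable] = measurable_rv_sigma_alg
    have pm [measurable]: "p k \<in> borel_measurable (sigma_alg_v k)" by (simp add: p_def P_cond_def)
    have "(\<integral>v. wt (rv k v) * (f v * p k v) \<partial>sigma3) = (\<integral>v. (wt (rv k v) * p k v) * f v \<partial>sigma3)"
      by (simp add: mult_ac)
    also have "\<dots> = (\<integral>v. (wt (rv k v) * p k v) * p k v \<partial>sigma3)"
      unfolding p_def[of k] P_cond_def
      by (rule real_cond_exp_intg(2)[symmetric]) (use L2(1)[OF L2(2)[OF pL2[of k]] f] in \<open>auto simp: p_def P_cond_def\<close>)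
    also have "\<dots> = (\<integral>v. wt (rv k v) * g k (rv k v) * g k (rv k v) \<partial>sigma3)"
      by (rule cong) (simp add: pg)
    also have "\<dots> = wt_inner (g k) (g k)"
      unfolding wt_inner_def by (rule tr(1)[of "\<lambda>x. wt x * g k x * g k x"]) measurable
    finally show "(\<integral>v. wt (rv k v) * (f v * p k v) \<partial>sigma3) = wt_inner (g k) (g k)" .
    have "(\<lambda>v. 1) \<in> L2_sigma3" by (simp add: L2_sigma3_def)
    then have "integrable sigma3 (\<lambda>v. wt (rv k v) * f v)"
      using L2(1)[OF L2(2)[of "\<lambda>_. 1" k] f] by simp
    then have "(\<integral>v. wt (rv k v) * f v \<partial>sigma3) = (\<integral>v. wt (rv k v) * p k v \<partial>sigma3)"
      unfolding p_def P_cond_def by (intro real_cond_exp_intg(2)[symmetric]) measurable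
    also have "\<dots> = (\<integral>v. wt (rv k v) * 1 * g k (rv k v) \<partial>sigma3)"
      by (rule cong) (simp add: pg)
    also have "\<dots> = wt_inner (\<lambda>_. 1) (g k)"
      unfolding wt_inner_def by (rule tr(1)[of "\<lambda>x. wt x * 1 * g k x"]) measurable
    finally show "(\<integral>v. wt (rv k v) * f v \<partial>sigma3) = wt_inner (\<lambda>_. 1) (g k)" .
  qed
  define \<tau> where "\<tau> = 1/2 * (\<Sum>k\<in>UNIV. wt_inner (g k) (g k))"
  define G where "G v = 1/2 * (\<Sum>k\<in>UNIV. wt (rv k v) * p k v)" for v

  define gm where "gm x = (g 1 x + g 2 x + g 3 x) / 3" for x
  define gd where "gd k x = g k x - gm x" for k x
  have gmL2: "wt_L2 gm"
  proof -
    have "wt_L2 (\<lambda>x. 1/3 * g 1 x + (1/3 * g 2 x + (1/3 * g 3 x + 0)))"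
      by (intro wt_L2_add_scale gL2 wt_L2_bounded[of _ 0]) auto
    also have "(\<lambda>x. 1/3 * g 1 x + (1/3 * g 2 x + (1/3 * g 3 x + 0))) = gm"
      by (rule ext) (simp add: gm_def)
    finally show ?thesis .
  qed
  have gdL2: "wt_L2 (gd k)" for k
  proof -
    have "(\<lambda>x. -1 * gm x + g k x) = gd k" by (rule ext) (simp add: gd_def)
    then show ?thesis using wt_L2_add_scale[OF gmL2 gL2[of k], of "-1"] by (simp only:)
  qed
  \<comment> \<open>The sum of \<open>wt (rv k v)\<close> over \<open>k\<close> is the constant
    \<open>3/2\<close>, so the three weighted means add up to \<open>3/2\<close> times the mean of
    \<open>f\<close>. This is the sole place where the mean of \<open>f\<close> is used.\<close>
  have gm_mean: "wt_inner (\<lambda>_. 1) gm = 0"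
  proof -
    have one: "wt_L2 (\<lambda>_. 1)" by (rule wt_L2_bounded[of _ 1]) auto
    have i: "integrable mu (\<lambda>x. wt x * 1 * g k x)" for k by (rule wt_L2_inner(1)[OF one gL2])
    have "3 * wt_inner (\<lambda>_. 1) gm = (\<integral>x. wt x * 1 * g 1 x + wt x * 1 * g 2 x + wt x * 1 * g 3 x \<partial>mu)"
    proof -
      have "3 * wt_inner (\<lambda>_. 1) gm = (\<integral>x. 3 * (wt x * 1 * gm x) \<partial>mu)" by (simp add: wt_inner_def)
      also have "\<dots> = (\<integral>x. wt x * 1 * g 1 x + wt x * 1 * g 2 x + wt x * 1 * g 3 x \<partial>mu)"
        by (rule Bochner_Integration.integral_cong) (simp_all add: gm_def field_simps)
      finally show ?thesis .
    qed
    also have "\<dots> = (\<Sum>k\<in>UNIV. wt_inner (\<lambda>_. 1) (g k))"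
      using i by (simp add: wt_inner_def sum_3)
    also have "\<dots> = (\<integral>v. (\<Sum>k\<in>UNIV. wt (rv k v) * f v) \<partial>sigma3)"
    proof (subst Bochner_Integration.integral_sum)
      fix k
      have "(\<lambda>v. 1) \<in> L2_sigma3" by (simp add: L2_sigma3_def)
      then show "integrable sigma3 (\<lambda>v. wt (rv k v) * f v)"
        using L2(1)[OF L2(2)[of "\<lambda>_. 1" k] f] by simp
    qed (simp add: mean_k)
    also have "\<dots> = (\<integral>v. 3/2 * f v \<partial>sigma3)"
      by (rule cong) (simp add: wt_rv_sum flip: sum_distrib_right)
    finally show ?thesis using mean0 by simp
  qed
  have N_split: "(\<Sum>k\<in>UNIV. wt_inner (g k) (g k)) = 3 * wt_inner gm gm + (\<Sum>k\<in>UNIV. wt_inner (gd k) (gd k))"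
  proof -
    have "(\<Sum>k\<in>UNIV. wt_inner (g k) (g k)) = (\<integral>x. wt x * g 1 x * g 1 x + wt x * g 2 x * g 2 x + wt x * g 3 x * g 3 x \<partial>mu)"
      using wt_L2_inner(1)[OF gL2 gL2] by (simp add: wt_inner_def sum_3)
    also have "\<dots> = (\<integral>x. 3 * (wt x * gm x * gm x) + (wt x * gd 1 x * gd 1 x + wt x * gd 2 x * gd 2 x + wt x * gd 3 x * gd 3 x) \<partial>mu)"
      by (rule Bochner_Integration.integral_cong) (simp_all add: gd_def gm_def field_simps)
    also have "\<dots> = 3 * wt_inner gm gm + (\<Sum>k\<in>UNIV. wt_inner (gd k) (gd k))"
      using wt_L2_inner(1)[OF gdL2 gdL2] wt_L2_inner(1)[OF gmL2 gmL2] by (simp add: wt_inner_def sum_3)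
    finally show ?thesis .
  qed
  have D_split: "(\<Sum>k\<in>UNIV. diag_form (g k) (g k)) = 3 * diag_form gm gm + (\<Sum>k\<in>UNIV. diag_form (gd k) (gd k))"
  proof -
    have "(\<Sum>k\<in>UNIV. diag_form (g k) (g k)) = (\<integral>x. (wt x)\<^sup>2 * g 1 x * g 1 x + (wt x)\<^sup>2 * g 2 x * g 2 x + (wt x)\<^sup>2 * g 3 x * g 3 x \<partial>mu)"
      using wt_L2_inner(2)[OF gL2 gL2] by (simp add: diag_form_def sum_3)
    also have "\<dots> = (\<integral>x. 3 * ((wt x)\<^sup>2 * gm x * gm x) + ((wt x)\<^sup>2 * gd 1 x * gd 1 x + (wt x)\<^sup>2 * gd 2 x * gd 2 x + (wt x)\<^sup>2 * gd 3 x * gd 3 x) \<partial>mu)"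
      by (rule Bochner_Integration.integral_cong) (simp_all add: gd_def gm_def field_simps)
    also have "\<dots> = 3 * diag_form gm gm + (\<Sum>k\<in>UNIV. diag_form (gd k) (gd k))"
      using wt_L2_inner(2)[OF gdL2 gdL2] wt_L2_inner(2)[OF gmL2 gmL2] by (simp add: diag_form_def sum_3)
    finally show ?thesis .
  qed
  \<comment> \<open>The mixed terms are the square of the sum minus the sum of the squares. As the
    deviations add up to zero, the mean contributes \<open>9 - 3 = 6\<close> cross forms and each
    deviation contributes minus one.\<close>
  have A_split: "2 * (cross_form (g 1) (g 2) + cross_form (g 1) (g 3) + cross_form (g 2) (g 3)) =
      6 * cross_form gm gm - (\<Sum>k\<in>UNIV. cross_form (gd k) (gd k))"
  proof -
    define W where "W q = wt (fst q) * wt (snd q)" for q :: "(real^3) \<times> (real^3)"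
    note i = wt_L2_cross(1)[folded W_def]
    have "2 * (cross_form (g 1) (g 2) + cross_form (g 1) (g 3) + cross_form (g 2) (g 3)) =
        cross_form (g 1) (g 2) + cross_form (g 2) (g 1) + (cross_form (g 1) (g 3) + cross_form (g 3) (g 1))
        + (cross_form (g 2) (g 3) + cross_form (g 3) (g 2))"
      using cross_form_commute[OF gL2 gL2] by simp
    also have "\<dots> = (\<integral>q. W q * (g 1 (fst q) * g 2 (snd q)) + W q * (g 2 (fst q) * g 1 (snd q)) +
        (W q * (g 1 (fst q) * g 3 (snd q)) + W q * (g 3 (fst q) * g 1 (snd q))) +
        (W q * (g 2 (fst q) * g 3 (snd q)) + W q * (g 3 (fst q) * g 2 (snd q))) \<partial>pair_law)"
      using i[OF gL2 gL2] by (simp add: cross_form_def W_def[symmetric])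
    also have "\<dots> = (\<integral>q. 6 * (W q * (gm (fst q) * gm (snd q))) - (W q * (gd 1 (fst q) * gd 1 (snd q))
        + W q * (gd 2 (fst q) * gd 2 (snd q)) + W q * (gd 3 (fst q) * gd 3 (snd q))) \<partial>pair_law)"
      by (rule Bochner_Integration.integral_cong) (simp_all add: gd_def gm_def field_simps)
    also have "\<dots> = 6 * cross_form gm gm - (\<Sum>k\<in>UNIV. cross_form (gd k) (gd k))"
      using i[OF gdL2 gdL2] i[OF gmL2 gmL2] by (simp add: cross_form_def W_def[symmetric] sum_3)
    finally show ?thesis .
  qed
  have GL2: "G \<in> L2_sigma3" and fG: "(\<integral>v. f v * G v \<partial>sigma3) = \<tau>"
    and GG: "(\<integral>v. (G v)\<^sup>2 \<partial>sigma3) = 1/4 * ((\<Sum>k\<in>UNIV. diag_form (g k) (g k)) +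
      2 * (cross_form (g 1) (g 2) + cross_form (g 1) (g 3) + cross_form (g 2) (g 3)))"
  proof -
    define q where "q k v = wt (rv k v) * p k v" for k v
    have qL2: "q k \<in> L2_sigma3" for k unfolding q_def[abs_def] by (intro L2)
    note ii = integrable_L2_mult[OF qL2 qL2]
    have G_q: "G v = (q 1 v + q 2 v + q 3 v) / 2" for v by (simp add: G_def q_def sum_3)
    have Gsq: "(G v)\<^sup>2 = 1/4 * (q 1 v * q 1 v + q 2 v * q 2 v + q 3 v * q 3 v +
        2 * (q 1 v * q 2 v + q 1 v * q 3 v + q 2 v * q 3 v))" for v
      by (simp add: G_q power2_eq_square field_simps)
    have [measurable]: "q k \<in> borel_measurable sigma3" for k using qL2[of k] by (simp add: L2_sigma3_def)
    have "integrable sigma3 (\<lambda>v. (G v)\<^sup>2)" unfolding Gsq using ii by simp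
    moreover have "G \<in> borel_measurable sigma3" unfolding G_q[abs_def] by measurable
    ultimately show "G \<in> L2_sigma3" by (simp add: L2_sigma3_def)
    have fq: "integrable sigma3 (\<lambda>v. f v * q k v)" "(\<integral>v. f v * q k v \<partial>sigma3) = wt_inner (g k) (g k)" for k
      using integrable_L2_mult[OF f qL2[of k]] N[of k] by (simp_all add: q_def mult_ac)
    have "(\<integral>v. f v * G v \<partial>sigma3) = (\<integral>v. 1/2 * (f v * q 1 v + f v * q 2 v + f v * q 3 v) \<partial>sigma3)"
      by (rule Bochner_Integration.integral_cong) (simp_all add: G_q field_simps)
    then show "(\<integral>v. f v * G v \<partial>sigma3) = \<tau>"
      using fq by (simp add: \<tau>_def sum_3)
    have qq: "(\<integral>v. q k v * q k v \<partial>sigma3) = diag_form (g k) (g k)" for k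
    proof -
      have "(\<integral>v. q k v * q k v \<partial>sigma3) = (\<integral>v. (wt (rv k v))\<^sup>2 * g k (rv k v) * g k (rv k v) \<partial>sigma3)"
        by (rule cong) (simp add: q_def pg power2_eq_square mult_ac)
      also have "\<dots> = diag_form (g k) (g k)"
        unfolding diag_form_def by (rule tr(1)[of "\<lambda>x. (wt x)\<^sup>2 * g k x * g k x"]) measurable
      finally show ?thesis .
    qed
    have qjk: "(\<integral>v. q j v * q k v \<partial>sigma3) = cross_form (g j) (g k)" if "j \<noteq> k" for j k
    proof -
      have "(\<integral>v. q j v * q k v \<partial>sigma3) = (\<integral>v. wt (rv j v) * wt (rv k v) * (g j (rv j v) * g k (rv k v)) \<partial>sigma3)"
        by (rule cong) (simp add: q_def pg mult_ac)
      also have "\<dots> = cross_form (g j) (g k)"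
        unfolding cross_form_def
        using tr2[OF that, of "\<lambda>q. wt (fst q) * wt (snd q) * (g j (fst q) * g k (snd q))"] by simp
      finally show ?thesis .
    qed
    have ne: "(1::3) \<noteq> 2" "(1::3) \<noteq> 3" "(2::3) \<noteq> 3" by simp_all
    show "(\<integral>v. (G v)\<^sup>2 \<partial>sigma3) = 1/4 * ((\<Sum>k\<in>UNIV. diag_form (g k) (g k)) +
      2 * (cross_form (g 1) (g 2) + cross_form (g 1) (g 3) + cross_form (g 2) (g 3)))"
      unfolding Gsq qjk[OF ne(1), symmetric] qjk[OF ne(2), symmetric] qjk[OF ne(3), symmetric] qq[symmetric] sum_3
      using ii by simp
  qed
  \<comment> \<open>The left side is at most \<open>1/2 * diag_form + 3/4 * wt_inner\<close>, hence
    at most \<open>5/4 * wt_inner\<close>, well below \<open>2 * c\<close>.\<close>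
  have gd_bound: "diag_form (gd k) (gd k) - cross_form (gd k) (gd k) \<le> 2 * c * wt_inner (gd k) (gd k)" for k
    using minus_cross_form_le[OF gdL2[of k]] diag_form_le[OF gdL2[of k]] wt_inner_nonneg[of "gd k"]
    by (simp add: c_def)
  \<comment> \<open>\<open>3 * diag_form + 6 * cross_form\<close> is six times
    \<open>kac_form\<close>; this is where the diagonal coefficient \<open>1/2\<close> of the
    operator originates.\<close>
  have gm_bound: "3 * diag_form gm gm + 6 * cross_form gm gm \<le> 6 * c * wt_inner gm gm"
    using kac_form_spectral_bound[OF gmL2 gm_mean] by (simp add: kac_form_def c_def)
  have GG_le: "(\<integral>v. (G v)\<^sup>2 \<partial>sigma3) \<le> c * \<tau>"
  proof -
    have "4 * (\<integral>v. (G v)\<^sup>2 \<partial>sigma3) = (3 * diag_form gm gm + 6 * cross_form gm gm) +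
        (\<Sum>k\<in>UNIV. diag_form (gd k) (gd k) - cross_form (gd k) (gd k))"
      unfolding GG D_split A_split by (simp add: sum_subtractf)
    also have "\<dots> \<le> 6 * c * wt_inner gm gm + (\<Sum>k\<in>UNIV. 2 * c * wt_inner (gd k) (gd k))"
      by (intro add_mono gm_bound sum_mono gd_bound)
    also have "\<dots> = 2 * c * (\<Sum>k\<in>UNIV. wt_inner (g k) (g k))"
      unfolding N_split by (simp add: sum_distrib_left distrib_left)
    also have "\<dots> = 4 * (c * \<tau>)" by (simp add: \<tau>_def)
    finally show ?thesis by simp
  qed
  have fGi: "integrable sigma3 (\<lambda>v. f v * G v)" by (rule integrable_L2_mult[OF f GL2])
  \<comment> \<open>Duality without division by the norm of \<open>G\<close>: expanding gives
    \<open>2 * c * \<tau> \<le> c^2 * \<parallel>f\<parallel>^2 + \<parallel>G\<parallel>^2\<close>,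
    and \<open>\<parallel>G\<parallel>^2 \<le> c * \<tau>\<close> cancels half of the left
    side.\<close>
  have "0 \<le> (\<integral>v. (c * f v - G v)\<^sup>2 \<partial>sigma3)" by simp
  also have "(\<lambda>v. (c * f v - G v)\<^sup>2) = (\<lambda>v. c\<^sup>2 * (f v)\<^sup>2 - 2 * c * (f v * G v) + (G v)\<^sup>2)"
    by (auto simp: power2_eq_square algebra_simps)
  also have "(\<integral>v. c\<^sup>2 * (f v)\<^sup>2 - 2 * c * (f v * G v) + (G v)\<^sup>2 \<partial>sigma3) =
      c\<^sup>2 * (\<integral>v. (f v)\<^sup>2 \<partial>sigma3) - 2 * c * \<tau> + (\<integral>v. (G v)\<^sup>2 \<partial>sigma3)"
    using f GL2 fGi fG by (simp add: L2_sigma3_def)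
  finally have "c * \<tau> \<le> c * (c * (\<integral>v. (f v)\<^sup>2 \<partial>sigma3))"
    using GG_le by (simp add: power2_eq_square mult.assoc)
  then have "\<tau> \<le> c * (\<integral>v. (f v)\<^sup>2 \<partial>sigma3)" by (simp add: c_def)
  then show ?thesis
    using N by (simp add: \<tau>_def c_def p_def)
qed

lemma integrable_wt_rv_L2:
  assumes f: "f \<in> L2_sigma3"
  shows "integrable sigma3 (\<lambda>v. wt (rv k v) * (f v)\<^sup>2)" "integrable sigma3 (\<lambda>v. wt (rv k v) * (f v * P_cond k f v))"
  using integrable_L2_mult[OF wt_rv_mult_L2[OF f, of k] f]
    integrable_L2_mult[OF wt_rv_mult_L2[OF f, of k] P_cond_L2(2)[OF f, of k]]
  by (simp_all add: power2_eq_square mult.assoc)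

lemma sum_wt_rv_L2:
  assumes f: "f \<in> L2_sigma3"
  shows "(\<Sum>k\<in>UNIV. \<integral>v. wt (rv k v) * (f v)\<^sup>2 \<partial>sigma3) = 3/2 * (\<integral>v. (f v)\<^sup>2 \<partial>sigma3)"
proof -
  have "(\<Sum>k\<in>UNIV. \<integral>v. wt (rv k v) * (f v)\<^sup>2 \<partial>sigma3) = (\<integral>v. (\<Sum>k\<in>UNIV. wt (rv k v) * (f v)\<^sup>2) \<partial>sigma3)"
    using integrable_wt_rv_L2(1)[OF f] by simp
  also have "\<dots> = (\<integral>v. 3/2 * (f v)\<^sup>2 \<partial>sigma3)"
    by (rule Bochner_Integration.integral_cong) (simp_all add: space_sigma3 wt_rv_sum flip: sum_distrib_right)
  finally show ?thesis by simp
qed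

text \<open>The prefactor \<open>1/3\<close> and \<open>kac_weight 3 = 3/2 * wt\<close> combine to
  \<open>1/2\<close>. The constant sum of the weights then gives \<open>3/4\<close> for the term
  with \<open>(f v)^2\<close>, and \<open>3/4 - 9127/12500 = 0.01984\<close>.\<close>

lemma kac_dirichlet_form_bound:
  assumes f: "f \<in> L2_sigma3" and mean0: "(\<integral>v. f v \<partial>sigma3) = 0"
  shows "(1/3) * (\<Sum>k\<in>UNIV. \<integral>v. kac_weight 3 (v $ k) * ((f v)\<^sup>2 - f v * P_cond k f v) \<partial>sigma3)
    \<ge> 0.01984 * (\<integral>v. (f v)\<^sup>2 \<partial>sigma3)"
proof -
  define A B where "A k = (\<integral>v. wt (rv k v) * (f v)\<^sup>2 \<partial>sigma3)"
    and "B k = (\<integral>v. wt (rv k v) * (f v * P_cond k f v) \<partial>sigma3)" for k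
  have eq: "(\<integral>v. kac_weight 3 (v $ k) * ((f v)\<^sup>2 - f v * P_cond k f v) \<partial>sigma3) =
      3/2 * ((\<integral>v. wt (rv k v) * (f v)\<^sup>2 \<partial>sigma3) - (\<integral>v. wt (rv k v) * (f v * P_cond k f v) \<partial>sigma3))" for k
  proof -
    have "kac_weight 3 (v $ k) * ((f v)\<^sup>2 - f v * P_cond k f v) =
        3/2 * (wt (rv k v) * (f v)\<^sup>2 - wt (rv k v) * (f v * P_cond k f v))" for v
      by (simp add: kac_weight_rv algebra_simps)
    then have "(\<integral>v. kac_weight 3 (v $ k) * ((f v)\<^sup>2 - f v * P_cond k f v) \<partial>sigma3) =
        (\<integral>v. 3/2 * (wt (rv k v) * (f v)\<^sup>2 - wt (rv k v) * (f v * P_cond k f v)) \<partial>sigma3)"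
      by (simp only:)
    then show ?thesis using integrable_wt_rv_L2[OF f, of k] by simp
  qed
  have "(1/3) * (\<Sum>k\<in>UNIV. \<integral>v. kac_weight 3 (v $ k) * ((f v)\<^sup>2 - f v * P_cond k f v) \<partial>sigma3) =
      1/2 * (\<Sum>k\<in>UNIV. \<integral>v. wt (rv k v) * (f v)\<^sup>2 \<partial>sigma3)
      - 1/2 * (\<Sum>k\<in>UNIV. \<integral>v. wt (rv k v) * (f v * P_cond k f v) \<partial>sigma3)"
    unfolding eq by (simp add: sum_3 algebra_simps flip: A_def B_def)
  then show ?thesis
    using sum_P_cond_bound[OF f mean0] unfolding sum_wt_rv_L2[OF f] by simp
qed

lemma conj_kac_gen_inner:
  assumes f: "f \<in> L2_sigma3"
  shows "- inner_sigma3 f (conj_kac_gen f) =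
    (1/3) * (\<Sum>k\<in>UNIV. \<integral>v. kac_weight 3 (v $ k) * ((f v)\<^sup>2 - f v * P_cond k f v) \<partial>sigma3)"
proof -
  have i: "integrable sigma3 (\<lambda>v. kac_weight 3 (v $ k) * ((f v)\<^sup>2 - f v * P_cond k f v))" for k
  proof -
    have "integrable sigma3 (\<lambda>v. 3/2 * (wt (rv k v) * (f v)\<^sup>2 - wt (rv k v) * (f v * P_cond k f v)))"
      using integrable_wt_rv_L2[OF f, of k] by simp
    then show ?thesis by (simp add: kac_weight_rv right_diff_distrib mult.assoc)
  qed
  have "- inner_sigma3 f (conj_kac_gen f) =
      (\<integral>v. 1/3 * (\<Sum>k\<in>UNIV. kac_weight 3 (v $ k) * ((f v)\<^sup>2 - f v * P_cond k f v)) \<partial>sigma3)"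
    unfolding inner_sigma3_def integral_minus[symmetric]
    by (rule Bochner_Integration.integral_cong) (simp_all add: conj_kac_gen_def sum_3 power2_eq_square field_simps)
  then show ?thesis using i by simp
qed

text \<open>The infimum over the reals is meaningful for a nonempty set. A coordinate of one
  velocity has mean zero under \<open>v \<mapsto> - v\<close>, and some coordinate has positive
  second moment because the mean of \<open>(norm (rv 3 v))^2\<close> is \<open>1/2\<close>.\<close>

lemma ex_L2_normalized:
  obtains f where "f \<in> L2_sigma3" "(\<integral>v. f v \<partial>sigma3) = 0" "(\<integral>v. f v * f v \<partial>sigma3) = 1"
proof -
  define x where "x i v = rv 3 v $ i" for i v
  have x2: "(\<Sum>i\<in>UNIV. (x i v)\<^sup>2) = (norm (rv 3 v))\<^sup>2" for v
    unfolding x_def power2_norm_eq_inner inner_vec_def by (simp add: power2_eq_square)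
  have [measurable]: "x i \<in> borel_measurable sigma3" for i
  proof -
    have "(\<lambda>y :: real^3. y $ i) \<in> borel_measurable borel"
      by (intro borel_measurable_continuous_onI continuous_intros)
    from measurable_compose[OF measurable_rv this] show ?thesis by (simp add: x_def[abs_def])
  qed
  have xb: "(x i v)\<^sup>2 \<le> 1" if "v \<in> state_space3" for i v
  proof -
    have "(x i v)\<^sup>2 \<le> (\<Sum>i\<in>UNIV. (x i v)\<^sup>2)" by (intro member_le_sum) auto
    also have "\<dots> \<le> 1" unfolding x2 using norm_rv_le[OF that, of 3] by (simp add: power_le_one)
    finally show ?thesis .
  qed
  have xi: "integrable sigma3 (\<lambda>v. (x i v)\<^sup>2)" for i
    by (rule sigma3.integrable_const_bound[of _ 1]) (auto intro!: AE_I2 xb simp: space_sigma3)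
  have "(\<Sum>i\<in>UNIV. \<integral>v. (x i v)\<^sup>2 \<partial>sigma3) = (\<integral>v. (norm (rv 3 v))\<^sup>2 \<partial>sigma3)"
    using xi by (simp flip: x2)
  also have "\<dots> = (\<integral>y. (norm y)\<^sup>2 \<partial>mu)"
    unfolding mu_def by (simp add: integral_distr)
  also have "\<dots> = (\<integral>y. 1 - wt y \<partial>mu)" by (simp add: wt_def)
  also have "\<dots> = 1/2"
  proof -
    have "integrable mu wt"
      by (rule mu.integrable_const_bound[of _ 1]) (use AE_mu wt_bounds in \<open>auto elim!: eventually_mono\<close>)
    then show ?thesis using mu.prob_space by (simp add: integral_wt_mu)
  qed
  finally have "(\<Sum>i\<in>UNIV. \<integral>v. (x i v)\<^sup>2 \<partial>sigma3) \<noteq> 0" by simp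
  then obtain i where ne: "(\<integral>v. (x i v)\<^sup>2 \<partial>sigma3) \<noteq> 0" by (metis sum.neutral)
  define c where "c = (\<integral>v. (x i v)\<^sup>2 \<partial>sigma3)"
  have c: "0 < c" using ne by (simp add: c_def less_le)
  have mean: "(\<integral>v. x i v \<partial>sigma3) = 0"
  proof -
    have o: "orthogonal_transformation (uminus :: real^3^3 \<Rightarrow> _)"
      by (simp add: orthogonal_transformation_def linear_iff)
    have d: "distr sigma3 sigma3 uminus = sigma3"
      by (rule sigma3_rotation_invariant[OF o]) (auto simp: momentum_space_def sum_negf)
    have m: "uminus \<in> measurable sigma3 sigma3"
      unfolding measurable_cong_sets[OF sets_sigma3 sets_sigma3]
      by (intro measurable_restrict_space3) (auto simp: state_space3_def sum_negf)
    have "(\<integral>v. x i v \<partial>sigma3) = (\<integral>v. x i v \<partial>distr sigma3 sigma3 uminus)" by (simp only: d)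
    also have "\<dots> = (\<integral>v. x i (- v) \<partial>sigma3)" by (rule integral_distr[OF m]) simp
    also have "\<dots> = - (\<integral>v. x i v \<partial>sigma3)" by (simp add: x_def rv_def)
    finally show ?thesis by simp
  qed
  show thesis
  proof (rule that)
    show "(\<lambda>v. x i v / sqrt c) \<in> L2_sigma3" using xi by (simp add: L2_sigma3_def power_divide)
    show "(\<integral>v. x i v / sqrt c \<partial>sigma3) = 0" using mean by simp
    show "(\<integral>v. x i v / sqrt c * (x i v / sqrt c) \<partial>sigma3) = 1"
    proof -
      have "x i v / sqrt c * (x i v / sqrt c) = (x i v)\<^sup>2 / c" for v
        using c by (simp add: power2_eq_square)
      then have "(\<integral>v. x i v / sqrt c * (x i v / sqrt c) \<partial>sigma3) = (\<integral>v. (x i v)\<^sup>2 / c \<partial>sigma3)"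
        by (simp only:)
      also have "\<dots> = 1" using c by (simp add: c_def[symmetric])
      finally show ?thesis .
    qed
  qed
qed

theorem theorem2p1:
  shows "conj_kac_gap \<ge> 0.01984 \<and>
    (\<forall>f \<in> L2_sigma3. (\<integral>v. f v \<partial>sigma3) = 0 \<longrightarrow>
      (1/3) * (\<Sum>k\<in>UNIV. \<integral>v. kac_weight 3 (v $ k) * ((f v)\<^sup>2 - f v * P_cond k f v) \<partial>sigma3)
        \<ge> 0.01984 * (\<integral>v. (f v)\<^sup>2 \<partial>sigma3))"
proof (intro conjI ballI impI)
  show "conj_kac_gap \<ge> 0.01984"
    unfolding conj_kac_gap_def
  proof (rule cInf_greatest)
    obtain f where "f \<in> L2_sigma3" "(\<integral>v. f v \<partial>sigma3) = 0" "(\<integral>v. f v * f v \<partial>sigma3) = 1"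
      by (rule ex_L2_normalized)
    then show "{- inner_sigma3 f (conj_kac_gen f) | f.
       f \<in> L2_sigma3 \<and> inner_sigma3 f (\<lambda>_. 1) = 0 \<and> sqrt (inner_sigma3 f f) = 1} \<noteq> {}"
      by (auto simp: inner_sigma3_def)
  next
    fix y assume "y \<in> {- inner_sigma3 f (conj_kac_gen f) | f.
       f \<in> L2_sigma3 \<and> inner_sigma3 f (\<lambda>_. 1) = 0 \<and> sqrt (inner_sigma3 f f) = 1}"
    then obtain f where y: "y = - inner_sigma3 f (conj_kac_gen f)" and f: "f \<in> L2_sigma3"
      and f1: "inner_sigma3 f (\<lambda>_. 1) = 0" "sqrt (inner_sigma3 f f) = 1" by auto
    have "(\<integral>v. f v \<partial>sigma3) = 0" "(\<integral>v. (f v)\<^sup>2 \<partial>sigma3) = 1"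
      using f1 by (simp_all add: inner_sigma3_def power2_eq_square)
    then show "0.01984 \<le> y"
      unfolding y conj_kac_gen_inner[OF f] using kac_dirichlet_form_bound[OF f] by simp
  qed
qed (rule kac_dirichlet_form_bound)

end
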